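(* Let $X$ be a topological space with subspaces $A,B,C$ such that $C\subseteq A\cap B$, and write $X_*=(X;A,B;C)$. Let $RX_*$ be the set of continuous maps $f:I^2\to X$ which map the edges $\partial_1^{\pm}I^2$ into $B$, the edges $\partial_2^{\pm}I^2$ into $A$, and all four vertices of $I^2$ into $C$. Let $\rho X_*$ be the quotient of $RX_*$ by the relation of homotopy rel vertices of $I^2$ and through elements of $RX_*$. Suppose that for all $c\in C$ the induced morphisms $\pi_2(A,c)\to\pi_2(X,c)$ and $\pi_2(B,c)\to\pi_2(X,c)$ have the same image. Then the compositions $\circ_1,\circ_2$ of squares are inherited by $\rho X_*$ to give it the structure of a double groupoid (with edge groupoids the fundamental groupoids $\pi_1(A,C)$ and $\pi_1(B,C)$). Further, under the same condition, the natural morphisms $$\pi_2(X,A;C)\to(\rho X_*,\circ_1),\qquad \pi_2(X,B;C)\to(\rho X_*,\circ_2)$$ are injective.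
   Context: $I=[0,1]$, with coordinates $(s_1,s_2)$ on $I^2$; direction 1 is drawn vertically (downwards) and direction 2 horizontally (to the right). $\partial_i^-I^2$ and $\partial_i^+I^2$ are the edges $s_i=0$ and $s_i=1$; for $f\in RX_*$, $\partial_i^\pm f$ is the restriction of $f$ to $\partial_i^\pm I^2$. So the left and right edges $\partial_2^\pm f$ are paths in $A$ with endpoints in $C$, and the top and bottom edges $\partial_1^\pm f$ are paths in $B$ with endpoints in $C$. On $RX_*$, $\alpha\circ_i\beta$ is the usual gluing (with rescaling) of squares in direction $i$, defined when $\partial_i^+\alpha=\partial_i^-\beta$. $\pi_1(A,C)$ denotes the fundamental groupoid of $A$ on the set $C$ of base points: homotopy classes rel endpoints of paths in $A$ with endpoints in $C$; similarly for $\pi_1(B,C)$. Inherited compositions: write $\langle\!\langle\alpha\rangle\!\rangle$ for the class of $\alpha$ in $\rho X_*$. The class $\langle\!\langle\alpha\rangle\!\rangle\circ_2\langle\!\langle\beta\rangle\!\rangle$ is defined when $\partial_2^+\alpha$ and $\partial_2^-\beta$ are homotopic in $A$ rel endpoints. In that case one chooses such a homotopy $h$, regarded as a square in $A$ with left edge $\partial_2^+\alpha$, right edge $\partial_2^-\beta$ and constant top and bottom edges, and sets $\langle\!\langle\alpha\rangle\!\rangle\circ_2\langle\!\langle\beta\rangle\!\rangle=\langle\!\langle\alpha\circ_2h\circ_2\beta\rangle\!\rangle$. Being inherited includes that this is independent of the choices. The composition $\circ_1$ on $\rho X_*$ is defined in the same way, with $\partial_1^+\alpha$ and $\partial_1^-\beta$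 homotopic in $B$ rel endpoints. Identities are given by the classes of the degenerate squares. Double groupoid: $\rho X_*$ is a groupoid under $\circ_2$ with object set $\pi_1(A,C)$ (source and target induced by $\partial_2^-,\partial_2^+$) and a groupoid under $\circ_1$ with object set $\pi_1(B,C)$ (source and target induced by $\partial_1^-,\partial_1^+$), both edge groupoids having object set $C$, with boundary and identity maps compatible with all compositions, and the interchange law holding. $\pi_2(X,A;C)$ is the family (totally disconnected groupoid over $C$) of the relative homotopy groups $\pi_2(X,A,c)$, $c\in C$. An element of $\pi_2(X,A,c)$ is represented by a map $I^2\to X$ sending one edge of direction 2 (say $\partial_2^-I^2$; the choice is immaterial by reflection) into $A$ and the other three edges to $c$, with homotopies through such maps, and group operation induced by gluing in direction 1. Such a map is an element of $RX_*$, and the natural morphism sends its class to its class in $\rho X_*$. Symmetrically, an element of $\pi_2(X,B,c)$ is represented by a map sending one edge of direction 1 (say $\partial_1^-I^2$) into $B$ and the other three edges to $c$, with group operation induced by gluing in direction 2. *)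

theory Defs
  imports "HOL-Analysis.Analysis"
begin

section \<open>Groupoids and double groupoids\<close>

text \<open>
  Composition is written in diagrammatic order: \<open>Cmp G f g\<close> is relevant
  when \<open>Tgt G f = Src G g\<close>, and its value is unconstrained otherwise.
\<close>

record ('o, 'm) gpd =
  Obj :: "'o set"
  Arr :: "'m set"
  Src :: "'m \<Rightarrow> 'o"
  Tgt :: "'m \<Rightarrow> 'o"
  Ide :: "'o \<Rightarrow> 'm"
  Cmp :: "'m \<Rightarrow> 'm \<Rightarrow> 'm"

definition groupoid :: "('o, 'm) gpd \<Rightarrow> bool" where
  "groupoid G \<longleftrightarrow>
     (\<forall>f\<in>Arr G. Src G f \<in> Obj G \<and> Tgt G f \<in> Obj G) \<and>
     (\<forall>x\<in>Obj G. Ide G x \<in> Arr G \<and> Src G (Ide G x) = x \<and> Tgt G (Ide G x) = x) \<and>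
     (\<forall>f\<in>Arr G. \<forall>g\<in>Arr G. Tgt G f = Src G g \<longrightarrow>
        Cmp G f g \<in> Arr G \<and> Src G (Cmp G f g) = Src G f \<and> Tgt G (Cmp G f g) = Tgt G g) \<and>
     (\<forall>f\<in>Arr G. \<forall>g\<in>Arr G. \<forall>h\<in>Arr G. Tgt G f = Src G g \<longrightarrow> Tgt G g = Src G h \<longrightarrow>
        Cmp G (Cmp G f g) h = Cmp G f (Cmp G g h)) \<and>
     (\<forall>f\<in>Arr G. Cmp G (Ide G (Src G f)) f = f \<and> Cmp G f (Ide G (Tgt G f)) = f) \<and>
     (\<forall>f\<in>Arr G. \<exists>g\<in>Arr G. Src G g = Tgt G f \<and> Tgt G g = Src G f \<and>
        Cmp G f g = Ide G (Src G f) \<and> Cmp G g f = Ide G (Tgt G f))"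

definition groupoid_hom ::
    "('o, 'm) gpd \<Rightarrow> ('p, 'n) gpd \<Rightarrow> ('o \<Rightarrow> 'p) \<Rightarrow> ('m \<Rightarrow> 'n) \<Rightarrow> bool" where
  "groupoid_hom G H F0 F \<longleftrightarrow>
     F0 \<in> Obj G \<rightarrow> Obj H \<and> F \<in> Arr G \<rightarrow> Arr H \<and>
     (\<forall>f\<in>Arr G. Src H (F f) = F0 (Src G f) \<and> Tgt H (F f) = F0 (Tgt G f)) \<and>
     (\<forall>x\<in>Obj G. F (Ide G x) = Ide H (F0 x)) \<and>
     (\<forall>f\<in>Arr G. \<forall>g\<in>Arr G. Tgt G f = Src G g \<longrightarrow> F (Cmp G f g) = Cmp H (F f) (F g))"

text \<open>
  \<open>V\<close> and \<open>H\<close> are the edge groupoids of vertical and horizontal edges.  \<open>D2\<close> and \<open>D1\<close> are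
  the two groupoid structures on the same set of squares: \<open>D2\<close> composes horizontally, with
  the left and right edges as source and target, \<open>D1\<close> composes vertically (downwards), with the
  top and bottom edges as source and target.
\<close>

definition double_groupoid ::
    "('p, 'v) gpd \<Rightarrow> ('p, 'h) gpd \<Rightarrow> ('h, 'd) gpd \<Rightarrow> ('v, 'd) gpd \<Rightarrow> bool" where
  "double_groupoid V H D1 D2 \<longleftrightarrow>
     groupoid V \<and> groupoid H \<and> groupoid D1 \<and> groupoid D2 \<and>
     Obj V = Obj H \<and> Obj D1 = Arr H \<and> Obj D2 = Arr V \<and> Arr D1 = Arr D2 \<and>
     \<comment> \<open>the two ways of reaching each corner agree\<close>
     (\<forall>x\<in>Arr D1.
        Src V (Src D2 x) = Src H (Src D1 x) \<and> Tgt V (Src D2 x) = Src H (Tgt D1 x) \<and>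
        Src V (Tgt D2 x) = Tgt H (Src D1 x) \<and> Tgt V (Tgt D2 x) = Tgt H (Tgt D1 x)) \<and>
     \<comment> \<open>the boundary maps of each structure respect the composition and identities of the other\<close>
     (\<forall>x\<in>Arr D1. \<forall>y\<in>Arr D1. Tgt D2 x = Src D2 y \<longrightarrow>
        Src D1 (Cmp D2 x y) = Cmp H (Src D1 x) (Src D1 y) \<and>
        Tgt D1 (Cmp D2 x y) = Cmp H (Tgt D1 x) (Tgt D1 y)) \<and>
     (\<forall>x\<in>Arr D1. \<forall>y\<in>Arr D1. Tgt D1 x = Src D1 y \<longrightarrow>
        Src D2 (Cmp D1 x y) = Cmp V (Src D2 x) (Src D2 y) \<and>
        Tgt D2 (Cmp D1 x y) = Cmp V (Tgt D2 x) (Tgt D2 y)) \<and>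
     (\<forall>v\<in>Arr V. Src D1 (Ide D2 v) = Ide H (Src V v) \<and> Tgt D1 (Ide D2 v) = Ide H (Tgt V v)) \<and>
     (\<forall>h\<in>Arr H. Src D2 (Ide D1 h) = Ide V (Src H h) \<and> Tgt D2 (Ide D1 h) = Ide V (Tgt H h)) \<and>
     \<comment> \<open>so do the identity maps\<close>
     (\<forall>v\<in>Arr V. \<forall>w\<in>Arr V. Tgt V v = Src V w \<longrightarrow>
        Ide D2 (Cmp V v w) = Cmp D1 (Ide D2 v) (Ide D2 w)) \<and>
     (\<forall>h\<in>Arr H. \<forall>k\<in>Arr H. Tgt H h = Src H k \<longrightarrow>
        Ide D1 (Cmp H h k) = Cmp D2 (Ide D1 h) (Ide D1 k)) \<and>
     (\<forall>p\<in>Obj V. Ide D2 (Ide V p) = Ide D1 (Ide H p)) \<and>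
     \<comment> \<open>interchange law\<close>
     (\<forall>x\<in>Arr D1. \<forall>y\<in>Arr D1. \<forall>z\<in>Arr D1. \<forall>w\<in>Arr D1.
        Tgt D2 x = Src D2 y \<longrightarrow> Tgt D2 z = Src D2 w \<longrightarrow>
        Tgt D1 x = Src D1 z \<longrightarrow> Tgt D1 y = Src D1 w \<longrightarrow>
        Cmp D1 (Cmp D2 x y) (Cmp D2 z w) = Cmp D2 (Cmp D1 x z) (Cmp D1 y w))"


section \<open>The fundamental groupoid on a set of base points\<close>

text \<open>
  Throughout, homotopy classes are sets of maps, and a map or operation on classes induced by one
  on representatives is written \<open>the_elem\<close> of the set of all classes obtained from all
  representatives: it has the intended value exactly when that set is a singleton, that is when
  the result does not depend on the representatives.  Maps on the unit interval or on the unit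
  square are, as usual, total functions of which only the restriction matters.
\<close>

definition path_class :: "'a::topological_space set \<Rightarrow> (real \<Rightarrow> 'a) \<Rightarrow> (real \<Rightarrow> 'a) set" where
  "path_class A p = {q. homotopic_paths A p q}"

definition paths_on :: "'a::topological_space set \<Rightarrow> 'a set \<Rightarrow> (real \<Rightarrow> 'a) set" where
  "paths_on A C = {p. path p \<and> path_image p \<subseteq> A \<and> pathstart p \<in> C \<and> pathfinish p \<in> C}"

definition fundamental_groupoid ::
    "'a::topological_space set \<Rightarrow> 'a set \<Rightarrow> ('a, (real \<Rightarrow> 'a) set) gpd" where
  "fundamental_groupoid A C =
     \<lparr> Obj = C,
       Arr = path_class A ` paths_on A C,
       Src = (\<lambda>P. the_elem (pathstart ` P)),
       Tgt = (\<lambda>P. the_elem (pathfinish ` P)),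
       Ide = (\<lambda>c. path_class A (\<lambda>_. c)),
       Cmp = (\<lambda>P Q. the_elem {path_class A (p +++ q) | p q.
                p \<in> P \<and> q \<in> Q \<and> pathfinish p = pathstart q}) \<rparr>"


section \<open>Squares\<close>

type_synonym 'a square = "real \<times> real \<Rightarrow> 'a"

abbreviation unit_square :: "(real \<times> real) set" where
  "unit_square \<equiv> {0..1} \<times> {0..1}"

text \<open>
  \<open>edge1 0\<close>, \<open>edge1 1\<close> are the restrictions to the top and bottom edges \<open>s1 = 0\<close>, \<open>s1 = 1\<close>;
  \<open>edge2 0\<close>, \<open>edge2 1\<close> are the restrictions to the left and right edges \<open>s2 = 0\<close>, \<open>s2 = 1\<close>.
\<close>

definition edge1 :: "real \<Rightarrow> 'a square \<Rightarrow> real \<Rightarrow> 'a" where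
  "edge1 e f = (\<lambda>t. f (e, t))"

definition edge2 :: "real \<Rightarrow> 'a square \<Rightarrow> real \<Rightarrow> 'a" where
  "edge2 e f = (\<lambda>t. f (t, e))"

definition glue1 :: "'a square \<Rightarrow> 'a square \<Rightarrow> 'a square" where
  "glue1 f g = (\<lambda>(s1, s2). if s1 \<le> 1/2 then f (2 * s1, s2) else g (2 * s1 - 1, s2))"

definition glue2 :: "'a square \<Rightarrow> 'a square \<Rightarrow> 'a square" where
  "glue2 f g = (\<lambda>(s1, s2). if s2 \<le> 1/2 then f (s1, 2 * s2) else g (s1, 2 * s2 - 1))"

definition degenerate1 :: "(real \<Rightarrow> 'a) \<Rightarrow> 'a square" where
  "degenerate1 p = (\<lambda>(s1, s2). p s2)"

definition degenerate2 :: "(real \<Rightarrow> 'a) \<Rightarrow> 'a square" where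
  "degenerate2 p = (\<lambda>(s1, s2). p s1)"

definition square_maps :: "'a::topological_space set \<Rightarrow> 'a square set" where
  "square_maps Y = {f. continuous_on unit_square f \<and> f \<in> unit_square \<rightarrow> Y}"

text \<open>Homotopy class of \<open>f\<close>, for homotopies of maps into \<open>Y\<close> that stay inside the set \<open>M\<close>.\<close>

definition square_class ::
    "'a square set \<Rightarrow> 'a::topological_space set \<Rightarrow> 'a square \<Rightarrow> 'a square set" where
  "square_class M Y f = {g. homotopic_with_canon (\<lambda>h. h \<in> M) unit_square Y f g}"

definition R_squares ::
    "'a::topological_space set \<Rightarrow> 'a set \<Rightarrow> 'a set \<Rightarrow> 'a set \<Rightarrow> 'a square set" where
  "R_squares X A B C =
     {f \<in> square_maps X.
        (\<forall>e\<in>{0, 1}. \<forall>t\<in>{0..1}. edge1 e f t \<in> B \<and> edge2 e f t \<in> A) \<and>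
        (\<forall>v\<in>{0, 1} \<times> {0, 1}. f v \<in> C)}"

definition rho_class ::
    "'a::topological_space set \<Rightarrow> 'a set \<Rightarrow> 'a set \<Rightarrow> 'a set \<Rightarrow> 'a square \<Rightarrow> 'a square set" where
  "rho_class X A B C f =
     square_class {h \<in> R_squares X A B C. \<forall>v\<in>{0, 1} \<times> {0, 1}. h v = f v} X f"

definition rho ::
    "'a::topological_space set \<Rightarrow> 'a set \<Rightarrow> 'a set \<Rightarrow> 'a set \<Rightarrow> 'a square set set" where
  "rho X A B C = rho_class X A B C ` R_squares X A B C"

text \<open>
  Homotopies rel endpoints in \<open>A\<close> from \<open>p\<close> to \<open>q\<close>, regarded as squares: \<open>connectors2\<close> has
  left edge \<open>p\<close>, right edge \<open>q\<close> and constant top and bottom edges; \<open>connectors1\<close> has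
  top edge \<open>p\<close>, bottom edge \<open>q\<close> and constant left and right edges.
\<close>

definition connectors1 ::
    "'a::topological_space set \<Rightarrow> (real \<Rightarrow> 'a) \<Rightarrow> (real \<Rightarrow> 'a) \<Rightarrow> 'a square set" where
  "connectors1 B p q =
     {h \<in> square_maps B. \<forall>t\<in>{0..1}.
        edge1 0 h t = p t \<and> edge1 1 h t = q t \<and> edge2 0 h t = p 0 \<and> edge2 1 h t = p 1}"

definition connectors2 ::
    "'a::topological_space set \<Rightarrow> (real \<Rightarrow> 'a) \<Rightarrow> (real \<Rightarrow> 'a) \<Rightarrow> 'a square set" where
  "connectors2 A p q =
     {h \<in> square_maps A. \<forall>t\<in>{0..1}.
        edge2 0 h t = p t \<and> edge2 1 h t = q t \<and> edge1 0 h t = p 0 \<and> edge1 1 h t = p 1}"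

text \<open>All the values that the composite of two classes can take, over all choices.\<close>

definition rho_composites1 ::
    "'a::topological_space set \<Rightarrow> 'a set \<Rightarrow> 'a set \<Rightarrow> 'a set \<Rightarrow>
     'a square set \<Rightarrow> 'a square set \<Rightarrow> 'a square set set" where
  "rho_composites1 X A B C S T =
     {rho_class X A B C (glue1 (glue1 \<alpha> h) \<beta>) | \<alpha> h \<beta>.
        \<alpha> \<in> S \<and> \<beta> \<in> T \<and> h \<in> connectors1 B (edge1 1 \<alpha>) (edge1 0 \<beta>)}"

definition rho_composites2 ::
    "'a::topological_space set \<Rightarrow> 'a set \<Rightarrow> 'a set \<Rightarrow> 'a set \<Rightarrow>
     'a square set \<Rightarrow> 'a square set \<Rightarrow> 'a square set set" where
  "rho_composites2 X A B C S T =
     {rho_class X A B C (glue2 (glue2 \<alpha> h) \<beta>) | \<alpha> h \<beta>.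
        \<alpha> \<in> S \<and> \<beta> \<in> T \<and> h \<in> connectors2 A (edge2 1 \<alpha>) (edge2 0 \<beta>)}"

definition rho1 ::
    "'a::topological_space set \<Rightarrow> 'a set \<Rightarrow> 'a set \<Rightarrow> 'a set \<Rightarrow>
     ((real \<Rightarrow> 'a) set, 'a square set) gpd" where
  "rho1 X A B C =
     \<lparr> Obj = Arr (fundamental_groupoid B C),
       Arr = rho X A B C,
       Src = (\<lambda>S. the_elem ((\<lambda>\<alpha>. path_class B (edge1 0 \<alpha>)) ` S)),
       Tgt = (\<lambda>S. the_elem ((\<lambda>\<alpha>. path_class B (edge1 1 \<alpha>)) ` S)),
       Ide = (\<lambda>P. the_elem ((\<lambda>p. rho_class X A B C (degenerate1 p)) ` P)),
       Cmp = (\<lambda>S T. the_elem (rho_composites1 X A B C S T)) \<rparr>"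

definition rho2 ::
    "'a::topological_space set \<Rightarrow> 'a set \<Rightarrow> 'a set \<Rightarrow> 'a set \<Rightarrow>
     ((real \<Rightarrow> 'a) set, 'a square set) gpd" where
  "rho2 X A B C =
     \<lparr> Obj = Arr (fundamental_groupoid A C),
       Arr = rho X A B C,
       Src = (\<lambda>S. the_elem ((\<lambda>\<alpha>. path_class A (edge2 0 \<alpha>)) ` S)),
       Tgt = (\<lambda>S. the_elem ((\<lambda>\<alpha>. path_class A (edge2 1 \<alpha>)) ` S)),
       Ide = (\<lambda>P. the_elem ((\<lambda>p. rho_class X A B C (degenerate2 p)) ` P)),
       Cmp = (\<lambda>S T. the_elem (rho_composites2 X A B C S T)) \<rparr>"

text \<open>
  The compositions of squares are inherited by the quotient: whenever the adjacent edges are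
  homotopic, a composite of the classes exists and is independent of all choices; and if the
  squares themselves can be glued, the composite is the class of the glued square.
\<close>

definition composition1_inherited ::
    "'a::topological_space set \<Rightarrow> 'a set \<Rightarrow> 'a set \<Rightarrow> 'a set \<Rightarrow> bool" where
  "composition1_inherited X A B C \<longleftrightarrow>
     (\<forall>\<alpha>\<in>R_squares X A B C. \<forall>\<beta>\<in>R_squares X A B C.
        (homotopic_paths B (edge1 1 \<alpha>) (edge1 0 \<beta>) \<longrightarrow>
           (\<exists>\<gamma>\<in>rho X A B C.
              rho_composites1 X A B C (rho_class X A B C \<alpha>) (rho_class X A B C \<beta>) = {\<gamma>})) \<and>
        ((\<forall>t\<in>{0..1}. edge1 1 \<alpha> t = edge1 0 \<beta> t) \<longrightarrow>
           Cmp (rho1 X A B C) (rho_class X A B C \<alpha>) (rho_class X A B C \<beta>)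
             = rho_class X A B C (glue1 \<alpha> \<beta>)))"

definition composition2_inherited ::
    "'a::topological_space set \<Rightarrow> 'a set \<Rightarrow> 'a set \<Rightarrow> 'a set \<Rightarrow> bool" where
  "composition2_inherited X A B C \<longleftrightarrow>
     (\<forall>\<alpha>\<in>R_squares X A B C. \<forall>\<beta>\<in>R_squares X A B C.
        (homotopic_paths A (edge2 1 \<alpha>) (edge2 0 \<beta>) \<longrightarrow>
           (\<exists>\<gamma>\<in>rho X A B C.
              rho_composites2 X A B C (rho_class X A B C \<alpha>) (rho_class X A B C \<beta>) = {\<gamma>})) \<and>
        ((\<forall>t\<in>{0..1}. edge2 1 \<alpha> t = edge2 0 \<beta> t) \<longrightarrow>
           Cmp (rho2 X A B C) (rho_class X A B C \<alpha>) (rho_class X A B C \<beta>)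
             = rho_class X A B C (glue2 \<alpha> \<beta>)))"


section \<open>Absolute and relative second homotopy groups\<close>

definition pi2_maps :: "'a::topological_space set \<Rightarrow> 'a \<Rightarrow> 'a square set" where
  "pi2_maps Y c =
     {f \<in> square_maps Y. \<forall>e\<in>{0, 1}. \<forall>t\<in>{0..1}. edge1 e f t = c \<and> edge2 e f t = c}"

definition pi2_class :: "'a::topological_space set \<Rightarrow> 'a \<Rightarrow> 'a square \<Rightarrow> 'a square set" where
  "pi2_class Y c = square_class (pi2_maps Y c) Y"

definition pi2 :: "'a::topological_space set \<Rightarrow> 'a \<Rightarrow> 'a square set set" where
  "pi2 Y c = pi2_class Y c ` pi2_maps Y c"

text \<open>The map from \<open>pi2 Y c\<close> to \<open>pi2 X c\<close> induced by an inclusion of \<open>Y\<close> into \<open>X\<close>;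
  it does not mention \<open>Y\<close>, since the representatives stay the same.\<close>

definition pi2_induced ::
    "'a::topological_space set \<Rightarrow> 'a \<Rightarrow> 'a square set \<Rightarrow> 'a square set" where
  "pi2_induced X c S = the_elem (pi2_class X c ` S)"

text \<open>
  Relative maps.  In \<open>rel_maps2 X A c\<close> the left edge goes to \<open>A\<close> and the other three edges to
  \<open>c\<close>; in \<open>rel_maps1 X B c\<close> the top edge goes to \<open>B\<close> and the other three edges to \<open>c\<close>.
\<close>

definition rel_maps2 :: "'a::topological_space set \<Rightarrow> 'a set \<Rightarrow> 'a \<Rightarrow> 'a square set" where
  "rel_maps2 X A c =
     {f \<in> square_maps X. \<forall>t\<in>{0..1}.
        edge2 0 f t \<in> A \<and> edge2 1 f t = c \<and> edge1 0 f t = c \<and> edge1 1 f t = c}"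

definition rel_maps1 :: "'a::topological_space set \<Rightarrow> 'a set \<Rightarrow> 'a \<Rightarrow> 'a square set" where
  "rel_maps1 X B c =
     {f \<in> square_maps X. \<forall>t\<in>{0..1}.
        edge1 0 f t \<in> B \<and> edge1 1 f t = c \<and> edge2 0 f t = c \<and> edge2 1 f t = c}"

definition rel_class2 ::
    "'a::topological_space set \<Rightarrow> 'a set \<Rightarrow> 'a \<Rightarrow> 'a square \<Rightarrow> 'a square set" where
  "rel_class2 X A c = square_class (rel_maps2 X A c) X"

definition rel_class1 ::
    "'a::topological_space set \<Rightarrow> 'a set \<Rightarrow> 'a \<Rightarrow> 'a square \<Rightarrow> 'a square set" where
  "rel_class1 X B c = square_class (rel_maps1 X B c) X"

text \<open>
  The families of relative homotopy groups over \<open>C\<close>, as totally disconnected groupoids; an arrow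
  is a class tagged with its base point.  The group operation of \<open>rel_pi2_2\<close> is gluing in
  direction 1, that of \<open>rel_pi2_1\<close> is gluing in direction 2.
\<close>

definition rel_pi2_2 ::
    "'a::topological_space set \<Rightarrow> 'a set \<Rightarrow> 'a set \<Rightarrow> ('a, 'a \<times> 'a square set) gpd" where
  "rel_pi2_2 X A C =
     \<lparr> Obj = C,
       Arr = (SIGMA c:C. rel_class2 X A c ` rel_maps2 X A c),
       Src = fst,
       Tgt = fst,
       Ide = (\<lambda>c. (c, rel_class2 X A c (\<lambda>_. c))),
       Cmp = (\<lambda>(c, S) (_, T). (c, the_elem {rel_class2 X A c (glue1 f g) | f g. f \<in> S \<and> g \<in> T})) \<rparr>"

definition rel_pi2_1 ::
    "'a::topological_space set \<Rightarrow> 'a set \<Rightarrow> 'a set \<Rightarrow> ('a, 'a \<times> 'a square set) gpd" where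
  "rel_pi2_1 X B C =
     \<lparr> Obj = C,
       Arr = (SIGMA c:C. rel_class1 X B c ` rel_maps1 X B c),
       Src = fst,
       Tgt = fst,
       Ide = (\<lambda>c. (c, rel_class1 X B c (\<lambda>_. c))),
       Cmp = (\<lambda>(c, S) (_, T). (c, the_elem {rel_class1 X B c (glue2 f g) | f g. f \<in> S \<and> g \<in> T})) \<rparr>"

text \<open>The same formula sends the class of a relative map of either kind to its class in \<open>rho\<close>.\<close>

definition natural_map ::
    "'a::topological_space set \<Rightarrow> 'a set \<Rightarrow> 'a set \<Rightarrow> 'a set \<Rightarrow>
     'a \<times> 'a square set \<Rightarrow> 'a square set" where
  "natural_map X A B C = (\<lambda>(c, S). the_elem (rho_class X A B C ` S))"

end

theory Submission
  imports Defs
begin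

text \<open>
  The only obstacle to composing homotopy classes of squares vertically is the choice of the
  homotopy, inside \<open>B\<close> and rel end points, that joins the bottom edge of the upper square to the
  top edge of the lower one.  Two choices differ by a loop of paths: a homotopy in \<open>B\<close> from an
  edge \<open>q\<close> to itself.  Joined to the base point \<open>c = q 0\<close> along \<open>q\<close>, this loop is an element
  of the second homotopy group of \<open>B\<close> at \<open>c\<close>.  By hypothesis its image in the group of \<open>X\<close> also
  comes from \<open>A\<close>, so a homotopy inside \<open>X\<close> turns the loop into a small sphere \<open>k\<close> in \<open>A\<close> attached
  to the constant loop at \<open>q\<close>.  The left edge of a square may move freely in \<open>A\<close>, hence \<open>k\<close> can be
  pushed out of the square through the left edge, and the loop has disappeared.  This is
  \<open>glue1_loop\<close>.

  Now let two squares that can be glued be deformed independently.  Their adjacent edges trace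
  out homotopies in \<open>B\<close>, one of which followed by the reverse of the other is again a loop of
  paths, so \<open>glue1_homotopic\<close> follows: gluing squares with equal adjacent edges respects homotopy.
  Every class that is composable with the class of \<open>f\<close> contains a square whose edge is exactly
  that of \<open>f\<close> (\<open>rho_match1\<close>, \<open>rho_match2\<close>), so all the axioms can be checked on such
  representatives.  There associativity, units and inverses are reparametrizations of one
  coordinate, and interchange is an equality of functions.  Reflection in the diagonal exchanges
  \<open>A\<close> with \<open>B\<close> and the two directions, and the hypothesis is symmetric in \<open>A\<close> and \<open>B\<close>; this
  gives the horizontal structure.

  For injectivity, let \<open>H\<close> be a homotopy in \<open>R_squares\<close> between two relative maps \<open>f\<close> and \<open>g\<close>.
  The corners stay at \<open>c\<close>, and the top and bottom edges of \<open>f\<close> and \<open>g\<close> are constant, so the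
  top and the bottom face of the cube \<open>H\<close> are spheres in \<open>B\<close>.  By hypothesis they can be replaced by
  spheres in \<open>A\<close>, at the cost of enlarging \<open>H\<close>.  Then the whole boundary of the square moves
  in \<open>A\<close>, and it can be swept into the left edge (\<open>rel_class2_compression\<close>).  The result is a
  homotopy through relative maps.
\<close>

section \<open>Homotopies of squares as cubes\<close>

lemma continuous_on_path_compose:
  assumes "continuous_on {0..1} q" "continuous_on S \<phi>" "\<And>x. x \<in> S \<Longrightarrow> \<phi> x \<in> {0..1::real}"
  shows "continuous_on S (\<lambda>x. q (\<phi> x))"
  by (rule continuous_on_compose2[OF assms(1,2)]) (use assms(3) in auto)

lemma continuous_on_square_compose:
  assumes "continuous_on unit_square f" "continuous_on S \<phi>" "continuous_on S \<psi>"
    "\<And>x. x \<in> S \<Longrightarrow> \<phi> x \<in> {0..1} \<and> \<psi> x \<in> {0..1}"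
  shows "continuous_on S (\<lambda>x. f (\<phi> x, \<psi> x))"
  by (rule continuous_on_compose2[OF assms(1)])
    (use assms(4) in \<open>auto intro!: continuous_intros assms(2,3)\<close>)

definition continuous_cube :: "(real \<Rightarrow> real \<Rightarrow> real \<Rightarrow> 'a::topological_space) \<Rightarrow> bool" where
  "continuous_cube H \<longleftrightarrow> continuous_on ({0..1} \<times> unit_square) (\<lambda>(t, s1, s2). H t s1 s2)"

lemma continuous_on_cube_compose:
  assumes "continuous_cube H" "continuous_on S \<tau>" "continuous_on S \<phi>" "continuous_on S \<psi>"
    "\<And>x. x \<in> S \<Longrightarrow> \<tau> x \<in> {0..1} \<and> \<phi> x \<in> {0..1} \<and> \<psi> x \<in> {0..1}"
  shows "continuous_on S (\<lambda>x. H (\<tau> x) (\<phi> x) (\<psi> x))"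
proof -
  have "continuous_on S (\<lambda>x. (\<lambda>(t, s1, s2). H t s1 s2) (\<tau> x, \<phi> x, \<psi> x))"
    by (rule continuous_on_compose2[OF assms(1)[unfolded continuous_cube_def]])
      (use assms(5) in \<open>auto intro!: continuous_intros assms(2,3,4)\<close>)
  then show ?thesis by simp
qed

lemma continuous_cubeI:
  assumes "continuous_on ({0..1} \<times> unit_square) (\<lambda>x. H (fst x) (fst (snd x)) (snd (snd x)))"
  shows "continuous_cube H"
  using assms by (simp add: continuous_cube_def case_prod_unfold)

lemma continuous_cube_slice:
  assumes "continuous_cube H" "t \<in> {0..1}"
  shows "continuous_on unit_square (\<lambda>(s1, s2). H t s1 s2)"
proof -
  have "continuous_on unit_square (\<lambda>x. H t (fst x) (snd x))"
    by (rule continuous_on_cube_compose[OF assms(1)]) (use assms(2) in \<open>auto intro!: continuous_intros\<close>)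
  then show ?thesis by (simp add: case_prod_unfold)
qed

text \<open>
  A homotopy in the sense of \<open>homotopic_with\<close> has prescribed ends even outside the unit square.  If
  membership in \<open>M\<close> depends only on the values on the unit square, a cube that has the right ends
  there can be redefined outside.
\<close>

lemma square_class_iff:
  assumes loc: "\<And>f g. f \<in> M \<Longrightarrow> (\<And>z. z \<in> unit_square \<Longrightarrow> f z = g z) \<Longrightarrow> g \<in> M"
    and sub: "M \<subseteq> square_maps Y"
  shows "g \<in> square_class M Y f \<longleftrightarrow>
    (\<exists>H. continuous_cube H \<and> (\<forall>t\<in>{0..1}. (\<lambda>(s1, s2). H t s1 s2) \<in> M) \<and>
      (\<forall>s1\<in>{0..1}. \<forall>s2\<in>{0..1}. H 0 s1 s2 = f (s1, s2) \<and> H 1 s1 s2 = g (s1, s2)))"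
    (is "?L \<longleftrightarrow> ?R")
proof -
  have loc': "h \<in> M \<longleftrightarrow> k \<in> M" if "\<And>x. x \<in> topspace (top_of_set unit_square) \<Longrightarrow> h x = k x" for h k
    using loc[of h k] loc[of k h] that by auto
  have "?L \<longleftrightarrow> (\<exists>h. continuous_map (prod_topology (top_of_set {0..1::real}) (top_of_set unit_square)) (top_of_set Y) h \<and>
              (\<forall>x \<in> topspace (top_of_set unit_square). h(0,x) = f x) \<and>
              (\<forall>x \<in> topspace (top_of_set unit_square). h(1,x) = g x) \<and>
              (\<forall>t \<in> {0..1}. (\<lambda>x. h(t, x)) \<in> M))"
    unfolding square_class_def mem_Collect_eq
    by (rule homotopic_with[where P = "\<lambda>h. h \<in> M"]) (rule loc')
  also have "\<dots> \<longleftrightarrow> ?R"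
  proof
    assume "\<exists>h. continuous_map (prod_topology (top_of_set {0..1::real}) (top_of_set unit_square)) (top_of_set Y) h \<and>
              (\<forall>x \<in> topspace (top_of_set unit_square). h(0,x) = f x) \<and>
              (\<forall>x \<in> topspace (top_of_set unit_square). h(1,x) = g x) \<and>
              (\<forall>t \<in> {0..1}. (\<lambda>x. h(t, x)) \<in> M)"
    then obtain h where h: "continuous_map (prod_topology (top_of_set {0..1::real}) (top_of_set unit_square)) (top_of_set Y) h"
      "\<forall>x \<in> unit_square. h(0::real,x) = f x" "\<forall>x \<in> unit_square. h(1,x) = g x"
      "\<forall>t \<in> {0..1}. (\<lambda>x. h(t, x)) \<in> M"
      by auto
    have "continuous_on ({0..1} \<times> unit_square) h"
      using h(1) by (simp add: prod_topology_subtopology_eu)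
    then show ?R
      using h(2-4) by (intro exI[of _ "\<lambda>t s1 s2. h (t, s1, s2)"]) (auto simp: continuous_cube_def case_prod_unfold)
  next
    assume ?R
    then obtain H where H: "continuous_cube H" "\<forall>t\<in>{0..1}. (\<lambda>(s1, s2). H t s1 s2) \<in> M"
      "\<forall>s1\<in>{0..1}. \<forall>s2\<in>{0..1}. H 0 s1 s2 = f (s1, s2) \<and> H 1 s1 s2 = g (s1, s2)" by blast
    have Y: "H t s1 s2 \<in> Y" if "t \<in> {0..1}" "s1 \<in> {0..1}" "s2 \<in> {0..1}" for t s1 s2
    proof -
      have "(\<lambda>(s1, s2). H t s1 s2) \<in> square_maps Y" using H(2) sub that by blast
      then show ?thesis using that by (auto simp: square_maps_def Pi_iff)
    qed
    show "\<exists>h. continuous_map (prod_topology (top_of_set {0..1::real}) (top_of_set unit_square)) (top_of_set Y) h \<and>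
              (\<forall>x \<in> topspace (top_of_set unit_square). h(0,x) = f x) \<and>
              (\<forall>x \<in> topspace (top_of_set unit_square). h(1,x) = g x) \<and>
              (\<forall>t \<in> {0..1}. (\<lambda>x. h(t, x)) \<in> M)"
      using H Y
      by (intro exI[of _ "\<lambda>(t, s1, s2). H t s1 s2"])
        (auto simp: continuous_cube_def prod_topology_subtopology_eu case_prod_unfold Pi_iff)
  qed
  finally show ?thesis .
qed

lemma square_class_refl:
  assumes "f \<in> M" "M \<subseteq> square_maps Y" shows "f \<in> square_class M Y f"
  using assms by (auto simp: square_class_def square_maps_def)

lemma square_class_sym: "g \<in> square_class M Y f \<Longrightarrow> f \<in> square_class M Y g"
  by (auto simp: square_class_def intro: homotopic_with_symD)

lemma square_class_trans: "g \<in> square_class M Y f \<Longrightarrow> h \<in> square_class M Y g \<Longrightarrow> h \<in> square_class M Y f"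
  by (auto simp: square_class_def intro: homotopic_with_trans)

lemma square_class_eq: "g \<in> square_class M Y f \<Longrightarrow> square_class M Y g = square_class M Y f"
  using square_class_sym square_class_trans by blast

lemma square_class_memD: "g \<in> square_class M Y f \<Longrightarrow> f \<in> M \<and> g \<in> M"
  unfolding square_class_def mem_Collect_eq by (drule homotopic_with_imp_property) simp

lemma square_maps_iff:
  "f \<in> square_maps Y \<longleftrightarrow> continuous_on unit_square f \<and> (\<forall>a\<in>{0..1}. \<forall>b\<in>{0..1}. f (a, b) \<in> Y)"
  by (auto simp: square_maps_def)

lemma square_maps_cong:
  assumes "f \<in> square_maps Y" "\<And>z. z \<in> unit_square \<Longrightarrow> f z = g z" shows "g \<in> square_maps Y"
proof -
  have "continuous_on unit_square g" using assms by (auto simp: square_maps_def cong: continuous_on_cong)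
  then show ?thesis using assms by (auto simp: square_maps_def Pi_iff)
qed

section \<open>The homotopy relation between squares\<close>

lemma R_squares_iff:
  "f \<in> R_squares X A B C \<longleftrightarrow> continuous_on unit_square f \<and> (\<forall>a\<in>{0..1}. \<forall>b\<in>{0..1}. f (a, b) \<in> X) \<and>
     (\<forall>s\<in>{0..1}. f (0, s) \<in> B \<and> f (1, s) \<in> B \<and> f (s, 0) \<in> A \<and> f (s, 1) \<in> A) \<and>
     f (0, 0) \<in> C \<and> f (0, 1) \<in> C \<and> f (1, 0) \<in> C \<and> f (1, 1) \<in> C"
  by (auto simp: R_squares_def square_maps_iff edge1_def edge2_def)

lemma R_squaresD:
  assumes "f \<in> R_squares X A B C"
  shows "continuous_on unit_square f"
    and "\<And>a b. a \<in> {0..1} \<Longrightarrow> b \<in> {0..1} \<Longrightarrow> f (a, b) \<in> X"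
    and "\<And>s. s \<in> {0..1} \<Longrightarrow> f (0, s) \<in> B \<and> f (1, s) \<in> B"
    and "\<And>s. s \<in> {0..1} \<Longrightarrow> f (s, 0) \<in> A \<and> f (s, 1) \<in> A"
    and "f (0, 0) \<in> C" "f (0, 1) \<in> C" "f (1, 0) \<in> C" "f (1, 1) \<in> C"
  using assms unfolding R_squares_iff by blast+

lemma R_squares_cong:
  assumes "f \<in> R_squares X A B C" "\<And>z. z \<in> unit_square \<Longrightarrow> f z = g z"
  shows "g \<in> R_squares X A B C"
proof -
  have "continuous_on unit_square g"
    using assms by (auto simp: R_squares_iff cong: continuous_on_cong)
  then show ?thesis using assms by (auto simp: R_squares_iff)
qed

text \<open>
  Membership in a class, read as a relation: this allows chains of homotopies.
\<close>

definition rho_homotopic ::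
    "'a::topological_space set \<Rightarrow> 'a set \<Rightarrow> 'a set \<Rightarrow> 'a set \<Rightarrow> 'a square \<Rightarrow> 'a square \<Rightarrow> bool" where
  "rho_homotopic X A B C f g \<longleftrightarrow> g \<in> rho_class X A B C f"

text \<open>
  The ends of the homotopy are not named, so that cubes can be glued and reparametrized before
  their ends are identified.
\<close>

definition rho_homotopy ::
    "'a::topological_space set \<Rightarrow> 'a set \<Rightarrow> 'a set \<Rightarrow> 'a set \<Rightarrow> (real \<Rightarrow> real \<Rightarrow> real \<Rightarrow> 'a) \<Rightarrow> bool" where
  "rho_homotopy X A B C H \<longleftrightarrow> continuous_cube H \<and>
     (\<forall>t\<in>{0..1}. (\<lambda>(s1, s2). H t s1 s2) \<in> R_squares X A B C) \<and>
     (\<forall>t\<in>{0..1}. \<forall>a\<in>{0, 1}. \<forall>b\<in>{0, 1}. H t a b = H 0 a b)"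

lemma rho_homotopic_iff:
  "rho_homotopic X A B C f g \<longleftrightarrow> (\<exists>H. rho_homotopy X A B C H \<and>
      (\<forall>s1\<in>{0..1}. \<forall>s2\<in>{0..1}. H 0 s1 s2 = f (s1, s2) \<and> H 1 s1 s2 = g (s1, s2)))"
proof -
  let ?M = "{h \<in> R_squares X A B C. \<forall>v\<in>{0, 1} \<times> {0, 1}. h v = f v}"
  have "rho_homotopic X A B C f g \<longleftrightarrow>
    (\<exists>H. continuous_cube H \<and> (\<forall>t\<in>{0..1}. (\<lambda>(s1, s2). H t s1 s2) \<in> ?M) \<and>
      (\<forall>s1\<in>{0..1}. \<forall>s2\<in>{0..1}. H 0 s1 s2 = f (s1, s2) \<and> H 1 s1 s2 = g (s1, s2)))"
    unfolding rho_homotopic_def rho_class_def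
  proof (rule square_class_iff)
    show "?M \<subseteq> square_maps X" by (auto simp: R_squares_def)
    show "k \<in> ?M" if "h \<in> ?M" "\<And>z. z \<in> unit_square \<Longrightarrow> h z = k z" for h k
      using that R_squares_cong[of h X A B C k] by auto
  qed
  also have "\<dots> \<longleftrightarrow> (\<exists>H. rho_homotopy X A B C H \<and>
      (\<forall>s1\<in>{0..1}. \<forall>s2\<in>{0..1}. H 0 s1 s2 = f (s1, s2) \<and> H 1 s1 s2 = g (s1, s2)))"
    unfolding rho_homotopy_def by (rule ex_cong1) auto
  finally show ?thesis .
qed

lemma rho_homotopicI:
  assumes "rho_homotopy X A B C H"
    and "\<And>s1 s2. s1 \<in> {0..1} \<Longrightarrow> s2 \<in> {0..1} \<Longrightarrow> H 0 s1 s2 = f (s1, s2)"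
    and "\<And>s1 s2. s1 \<in> {0..1} \<Longrightarrow> s2 \<in> {0..1} \<Longrightarrow> H 1 s1 s2 = g (s1, s2)"
  shows "rho_homotopic X A B C f g"
  using assms unfolding rho_homotopic_iff by blast

lemma rho_homotopyI:
  assumes "continuous_cube H"
    and "\<And>t a b. t \<in> {0..1} \<Longrightarrow> a \<in> {0..1} \<Longrightarrow> b \<in> {0..1} \<Longrightarrow> H t a b \<in> X"
    and "\<And>t s. t \<in> {0..1} \<Longrightarrow> s \<in> {0..1} \<Longrightarrow> H t 0 s \<in> B \<and> H t 1 s \<in> B"
    and "\<And>t s. t \<in> {0..1} \<Longrightarrow> s \<in> {0..1} \<Longrightarrow> H t s 0 \<in> A \<and> H t s 1 \<in> A"
    and "\<And>t. t \<in> {0..1} \<Longrightarrow> H t 0 0 = nw \<and> H t 0 1 = ne \<and> H t 1 0 = sw \<and> H t 1 1 = se"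
    and "{nw, ne, sw, se} \<subseteq> C"
  shows "rho_homotopy X A B C H"
  using assms unfolding rho_homotopy_def R_squares_iff
  by (auto intro: continuous_cube_slice)

lemma rho_homotopyD:
  assumes H: "rho_homotopy X A B C H"
  shows "continuous_cube H"
    and "\<And>t a b. t \<in> {0..1} \<Longrightarrow> a \<in> {0..1} \<Longrightarrow> b \<in> {0..1} \<Longrightarrow> H t a b \<in> X"
    and "\<And>t s. t \<in> {0..1} \<Longrightarrow> s \<in> {0..1} \<Longrightarrow> H t 0 s \<in> B \<and> H t 1 s \<in> B"
    and "\<And>t s. t \<in> {0..1} \<Longrightarrow> s \<in> {0..1} \<Longrightarrow> H t s 0 \<in> A \<and> H t s 1 \<in> A"
    and "\<And>t. t \<in> {0..1} \<Longrightarrow> H t 0 0 = H 0 0 0 \<and> H t 0 1 = H 0 0 1 \<and> H t 1 0 = H 0 1 0 \<and> H t 1 1 = H 0 1 1"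
    and "{H 0 0 0, H 0 0 1, H 0 1 0, H 0 1 1} \<subseteq> C"
proof -
  have R: "(\<lambda>(s1, s2). H t s1 s2) \<in> R_squares X A B C" if "t \<in> {0..1}" for t
    using H that unfolding rho_homotopy_def by blast
  show "continuous_cube H" using H by (simp add: rho_homotopy_def)
  show "\<And>t a b. t \<in> {0..1} \<Longrightarrow> a \<in> {0..1} \<Longrightarrow> b \<in> {0..1} \<Longrightarrow> H t a b \<in> X"
    using R unfolding R_squares_iff by simp
  show "\<And>t s. t \<in> {0..1} \<Longrightarrow> s \<in> {0..1} \<Longrightarrow> H t 0 s \<in> B \<and> H t 1 s \<in> B"
    using R unfolding R_squares_iff by simp
  show "\<And>t s. t \<in> {0..1} \<Longrightarrow> s \<in> {0..1} \<Longrightarrow> H t s 0 \<in> A \<and> H t s 1 \<in> A"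
    using R unfolding R_squares_iff by simp
  show "\<And>t. t \<in> {0..1} \<Longrightarrow> H t 0 0 = H 0 0 0 \<and> H t 0 1 = H 0 0 1 \<and> H t 1 0 = H 0 1 0 \<and> H t 1 1 = H 0 1 1"
    using H unfolding rho_homotopy_def by blast
  show "{H 0 0 0, H 0 0 1, H 0 1 0, H 0 1 1} \<subseteq> C"
    using R[of 0] unfolding R_squares_iff by simp
qed

lemma rho_homotopic_refl: "f \<in> R_squares X A B C \<Longrightarrow> rho_homotopic X A B C f f"
  unfolding rho_homotopic_def rho_class_def by (rule square_class_refl) (auto simp: R_squares_def)

lemma rho_homotopic_memD:
  assumes "rho_homotopic X A B C f g"
  shows "f \<in> R_squares X A B C" "g \<in> R_squares X A B C"
    and "\<And>v. v \<in> {0, 1} \<times> {0, 1} \<Longrightarrow> g v = f v"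
  using square_class_memD[OF assms[unfolded rho_homotopic_def rho_class_def]] by auto

lemma rho_class_eqI:
  assumes "rho_homotopic X A B C f g" shows "rho_class X A B C g = rho_class X A B C f"
proof -
  have "{h \<in> R_squares X A B C. \<forall>v\<in>{0, 1} \<times> {0, 1}. h v = g v}
      = {h \<in> R_squares X A B C. \<forall>v\<in>{0, 1} \<times> {0, 1}. h v = f v}"
    using rho_homotopic_memD(3)[OF assms] by auto
  then show ?thesis
    using square_class_eq[OF assms[unfolded rho_homotopic_def rho_class_def]] by (simp add: rho_class_def)
qed

lemma rho_homotopic_sym: "rho_homotopic X A B C f g \<Longrightarrow> rho_homotopic X A B C g f"
  using rho_class_eqI rho_homotopic_memD rho_homotopic_refl rho_homotopic_def by metis

lemma rho_homotopic_trans [trans]: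
  "rho_homotopic X A B C f g \<Longrightarrow> rho_homotopic X A B C g h \<Longrightarrow> rho_homotopic X A B C f h"
  using rho_class_eqI rho_homotopic_def by metis

lemma rho_class_eq_iff:
  "f \<in> R_squares X A B C \<Longrightarrow> rho_class X A B C f = rho_class X A B C g \<longleftrightarrow> rho_homotopic X A B C g f"
  using rho_class_eqI rho_homotopic_refl rho_homotopic_def by metis

lemma rho_homotopy_const:
  assumes "f \<in> R_squares X A B C" shows "rho_homotopy X A B C (\<lambda>t s1 s2. f (s1, s2))"
proof (rule rho_homotopyI[where nw = "f (0, 0)" and ne = "f (0, 1)" and sw = "f (1, 0)" and se = "f (1, 1)"])
  have "continuous_on unit_square f" using assms by (simp add: R_squares_iff)
  then show "continuous_cube (\<lambda>t s1 s2. f (s1, s2))"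
    by (intro continuous_cubeI continuous_on_square_compose[of f] continuous_intros) auto
qed (use R_squaresD[OF assms] in simp_all)

section \<open>Vertical gluing\<close>

lemma continuous_on_if_half:
  fixes h :: "'b::topological_space \<Rightarrow> real"
  assumes "continuous_on S h" "continuous_on {x \<in> S. h x \<le> 1/2} f" "continuous_on {x \<in> S. 1/2 \<le> h x} g"
    "\<And>x. x \<in> S \<Longrightarrow> h x = 1/2 \<Longrightarrow> f x = g x"
  shows "continuous_on S (\<lambda>x. if h x \<le> 1/2 then f x else g x)"
  using assms by (intro continuous_on_cases_le)

lemma rho_homotopy_glue1:
  assumes H: "rho_homotopy X A B C H" and K: "rho_homotopy X A B C K"
    and HK: "\<And>t s. t \<in> {0..1} \<Longrightarrow> s \<in> {0..1} \<Longrightarrow> H t 1 s = K t 0 s"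
  shows "rho_homotopy X A B C (\<lambda>t s1 s2. if s1 \<le> 1/2 then H t (2 * s1) s2 else K t (2 * s1 - 1) s2)"
proof (rule rho_homotopyI)
  note h = rho_homotopyD[OF H] and k = rho_homotopyD[OF K]
  have half: "H t (2 * a) s = K t (2 * a - 1) s"
    if "t \<in> {0..1}" "s \<in> {0..1}" "a * 2 = 1" for t a s :: real
    using HK[of t s] that by (simp add: mult.commute)
  show "continuous_cube (\<lambda>t s1 s2. if s1 \<le> 1/2 then H t (2 * s1) s2 else K t (2 * s1 - 1) s2)"
    by (intro continuous_cubeI continuous_on_if_half continuous_on_cube_compose[OF h(1)]
        continuous_on_cube_compose[OF k(1)] continuous_intros) (auto simp: half)
  show "(if a \<le> 1/2 then H t (2 * a) b else K t (2 * a - 1) b) \<in> X"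
    if "t \<in> {0..1}" "a \<in> {0..1}" "b \<in> {0..1}" for t a b using that h(2) k(2) by auto
  show "(if s \<le> 1/2 then H t (2 * s) 0 else K t (2 * s - 1) 0) \<in> A \<and>
        (if s \<le> 1/2 then H t (2 * s) 1 else K t (2 * s - 1) 1) \<in> A"
    if "t \<in> {0..1}" "s \<in> {0..1}" for t s using that h(4) k(4) by auto
  show "(if (0::real) \<le> 1/2 then H t (2 * 0) s else K t (2 * 0 - 1) s) \<in> B \<and>
        (if (1::real) \<le> 1/2 then H t (2 * 1) s else K t (2 * 1 - 1) s) \<in> B"
    if "t \<in> {0..1}" "s \<in> {0..1}" for t s :: real using that h(3)[of t s] k(3)[of t s] by simp
  show "{H 0 0 0, H 0 0 1, K 0 1 0, K 0 1 1} \<subseteq> C" using h(6) k(6) by simp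
  show "(if (0::real) \<le> 1/2 then H t (2 * 0) 0 else K t (2 * 0 - 1) 0) = H 0 0 0 \<and>
        (if (0::real) \<le> 1/2 then H t (2 * 0) 1 else K t (2 * 0 - 1) 1) = H 0 0 1 \<and>
        (if (1::real) \<le> 1/2 then H t (2 * 1) 0 else K t (2 * 1 - 1) 0) = K 0 1 0 \<and>
        (if (1::real) \<le> 1/2 then H t (2 * 1) 1 else K t (2 * 1 - 1) 1) = K 0 1 1"
    if "t \<in> {0..1}" for t :: real using h(5)[OF that] k(5)[OF that] by simp
qed

lemma glue1_in_R_squares:
  assumes f: "f \<in> R_squares X A B C" and g: "g \<in> R_squares X A B C"
    and fg: "\<And>s. s \<in> {0..1} \<Longrightarrow> f (1, s) = g (0, s)"
  shows "glue1 f g \<in> R_squares X A B C"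
  using rho_homotopy_glue1[OF rho_homotopy_const[OF f] rho_homotopy_const[OF g]] fg
  unfolding rho_homotopy_def glue1_def by auto

text \<open>
  The common edge may move: the two homotopies only have to agree on it at each time.  For homotopies
  that move the edge in different ways see \<open>glue1_homotopic\<close>, which rests on the hypothesis about the
  second homotopy groups.
\<close>

lemma rho_homotopic_glue1_moving:
  assumes H: "rho_homotopy X A B C H" and K: "rho_homotopy X A B C K"
    and HK: "\<And>t s. t \<in> {0..1} \<Longrightarrow> s \<in> {0..1} \<Longrightarrow> H t 1 s = K t 0 s"
    and "\<And>a b. a \<in> {0..1} \<Longrightarrow> b \<in> {0..1} \<Longrightarrow> H 0 a b = f (a, b) \<and> H 1 a b = f' (a, b)"
    and "\<And>a b. a \<in> {0..1} \<Longrightarrow> b \<in> {0..1} \<Longrightarrow> K 0 a b = g (a, b) \<and> K 1 a b = g' (a, b)"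
  shows "rho_homotopic X A B C (glue1 f g) (glue1 f' g')"
  by (rule rho_homotopicI[OF rho_homotopy_glue1[OF H K HK]]) (use assms(4,5) in \<open>auto simp: glue1_def\<close>)

lemma convex_combination_unit:
  fixes a b t :: real
  assumes "t \<in> {0..1}" "a \<in> {0..1}" "b \<in> {0..1}"
  shows "(1 - t) * a + t * b \<in> {0..1}"
  using convexD_alt[of "{0..1::real}" a b t] assms by simp

lemma connectors1_iff:
  "h \<in> connectors1 B p q \<longleftrightarrow> continuous_on unit_square h \<and> (\<forall>a\<in>{0..1}. \<forall>b\<in>{0..1}. h (a, b) \<in> B) \<and>
    (\<forall>s\<in>{0..1}. h (0, s) = p s \<and> h (1, s) = q s \<and> h (s, 0) = p 0 \<and> h (s, 1) = p 1)"
  by (auto simp: connectors1_def square_maps_iff edge1_def edge2_def)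

lemma connectors1D:
  assumes "h \<in> connectors1 B p q"
  shows "continuous_on unit_square h" "\<And>a b. a \<in> {0..1} \<Longrightarrow> b \<in> {0..1} \<Longrightarrow> h (a, b) \<in> B"
    "\<And>s. s \<in> {0..1} \<Longrightarrow> h (0, s) = p s" "\<And>s. s \<in> {0..1} \<Longrightarrow> h (1, s) = q s"
    "\<And>s. s \<in> {0..1} \<Longrightarrow> h (s, 0) = p 0" "\<And>s. s \<in> {0..1} \<Longrightarrow> h (s, 1) = p 1"
    "q 0 = p 0" "q 1 = p 1"
proof -
  show "continuous_on unit_square h" "\<And>a b. a \<in> {0..1} \<Longrightarrow> b \<in> {0..1} \<Longrightarrow> h (a, b) \<in> B"
    and 1: "\<And>s. s \<in> {0..1} \<Longrightarrow> h (0, s) = p s" "\<And>s. s \<in> {0..1} \<Longrightarrow> h (1, s) = q s"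
    "\<And>s. s \<in> {0..1} \<Longrightarrow> h (s, 0) = p 0" "\<And>s. s \<in> {0..1} \<Longrightarrow> h (s, 1) = p 1"
    using assms unfolding connectors1_iff by blast+
  show "q 0 = p 0" "q 1 = p 1" using 1(2)[of 0] 1(2)[of 1] 1(3)[of 1] 1(4)[of 1] by simp_all
qed

lemma homotopic_paths_iff_connectors1:
  "homotopic_paths B p q \<longleftrightarrow> (\<exists>h. h \<in> connectors1 B p q)"
proof
  assume "homotopic_paths B p q"
  then show "\<exists>h. h \<in> connectors1 B p q"
    unfolding homotopic_paths connectors1_iff
    by (elim exE, rule_tac x = h in exI) (auto simp: pathstart_def pathfinish_def Pi_iff)
next
  assume "\<exists>h. h \<in> connectors1 B p q"
  then show "homotopic_paths B p q"
    unfolding homotopic_paths connectors1_iff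
    by (elim exE, rule_tac x = h in exI) (auto simp: pathstart_def pathfinish_def)
qed

lemma rho_homotopic_edge1:
  assumes "rho_homotopic X A B C f g" "e \<in> {0, 1}"
  shows "homotopic_paths B (edge1 e f) (edge1 e g)"
proof -
  obtain H where H: "rho_homotopy X A B C H"
    and fg: "\<And>a b. a \<in> {0..1} \<Longrightarrow> b \<in> {0..1} \<Longrightarrow> H 0 a b = f (a, b) \<and> H 1 a b = g (a, b)"
    using assms unfolding rho_homotopic_iff by blast
  note h = rho_homotopyD[OF H]
  have "(\<lambda>x. H (fst x) e (snd x)) \<in> connectors1 B (edge1 e f) (edge1 e g)"
    unfolding connectors1_iff
  proof (intro conjI ballI)
    show "continuous_on unit_square (\<lambda>x. H (fst x) e (snd x))"
      by (intro continuous_on_cube_compose[OF h(1)] continuous_intros) (use assms(2) in auto)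
    show "\<And>a b. a \<in> {0..1} \<Longrightarrow> b \<in> {0..1} \<Longrightarrow> H (fst (a, b)) e (snd (a, b)) \<in> B"
      using h(3) assms(2) by auto
  qed (use fg h(5) assms(2) in \<open>auto simp: edge1_def\<close>)
  then show ?thesis using homotopic_paths_iff_connectors1 by blast
qed

locale triad =
  fixes X A B C :: "'a::topological_space set"
  assumes A_sub: "A \<subseteq> X" and B_sub: "B \<subseteq> X" and C_sub_A: "C \<subseteq> A" and C_sub_B: "C \<subseteq> B"
begin

abbreviation R :: "'a square set" where "R \<equiv> R_squares X A B C"
abbreviation sim :: "'a square \<Rightarrow> 'a square \<Rightarrow> bool" (infix \<open>\<simeq>\<close> 50) where
  "f \<simeq> g \<equiv> rho_homotopic X A B C f g"

lemma connectors1_in_R: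
  assumes "h \<in> connectors1 B p q" "p 0 \<in> C" "p 1 \<in> C" shows "h \<in> R"
proof -
  note h = connectors1D[OF assms(1)]
  have "p s \<in> B \<and> q s \<in> B" if "s \<in> {0..1}" for s
    using h(2)[of 0 s] h(2)[of 1 s] h(3,4)[OF that] that by simp
  moreover have "p 0 \<in> A" "p 1 \<in> A" "\<And>a b. a \<in> {0..1} \<Longrightarrow> b \<in> {0..1} \<Longrightarrow> h (a, b) \<in> X"
    using assms(2,3) h(2) C_sub_A B_sub by blast+
  ultimately show ?thesis using assms(2,3) h by (simp add: R_squares_iff)
qed

lemma paths_onD:
  assumes "p \<in> paths_on Y C"
  shows "continuous_on {0..1} p" "\<And>s. s \<in> {0..1} \<Longrightarrow> p s \<in> Y" "p 0 \<in> C" "p 1 \<in> C"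
  using assms by (auto simp: paths_on_def path_def path_image_def pathstart_def pathfinish_def)

lemma degenerate1_in_R:
  assumes "p \<in> paths_on B C" shows "degenerate1 p \<in> R"
proof -
  note p = paths_onD[OF assms]
  have "continuous_on unit_square (\<lambda>x. p (snd x))"
    by (intro continuous_on_path_compose[OF p(1)] continuous_intros) auto
  moreover have "p 0 \<in> A" "p 1 \<in> A" "\<And>s. s \<in> {0..1} \<Longrightarrow> p s \<in> X"
    using p C_sub_A B_sub by blast+
  ultimately show ?thesis using p(2-4)
    by (simp add: R_squares_iff degenerate1_def case_prod_unfold)
qed

lemma degenerate2_in_R:
  assumes "p \<in> paths_on A C" shows "degenerate2 p \<in> R"
proof -
  note p = paths_onD[OF assms]
  have "continuous_on unit_square (\<lambda>x. p (fst x))"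
    by (intro continuous_on_path_compose[OF p(1)] continuous_intros) auto
  moreover have "p 0 \<in> B" "p 1 \<in> B" "\<And>s. s \<in> {0..1} \<Longrightarrow> p s \<in> X"
    using p C_sub_B A_sub by blast+
  ultimately show ?thesis using p(2-4)
    by (simp add: R_squares_iff degenerate2_def case_prod_unfold)
qed

lemma paths_onI:
  assumes "continuous_on {0..1} p" "\<And>s. s \<in> {0..1} \<Longrightarrow> p s \<in> Y" "p 0 \<in> C" "p 1 \<in> C"
  shows "p \<in> paths_on Y C"
  using assms by (simp add: paths_on_def path_def path_image_def pathstart_def pathfinish_def image_subset_iff)

lemma edge1_in_paths_on:
  assumes "f \<in> R" and e: "e \<in> {0, 1}" shows "edge1 e f \<in> paths_on B C"
  unfolding edge1_def
proof (rule paths_onI)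
  note f = R_squaresD[OF assms(1)]
  show "continuous_on {0..1} (\<lambda>s. f (e, s))"
    using e by (intro continuous_on_square_compose[OF f(1)] continuous_intros) auto
  show "\<And>s. s \<in> {0..1} \<Longrightarrow> f (e, s) \<in> B" "f (e, 0) \<in> C" "f (e, 1) \<in> C"
    using e f(3,5-8) by blast+
qed

lemma edge2_in_paths_on:
  assumes "f \<in> R" and e: "e \<in> {0, 1}" shows "edge2 e f \<in> paths_on A C"
  unfolding edge2_def
proof (rule paths_onI)
  note f = R_squaresD[OF assms(1)]
  show "continuous_on {0..1} (\<lambda>s. f (s, e))"
    using e by (intro continuous_on_square_compose[OF f(1)] continuous_intros) auto
  show "\<And>s. s \<in> {0..1} \<Longrightarrow> f (s, e) \<in> A" "f (0, e) \<in> C" "f (1, e) \<in> C"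
    using e f(4,5-8) by blast+
qed

text \<open>
  Two reparametrizations of the vertical coordinate with the same ends are joined by the straight
  line homotopy; the ends must be \<open>0\<close> or \<open>1\<close> because only there the horizontal sections of \<open>f\<close>
  are known to run in \<open>B\<close>.
\<close>

lemma reparametrize1:
  assumes f: "f \<in> R" and "continuous_on {0..1} \<phi>" "continuous_on {0..1} \<psi>"
    and range: "\<And>s. s \<in> {0..1} \<Longrightarrow> \<phi> s \<in> {0..1} \<and> \<psi> s \<in> {0..1}"
    and ends: "\<phi> 0 = \<psi> 0" "\<phi> 1 = \<psi> 1" "\<phi> 0 \<in> {0, 1}" "\<phi> 1 \<in> {0, 1}"
    and "\<And>a b. a \<in> {0..1} \<Longrightarrow> b \<in> {0..1} \<Longrightarrow> g (a, b) = f (\<phi> a, b)"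
    and "\<And>a b. a \<in> {0..1} \<Longrightarrow> b \<in> {0..1} \<Longrightarrow> h (a, b) = f (\<psi> a, b)"
  shows "g \<simeq> h"
proof (rule rho_homotopicI)
  let ?H = "\<lambda>t s1 s2. f ((1 - t) * \<phi> s1 + t * \<psi> s1, s2)"
  have in01: "(1 - t) * \<phi> s + t * \<psi> s \<in> {0..1}" if "t \<in> {0..1}" "s \<in> {0..1}" for t s
    using convex_combination_unit range that by blast
  have e0: "(1 - t) * \<phi> 0 + t * \<psi> 0 = \<phi> 0" and e1: "(1 - t) * \<phi> 1 + t * \<psi> 1 = \<phi> 1" for t
    using ends by (auto simp: algebra_simps)
  have cf: "continuous_on unit_square f"
    and fX: "\<And>a b. a \<in> {0..1} \<Longrightarrow> b \<in> {0..1} \<Longrightarrow> f (a, b) \<in> X"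
    and fE: "\<And>s. s \<in> {0..1} \<Longrightarrow> f (0, s) \<in> B \<and> f (1, s) \<in> B \<and> f (s, 0) \<in> A \<and> f (s, 1) \<in> A"
    and fC: "f (0, 0) \<in> C" "f (0, 1) \<in> C" "f (1, 0) \<in> C" "f (1, 1) \<in> C"
    using f unfolding R_squares_iff by blast+
  show "rho_homotopy X A B C ?H"
  proof (rule rho_homotopyI)
    show "continuous_cube ?H"
      by (intro continuous_cubeI continuous_on_square_compose[OF cf] continuous_intros
          continuous_on_path_compose[OF assms(2)] continuous_on_path_compose[OF assms(3)])
        (use in01 in \<open>auto simp: mem_Times_iff\<close>)
    show "\<And>t a b. t \<in> {0..1} \<Longrightarrow> a \<in> {0..1} \<Longrightarrow> b \<in> {0..1} \<Longrightarrow> ?H t a b \<in> X"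
      using fX in01 by blast
    show "\<And>t s. t \<in> {0..1} \<Longrightarrow> s \<in> {0..1} \<Longrightarrow> ?H t 0 s \<in> B \<and> ?H t 1 s \<in> B"
      using fE ends(3,4) unfolding e0 e1 by auto
    show "\<And>t s. t \<in> {0..1} \<Longrightarrow> s \<in> {0..1} \<Longrightarrow> ?H t s 0 \<in> A \<and> ?H t s 1 \<in> A"
      using fE in01 by blast
    show "\<And>t. t \<in> {0..1} \<Longrightarrow> ?H t 0 0 = f (\<phi> 0, 0) \<and> ?H t 0 1 = f (\<phi> 0, 1) \<and>
        ?H t 1 0 = f (\<phi> 1, 0) \<and> ?H t 1 1 = f (\<phi> 1, 1)"
      unfolding e0 e1 by simp
    show "{f (\<phi> 0, 0), f (\<phi> 0, 1), f (\<phi> 1, 0), f (\<phi> 1, 1)} \<subseteq> C"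
      using fC ends(3,4) by auto
  qed
qed (use assms(9,10) in auto)

lemma glue1_assoc:
  assumes "f \<in> R" "g \<in> R" "h \<in> R"
    and fg: "\<And>s. s \<in> {0..1} \<Longrightarrow> f (1, s) = g (0, s)" and gh: "\<And>s. s \<in> {0..1} \<Longrightarrow> g (1, s) = h (0, s)"
  shows "glue1 (glue1 f g) h \<simeq> glue1 f (glue1 g h)"
proof (rule reparametrize1)
  show "glue1 f (glue1 g h) \<in> R"
    using assms by (intro glue1_in_R_squares) (auto simp: glue1_def)
  \<comment> \<open>The three pieces stretch \<open>[0, 1/4]\<close>, \<open>[1/4, 1/2]\<close>, \<open>[1/2, 1]\<close> to \<open>[0, 1/2]\<close>, \<open>[1/2, 3/4]\<close>,
    \<open>[3/4, 1]\<close>; the result is concave, hence a minimum.\<close>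
  show "continuous_on {0..1} (\<lambda>s::real. min (2 * s) (min (s + 1/4) ((s + 1) / 2)))"
    by (intro continuous_intros) auto
  show "glue1 (glue1 f g) h (a, b) = glue1 f (glue1 g h) (min (2 * a) (min (a + 1/4) ((a + 1) / 2)), b)"
    if "a \<in> {0..1}" "b \<in> {0..1}" for a b
  proof -
    consider "a \<le> 1/4" | "1/4 < a" "a \<le> 1/2" | "1/2 < a" by linarith
    then show ?thesis
    proof cases
      case 1
      then have "min (2 * a) (min (a + 1/4) ((a + 1) / 2)) = 2 * a" by (auto simp: min_def)
      then show ?thesis using 1 by (simp add: glue1_def)
    next
      case 2
      then have "min (2 * a) (min (a + 1/4) ((a + 1) / 2)) = a + 1/4" by (auto simp: min_def)
      then show ?thesis using 2 by (simp add: glue1_def algebra_simps)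
    next
      case 3
      then have "min (2 * a) (min (a + 1/4) ((a + 1) / 2)) = (a + 1) / 2" by (auto simp: min_def field_simps)
      moreover have "2 * ((a + 1) / 2) - 1 = a" "\<not> (a + 1) / 2 \<le> 1/2" using 3 by (simp_all add: field_simps)
      then have "glue1 f (glue1 g h) ((a + 1) / 2, b) = glue1 g h (a, b)"
        unfolding glue1_def[of f] case_prod_conv by metis
      ultimately show ?thesis using 3 by (simp add: glue1_def)
    qed
  qed
  show "glue1 f (glue1 g h) (a, b) = glue1 f (glue1 g h) (a, b)" for a b by simp
qed (auto simp: min_le_iff_disj intro!: continuous_intros)

lemma glue1_middle_unit:
  assumes "f \<in> R" "g \<in> R" and fg: "\<And>s. s \<in> {0..1} \<Longrightarrow> f (1, s) = p s \<and> g (0, s) = p s"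
  shows "glue1 (glue1 f (degenerate1 p)) g \<simeq> glue1 f g"
proof (rule reparametrize1)
  show "glue1 f g \<in> R" using assms by (intro glue1_in_R_squares) auto
  show "continuous_on {0..1} (\<lambda>s::real. max (min (2 * s) (1/2)) s)" by (intro continuous_intros)
  show "glue1 (glue1 f (degenerate1 p)) g (a, b) = glue1 f g (max (min (2 * a) (1/2)) a, b)"
    if "a \<in> {0..1}" "b \<in> {0..1}" for a b
  proof -
    consider "a \<le> 1/4" | "1/4 < a" "a \<le> 1/2" | "1/2 < a" by linarith
    then show ?thesis
    proof cases
      case 1
      then have "max (min (2 * a) (1/2)) a = 2 * a" using that by auto
      then show ?thesis using 1 by (simp add: glue1_def)
    next
      case 2
      then have "max (min (2 * a) (1/2)) a = 1/2" by auto
      then show ?thesis using 2 fg[OF that(2)] by (simp add: glue1_def degenerate1_def)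
    next
      case 3
      then have "max (min (2 * a) (1/2)) a = a" by auto
      then show ?thesis using 3 by (simp add: glue1_def)
    qed
  qed
  show "glue1 f g (a, b) = glue1 f g (a, b)" for a b by simp
qed (auto simp: min_le_iff_disj intro!: continuous_intros)

lemma glue1_left_unit:
  assumes "f \<in> R" "\<And>s. s \<in> {0..1} \<Longrightarrow> p s = f (0, s)"
  shows "glue1 (degenerate1 p) f \<simeq> f"
  by (rule reparametrize1[OF assms(1), of "\<lambda>s. max 0 (2 * s - 1)" "\<lambda>s. s"])
    (use assms(2) in \<open>auto simp: glue1_def degenerate1_def intro!: continuous_intros\<close>)

lemma glue1_right_unit:
  assumes "f \<in> R" "\<And>s. s \<in> {0..1} \<Longrightarrow> p s = f (1, s)"
  shows "glue1 f (degenerate1 p) \<simeq> f"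
proof (rule reparametrize1[OF assms(1), of "\<lambda>s. min 1 (2 * s)" "\<lambda>s. s"])
  show "glue1 f (degenerate1 p) (a, b) = f (min 1 (2 * a), b)" if "a \<in> {0..1}" "b \<in> {0..1}" for a b
    using assms(2)[of b] that by (cases "a \<le> 1/2") (auto simp: glue1_def degenerate1_def)
qed (auto intro!: continuous_intros)

definition flip1 :: "'a square \<Rightarrow> 'a square" where "flip1 f = (\<lambda>(s1, s2). f (1 - s1, s2))"

lemma flip1_in_R: assumes "f \<in> R" shows "flip1 f \<in> R"
proof -
  note f = R_squaresD[OF assms]
  have "continuous_on unit_square (\<lambda>x. f (1 - fst x, snd x))"
    by (intro continuous_on_square_compose[OF f(1)] continuous_intros) auto
  then show ?thesis using f(2-8) by (simp add: R_squares_iff flip1_def case_prod_unfold)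
qed

lemma glue1_flip1:
  assumes "f \<in> R"
  shows "glue1 f (flip1 f) \<simeq> degenerate1 (edge1 0 f)"
proof (rule reparametrize1[OF assms, of "\<lambda>s. 1 - \<bar>2 * s - 1\<bar>" "\<lambda>s. 0"])
  show "glue1 f (flip1 f) (a, b) = f (1 - \<bar>2 * a - 1\<bar>, b)" if "a \<in> {0..1}" "b \<in> {0..1}" for a b
    using that by (cases "a \<le> 1/2") (auto simp: glue1_def flip1_def)
qed (auto simp: degenerate1_def edge1_def abs_le_iff intro!: continuous_intros)

text \<open>
  At time \<open>t\<close> only the part of the connector up to height \<open>1 - t\<close> is attached.  The bottom edge
  changes during the homotopy, but it is a stage of the connector and so stays in \<open>B\<close>.
\<close>

lemma glue1_connector:
  assumes f: "f \<in> R" and h: "h \<in> connectors1 B (edge1 1 f) q"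
  shows "glue1 f h \<simeq> f"
proof (rule rho_homotopicI)
  have h': "continuous_on unit_square h" "\<And>a b. a \<in> {0..1} \<Longrightarrow> b \<in> {0..1} \<Longrightarrow> h (a, b) \<in> B"
    "\<And>s. s \<in> {0..1} \<Longrightarrow> h (0, s) = f (1, s) \<and> h (s, 0) = f (1, 0) \<and> h (s, 1) = f (1, 1)"
    using connectors1D[OF h] unfolding edge1_def by blast+
  have "h \<in> R" using R_squaresD[OF f] by (intro connectors1_in_R[OF h]) (simp_all add: edge1_def)
  then have W: "glue1 f h \<in> R" using f h'(3) by (intro glue1_in_R_squares) auto
  let ?\<phi> = "\<lambda>t s. (1 - t/2) * s :: real"
  have in01: "?\<phi> t s \<in> {0..1}" if "t \<in> {0..1}" "s \<in> {0..1}" for t s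
    using convex_combination_unit[of "t/2" s 0] that by auto
  have cW: "continuous_on unit_square (glue1 f h)"
    and WX: "\<And>a b. a \<in> {0..1} \<Longrightarrow> b \<in> {0..1} \<Longrightarrow> glue1 f h (a, b) \<in> X"
    and WA: "\<And>s. s \<in> {0..1} \<Longrightarrow> glue1 f h (s, 0) \<in> A \<and> glue1 f h (s, 1) \<in> A"
    using W unfolding R_squares_iff by blast+
  have bottom: "glue1 f h (?\<phi> t 1, s) = h (1 - t, s)" if "t \<in> {0..1}" "s \<in> {0..1}" for t s
    using that h'(3) by (auto simp: glue1_def)
  have fC: "f (0, 0) \<in> C" "f (0, 1) \<in> C" "f (1, 0) \<in> C" "f (1, 1) \<in> C" 
    and fB: "\<And>s. s \<in> {0..1} \<Longrightarrow> f (0, s) \<in> B"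
    using f unfolding R_squares_iff by blast+
  let ?H = "\<lambda>t s1 s2. glue1 f h (?\<phi> t s1, s2)"
  show "rho_homotopy X A B C ?H"
  proof (rule rho_homotopyI)
    show "continuous_cube ?H"
      by (intro continuous_cubeI continuous_on_square_compose[OF cW] continuous_intros)
        (use in01 in \<open>auto simp: mem_Times_iff\<close>)
    show "?H t a b \<in> X" if "t \<in> {0..1}" "a \<in> {0..1}" "b \<in> {0..1}" for t a b
      using WX[OF in01[OF that(1,2)] that(3)] .
    show "?H t 0 s \<in> B \<and> ?H t 1 s \<in> B" if "t \<in> {0..1}" "s \<in> {0..1}" for t s
      using bottom[OF that] h'(2)[of "1 - t" s] fB that by (auto simp: glue1_def)
    show "?H t s 0 \<in> A \<and> ?H t s 1 \<in> A" if "t \<in> {0..1}" "s \<in> {0..1}" for t s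
      using WA[OF in01[OF that]] .
    show "?H t 0 0 = f (0, 0) \<and> ?H t 0 1 = f (0, 1) \<and> ?H t 1 0 = f (1, 0) \<and> ?H t 1 1 = f (1, 1)"
      if "t \<in> {0..1}" for t
      using bottom[OF that, of 0] bottom[OF that, of 1] h'(3)[of "1 - t"] that by (auto simp: glue1_def)
  qed (use fC in auto)
  show "?H 1 a b = f (a, b)" if "a \<in> {0..1}" "b \<in> {0..1}" for a b
    using that by (auto simp: glue1_def)
qed auto

lemma connector_glue1:
  assumes f: "f \<in> R" and h: "h \<in> connectors1 B p (edge1 0 f)"
  shows "glue1 h f \<simeq> f"
proof (rule rho_homotopicI)
  have h': "continuous_on unit_square h" "\<And>a b. a \<in> {0..1} \<Longrightarrow> b \<in> {0..1} \<Longrightarrow> h (a, b) \<in> B"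
    "\<And>s. s \<in> {0..1} \<Longrightarrow> h (1, s) = f (0, s) \<and> h (s, 0) = f (0, 0) \<and> h (s, 1) = f (0, 1)"
    using connectors1D[OF h] by (simp_all add: edge1_def)
  have p: "p 0 = f (0, 0)" "p 1 = f (0, 1)"
    using connectors1D(7,8)[OF h] by (simp_all add: edge1_def)
  have "h \<in> R" using R_squaresD[OF f] p by (intro connectors1_in_R[OF h]) simp_all
  then have W: "glue1 h f \<in> R" using f h'(3) by (intro glue1_in_R_squares) auto
  let ?\<phi> = "\<lambda>t s. (1 - t/2) * s + t/2 :: real"
  have in01: "?\<phi> t s \<in> {0..1}" if "t \<in> {0..1}" "s \<in> {0..1}" for t s
    using convex_combination_unit[of "t/2" s 1] that by auto
  have cW: "continuous_on unit_square (glue1 h f)"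
    and WX: "\<And>a b. a \<in> {0..1} \<Longrightarrow> b \<in> {0..1} \<Longrightarrow> glue1 h f (a, b) \<in> X"
    and WA: "\<And>s. s \<in> {0..1} \<Longrightarrow> glue1 h f (s, 0) \<in> A \<and> glue1 h f (s, 1) \<in> A"
    using W unfolding R_squares_iff by blast+
  have top: "glue1 h f (?\<phi> t 0, s) = h (t, s)" if "t \<in> {0..1}" "s \<in> {0..1}" for t s
    using that h'(3) by (auto simp: glue1_def)
  have fC: "f (0, 0) \<in> C" "f (0, 1) \<in> C" "f (1, 0) \<in> C" "f (1, 1) \<in> C" 
    and fB: "\<And>s. s \<in> {0..1} \<Longrightarrow> f (1, s) \<in> B"
    using f unfolding R_squares_iff by blast+
  let ?H = "\<lambda>t s1 s2. glue1 h f (?\<phi> t s1, s2)"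
  show "rho_homotopy X A B C ?H"
  proof (rule rho_homotopyI)
    show "continuous_cube ?H"
      by (intro continuous_cubeI continuous_on_square_compose[OF cW] continuous_intros)
        (use in01 in \<open>auto simp: mem_Times_iff\<close>)
    show "?H t a b \<in> X" if "t \<in> {0..1}" "a \<in> {0..1}" "b \<in> {0..1}" for t a b
      using WX[OF in01[OF that(1,2)] that(3)] .
    show "?H t 0 s \<in> B \<and> ?H t 1 s \<in> B" if "t \<in> {0..1}" "s \<in> {0..1}" for t s
      using top[OF that] h'(2)[of t s] fB that by (auto simp: glue1_def)
    show "?H t s 0 \<in> A \<and> ?H t s 1 \<in> A" if "t \<in> {0..1}" "s \<in> {0..1}" for t s
      using WA[OF in01[OF that]] .
    show "?H t 0 0 = f (0, 0) \<and> ?H t 0 1 = f (0, 1) \<and> ?H t 1 0 = f (1, 0) \<and> ?H t 1 1 = f (1, 1)"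
      if "t \<in> {0..1}" for t
      using top[OF that, of 0] top[OF that, of 1] h'(3)[of t] that by (auto simp: glue1_def)
  qed (use fC in auto)
  show "?H 1 a b = f (a, b)" if "a \<in> {0..1}" "b \<in> {0..1}" for a b
    using that h'(3) by (auto simp: glue1_def)
qed auto

text \<open>
  Homotopies of \<open>f\<close> and \<open>g\<close> move the common edge in two different ways.  Between the two
  squares at time \<open>t\<close> insert the first trace run backwards from \<open>t\<close> to \<open>0\<close> and then the second
  trace run forwards from \<open>0\<close> to \<open>t\<close>.  At time \<open>1\<close> this insertion is \<open>h\<close>, a
  loop of paths if the edges of \<open>f'\<close> and \<open>g'\<close> agree.
\<close>

lemma glue1_homotopic_up_to_loop:
  assumes ff: "f \<simeq> f'" and gg: "g \<simeq> g'"
    and fg: "\<And>s. s \<in> {0..1} \<Longrightarrow> f (1, s) = g (0, s)"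
  obtains h where "h \<in> connectors1 B (edge1 1 f') (edge1 0 g')"
    "glue1 (glue1 f (degenerate1 (edge1 1 f))) g \<simeq> glue1 (glue1 f' h) g'"
proof -
  obtain H where H: "rho_homotopy X A B C H"
    and Hf: "\<And>a b. a \<in> {0..1} \<Longrightarrow> b \<in> {0..1} \<Longrightarrow> H 0 a b = f (a, b) \<and> H 1 a b = f' (a, b)"
    using ff unfolding rho_homotopic_iff by blast
  obtain K where K: "rho_homotopy X A B C K"
    and Kg: "\<And>a b. a \<in> {0..1} \<Longrightarrow> b \<in> {0..1} \<Longrightarrow> K 0 a b = g (a, b) \<and> K 1 a b = g' (a, b)"
    using gg unfolding rho_homotopic_iff by blast
  define M where "M = (\<lambda>t s1 s2. if s1 \<le> 1/2 then H (t * (1 - 2 * s1)) 1 s2 else K (t * (2 * s1 - 1)) 0 s2)"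
  note h = rho_homotopyD[OF H] and k = rho_homotopyD[OF K]
  have HK: "H 0 1 s = K 0 0 s" if "s \<in> {0..1}" for s using Hf Kg fg that by auto
  have half: "H (t * (1 - 2 * a)) 1 s = K (t * (2 * a - 1)) 0 s" if "s \<in> {0..1}" "a * 2 = 1" for t a s
    using HK[OF that(1)] that(2) by (simp add: mult.commute)
  have in1: "t * (1 - 2 * s) \<in> {0..1}" if "t \<in> {0..1}" "s \<in> {0..1}" "s \<le> 1/2" for t s :: real
    using that by (auto intro!: mult_le_one)
  have in2: "t * (2 * s - 1) \<in> {0..1}" if "t \<in> {0..1}" "s \<in> {0..1}" "1/2 \<le> s" for t s :: real
    using that by (auto intro!: mult_le_one)
  have cM: "continuous_cube M"
    unfolding M_def
    by (intro continuous_cubeI continuous_on_if_half continuous_on_cube_compose[OF h(1)]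
        continuous_on_cube_compose[OF k(1)] continuous_intros)
      (use in1 in2 in \<open>auto simp: mem_Times_iff half\<close>)
  have MB: "M t a b \<in> B" if "t \<in> {0..1}" "a \<in> {0..1}" "b \<in> {0..1}" for t a b
    using h(3)[OF in1[OF that(1,2)] that(3)] k(3)[OF in2[OF that(1,2)] that(3)] by (auto simp: M_def)
  have side: "M t s e = H 0 1 e" if "t \<in> {0..1}" "s \<in> {0..1}" "e \<in> {0, 1}" for t s e
    using h(5)[OF in1[OF that(1,2)]] k(5)[OF in2[OF that(1,2)]] HK[of e] that(3) by (auto simp: M_def)
  have HC: "H 0 1 0 \<in> C" "H 0 1 1 \<in> C" using h(6) by auto
  have M: "rho_homotopy X A B C M"
  proof (rule rho_homotopyI[OF cM])
    show "\<And>t a b. t \<in> {0..1} \<Longrightarrow> a \<in> {0..1} \<Longrightarrow> b \<in> {0..1} \<Longrightarrow> M t a b \<in> X" using MB B_sub by blast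
    show "\<And>t s. t \<in> {0..1} \<Longrightarrow> s \<in> {0..1} \<Longrightarrow> M t 0 s \<in> B \<and> M t 1 s \<in> B" using MB by simp
    show "\<And>t s. t \<in> {0..1} \<Longrightarrow> s \<in> {0..1} \<Longrightarrow> M t s 0 \<in> A \<and> M t s 1 \<in> A"
      using side HC C_sub_A by auto
    show "\<And>t. t \<in> {0..1} \<Longrightarrow> M t 0 0 = H 0 1 0 \<and> M t 0 1 = H 0 1 1 \<and> M t 1 0 = H 0 1 0 \<and> M t 1 1 = H 0 1 1"
      using side by simp
    show "{H 0 1 0, H 0 1 1, H 0 1 0, H 0 1 1} \<subseteq> C" using HC by simp
  qed
  have HM: "H t 1 s = M t 0 s" and MK: "M t 1 s = K t 0 s" for t s by (simp_all add: M_def)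
  define h' where "h' = (\<lambda>(s1, s2). M 1 s1 s2)"
  have "h' \<in> connectors1 B (edge1 1 f') (edge1 0 g')"
    unfolding connectors1_iff
  proof (intro conjI ballI)
    show "continuous_on unit_square h'" unfolding h'_def by (rule continuous_cube_slice[OF cM]) simp
    fix s :: real assume s: "s \<in> {0..1}"
    show "h' (0, s) = edge1 1 f' s" "h' (1, s) = edge1 0 g' s"
      using s Hf Kg by (auto simp: h'_def M_def edge1_def)
    show "h' (s, 0) = edge1 1 f' 0" "h' (s, 1) = edge1 1 f' 1"
      using s side h(5)[of 1] Hf by (auto simp: h'_def edge1_def)
  qed (use MB in \<open>auto simp: h'_def\<close>)
  moreover have "glue1 (glue1 f (degenerate1 (edge1 1 f))) g \<simeq> glue1 (glue1 f' h') g'"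
  proof (rule rho_homotopic_glue1_moving[OF rho_homotopy_glue1[OF H M HM] K])
    show "\<And>t s. t \<in> {0..1} \<Longrightarrow> s \<in> {0..1} \<Longrightarrow>
       (if 1 \<le> 1 / (2::real) then H t (2 * 1) s else M t (2 * 1 - 1) s) = K t 0 s"
      using MK by simp
    have M0: "M 0 a b = degenerate1 (edge1 1 f) (a, b)" if "a \<in> {0..1}" "b \<in> {0..1}" for a b
      using that Hf HK by (auto simp: M_def degenerate1_def edge1_def)
    show "\<And>a b. a \<in> {0..1} \<Longrightarrow> b \<in> {0..1} \<Longrightarrow>
      (if a \<le> 1 / 2 then H 0 (2 * a) b else M 0 (2 * a - 1) b) = glue1 f (degenerate1 (edge1 1 f)) (a, b) \<and>
      (if a \<le> 1 / 2 then H 1 (2 * a) b else M 1 (2 * a - 1) b) = glue1 f' h' (a, b)"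
      using Hf M0 by (auto simp: glue1_def h'_def)
  qed (use Kg in auto)
  ultimately show ?thesis by (rule that)
qed

end

section \<open>Cancelling a loop of paths\<close>

text \<open>The retraction of the line to the unit interval, which keeps arguments in range.\<close>

definition clip :: "real \<Rightarrow> real" where "clip x = max 0 (min 1 x)"

lemma clip_unit [simp]: "0 \<le> clip x" "clip x \<le> 1" by (auto simp: clip_def)
lemma clip_id: "x \<in> {0..1} \<Longrightarrow> clip x = x" by (auto simp: clip_def)
lemma clip_eq_0: "x \<le> 0 \<Longrightarrow> clip x = 0" by (auto simp: clip_def)
lemma clip_eq_1: "1 \<le> x \<Longrightarrow> clip x = 1" by (auto simp: clip_def)
lemma continuous_on_clip [continuous_intros]:
  "continuous_on S \<phi> \<Longrightarrow> continuous_on S (\<lambda>x. clip (\<phi> x))"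
  unfolding clip_def by (intro continuous_intros)

text \<open>
  The signed distance from the unit square in the maximum norm: negative inside, zero exactly on
  the boundary.
\<close>

definition box_dist :: "real \<Rightarrow> real \<Rightarrow> real" where
  "box_dist z1 z2 = max (max (- z1) (z1 - 1)) (max (- z2) (z2 - 1))"

lemma continuous_on_box_dist [continuous_intros]:
  "continuous_on S \<phi> \<Longrightarrow> continuous_on S \<psi> \<Longrightarrow> continuous_on S (\<lambda>x. box_dist (\<phi> x) (\<psi> x))"
  unfolding box_dist_def by (intro continuous_intros)

lemma unit_mult: "a \<in> {0..1} \<Longrightarrow> b \<in> {0..1} \<Longrightarrow> a * b \<in> {0..1::real}"
  by (auto intro: mult_le_one)

lemma pi2_maps_iff:
  "f \<in> pi2_maps Y c \<longleftrightarrow> continuous_on unit_square f \<and> (\<forall>a\<in>{0..1}. \<forall>b\<in>{0..1}. f (a, b) \<in> Y) \<and>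
    (\<forall>s\<in>{0..1}. f (0, s) = c \<and> f (1, s) = c \<and> f (s, 0) = c \<and> f (s, 1) = c)"
  by (auto simp: pi2_maps_def square_maps_iff edge1_def edge2_def)

lemma pi2_induced_class:
  assumes "Y \<subseteq> X" "u \<in> pi2_maps Y c"
  shows "pi2_induced X c (pi2_class Y c u) = pi2_class X c u"
proof -
  have sub: "pi2_maps Y c \<subseteq> square_maps Y" by (auto simp: pi2_maps_def)
  have "pi2_class X c v = pi2_class X c u" if v: "v \<in> pi2_class Y c u" for v
  proof -
    have "homotopic_with_canon (\<lambda>h. h \<in> pi2_maps Y c) unit_square X u v"
      using v assms(1) unfolding pi2_class_def square_class_def
      by (auto intro: homotopic_with_subset_right)
    then have "homotopic_with_canon (\<lambda>h. h \<in> pi2_maps X c) unit_square X u v"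
      by (rule homotopic_with_mono) (use assms(1) in \<open>auto simp: pi2_maps_iff\<close>)
    then show ?thesis unfolding pi2_class_def by (intro square_class_eq) (simp add: square_class_def)
  qed
  moreover have "u \<in> pi2_class Y c u"
    unfolding pi2_class_def by (rule square_class_refl[OF assms(2) sub])
  ultimately have "pi2_class X c ` pi2_class Y c u = {pi2_class X c u}" by blast
  then show ?thesis by (simp add: pi2_induced_def)
qed

lemma pi2_class_cube:
  assumes "k \<in> pi2_class X c u"
  obtains G where "continuous_cube G"
    "\<And>t a b. t \<in> {0..1} \<Longrightarrow> a \<in> {0..1} \<Longrightarrow> b \<in> {0..1} \<Longrightarrow> G t a b \<in> X"
    "\<And>t s. t \<in> {0..1} \<Longrightarrow> s \<in> {0..1} \<Longrightarrow> G t 0 s = c \<and> G t 1 s = c \<and> G t s 0 = c \<and> G t s 1 = c"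
    "\<And>a b. a \<in> {0..1} \<Longrightarrow> b \<in> {0..1} \<Longrightarrow> G 0 a b = u (a, b) \<and> G 1 a b = k (a, b)"
proof -
  have "\<exists>H. continuous_cube H \<and> (\<forall>t\<in>{0..1}. (\<lambda>(s1, s2). H t s1 s2) \<in> pi2_maps X c) \<and>
      (\<forall>s1\<in>{0..1}. \<forall>s2\<in>{0..1}. H 0 s1 s2 = u (s1, s2) \<and> H 1 s1 s2 = k (s1, s2))"
  proof (subst square_class_iff[symmetric])
    show "k \<in> square_class (pi2_maps X c) X u" using assms by (simp add: pi2_class_def)
    show "g \<in> pi2_maps X c" if "f \<in> pi2_maps X c" "\<And>z. z \<in> unit_square \<Longrightarrow> f z = g z" for f g
      using that square_maps_cong[of f X g] by (simp add: pi2_maps_def edge1_def edge2_def)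
  qed (auto simp: pi2_maps_def)
  then obtain G where G: "continuous_cube G" "\<forall>t\<in>{0..1}. (\<lambda>(s1, s2). G t s1 s2) \<in> pi2_maps X c"
    "\<forall>s1\<in>{0..1}. \<forall>s2\<in>{0..1}. G 0 s1 s2 = u (s1, s2) \<and> G 1 s1 s2 = k (s1, s2)" by blast
  show ?thesis
    by (rule that[OF G(1)]) (use G(2,3) in \<open>simp_all add: pi2_maps_iff\<close>)
qed

context triad begin

lemma rho_homotopy_stretch2:
  assumes f: "f \<in> R" and "continuous_on {0..1} \<phi>"
    and range: "\<And>s. s \<in> {0..1} \<Longrightarrow> \<phi> s \<in> {0..1}" and ends: "\<phi> 0 = 0" "\<phi> 1 = 1"
  shows "rho_homotopy X A B C (\<lambda>t s1 s2. f (s1, (1 - t) * s2 + t * \<phi> s2))"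
proof (rule rho_homotopyI[where nw = "f (0, 0)" and ne = "f (0, 1)" and sw = "f (1, 0)" and se = "f (1, 1)"])
  note f = R_squaresD[OF f]
  have in01: "(1 - t) * s + t * \<phi> s \<in> {0..1}" if "t \<in> {0..1}" "s \<in> {0..1}" for t s
    using convex_combination_unit range that by blast
  show "continuous_cube (\<lambda>t s1 s2. f (s1, (1 - t) * s2 + t * \<phi> s2))"
    by (intro continuous_cubeI continuous_on_square_compose[OF f(1)] continuous_intros
        continuous_on_path_compose[OF assms(2)]) (use in01 in \<open>auto simp: mem_Times_iff\<close>)
  show "\<And>t a b. t \<in> {0..1} \<Longrightarrow> a \<in> {0..1} \<Longrightarrow> b \<in> {0..1} \<Longrightarrow> f (a, (1 - t) * b + t * \<phi> b) \<in> X"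
    using f(2) in01 by blast
  show "\<And>t s. t \<in> {0..1} \<Longrightarrow> s \<in> {0..1} \<Longrightarrow>
      f (0, (1 - t) * s + t * \<phi> s) \<in> B \<and> f (1, (1 - t) * s + t * \<phi> s) \<in> B"
    using f(3) in01 by blast
qed (use R_squaresD[OF assms(1)] ends in simp_all)

lemma rho_homotopy_stretch12:
  assumes f: "f \<in> R" and "continuous_on {0..1} \<phi>"
    and range: "\<And>s. s \<in> {0..1} \<Longrightarrow> \<phi> s \<in> {0..1}" and ends: "\<phi> 0 = 0" "\<phi> 1 = 1"
  shows "rho_homotopy X A B C (\<lambda>t s1 s2. f ((1 - t) * s1 + t * \<phi> s1, (1 - t) * s2 + t * \<phi> s2))"
proof (rule rho_homotopyI[where nw = "f (0, 0)" and ne = "f (0, 1)" and sw = "f (1, 0)" and se = "f (1, 1)"])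
  note f = R_squaresD[OF f]
  have in01: "(1 - t) * s + t * \<phi> s \<in> {0..1}" if "t \<in> {0..1}" "s \<in> {0..1}" for t s
    using convex_combination_unit range that by blast
  show "continuous_cube (\<lambda>t s1 s2. f ((1 - t) * s1 + t * \<phi> s1, (1 - t) * s2 + t * \<phi> s2))"
    by (intro continuous_cubeI continuous_on_square_compose[OF f(1)] continuous_intros
        continuous_on_path_compose[OF assms(2)]) (use in01 in \<open>auto simp: mem_Times_iff\<close>)
  show "f ((1 - t) * a + t * \<phi> a, (1 - t) * b + t * \<phi> b) \<in> X"
    if "t \<in> {0..1}" "a \<in> {0..1}" "b \<in> {0..1}" for t a b
    using f(2) in01 that by blast
  show "f ((1 - t) * 0 + t * \<phi> 0, (1 - t) * s + t * \<phi> s) \<in> B \<and>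
      f ((1 - t) * 1 + t * \<phi> 1, (1 - t) * s + t * \<phi> s) \<in> B" if "t \<in> {0..1}" "s \<in> {0..1}" for t s
    using f(3)[OF in01[OF that]] ends by simp
  show "f ((1 - t) * s + t * \<phi> s, (1 - t) * 0 + t * \<phi> 0) \<in> A \<and>
      f ((1 - t) * s + t * \<phi> s, (1 - t) * 1 + t * \<phi> 1) \<in> A" if "t \<in> {0..1}" "s \<in> {0..1}" for t s
    using f(4)[OF in01[OF that]] ends by simp
qed (use R_squaresD[OF assms(1)] ends in simp_all)

text \<open>
  The middle square is stretched in both directions and its neighbours only horizontally, so that
  the edges keep matching.
\<close>

lemma glue1_stretch:
  assumes R: "f \<in> R" "h \<in> R" "g \<in> R"
    and "continuous_on {0..1} \<phi>" "\<And>s. s \<in> {0..1} \<Longrightarrow> \<phi> s \<in> {0..1}" and ends: "\<phi> 0 = 0" "\<phi> 1 = 1"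
    and fh: "\<And>s. s \<in> {0..1} \<Longrightarrow> f (1, s) = h (0, s)" and hg: "\<And>s. s \<in> {0..1} \<Longrightarrow> h (1, s) = g (0, s)"
  shows "glue1 (glue1 f h) g \<simeq>
    glue1 (glue1 (\<lambda>(s1, s2). f (s1, \<phi> s2)) (\<lambda>(s1, s2). h (\<phi> s1, \<phi> s2))) (\<lambda>(s1, s2). g (s1, \<phi> s2))"
proof -
  have in01: "(1 - t) * s + t * \<phi> s \<in> {0..1}" if "t \<in> {0..1}" "s \<in> {0..1}" for t s
    using convex_combination_unit assms(5) that by blast
  note F = rho_homotopy_stretch2[OF R(1) assms(4,5) ends]
    and H = rho_homotopy_stretch12[OF R(2) assms(4,5) ends]
    and G = rho_homotopy_stretch2[OF R(3) assms(4,5) ends]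
  show ?thesis
  proof (rule rho_homotopic_glue1_moving[OF rho_homotopy_glue1[OF F H] G])
    fix t s :: real assume "t \<in> {0..1}" "s \<in> {0..1}"
    then have "(1 - t) * s + t * \<phi> s \<in> {0..1}" by (rule in01)
    then show "f (1, (1 - t) * s + t * \<phi> s) = h ((1 - t) * 0 + t * \<phi> 0, (1 - t) * s + t * \<phi> s)"
      "(if 1 \<le> 1 / (2::real) then f (2 * 1, (1 - t) * s + t * \<phi> s)
        else h ((1 - t) * (2 * 1 - 1) + t * \<phi> (2 * 1 - 1), (1 - t) * s + t * \<phi> s)) =
       g (0, (1 - t) * s + t * \<phi> s)"
      using fh hg ends by simp_all
  qed (auto simp: glue1_def)
qed

text \<open>
  While the top and bottom edges of the middle square stay fixed, its left edge may move freely in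
  \<open>A\<close> and its interior in \<open>X\<close>.
\<close>

lemma glue1_middle_homotopy:
  assumes f: "f \<in> R" and g: "g \<in> R"
    and fg: "\<And>s. s \<in> {0..1} \<Longrightarrow> f (1, s) = g (0, s)"
    and cM: "continuous_cube M"
    and MX: "\<And>t a b. t \<in> {0..1} \<Longrightarrow> a \<in> {0..1} \<Longrightarrow> b \<in> {0..1} \<Longrightarrow> M t a b \<in> X"
    and Msides: "\<And>t s. t \<in> {0..1} \<Longrightarrow> s \<in> {0..1} \<Longrightarrow> M t s 0 \<in> A \<and> M t s 1 \<in> A"
    and fM: "\<And>t s. t \<in> {0..1} \<Longrightarrow> s \<in> {0..1} \<Longrightarrow> M t 0 s = g (0, s) \<and> M t 1 s = g (0, s)"
    and ends: "\<And>a b. a \<in> {0..1} \<Longrightarrow> b \<in> {0..1} \<Longrightarrow> M 0 a b = h (a, b) \<and> M 1 a b = h' (a, b)"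
  shows "glue1 (glue1 f h) g \<simeq> glue1 (glue1 f h') g"
proof -
  note g' = R_squaresD[OF g]
  have M: "rho_homotopy X A B C M"
    by (rule rho_homotopyI[where nw = "g (0, 0)" and ne = "g (0, 1)" and sw = "g (0, 0)" and se = "g (0, 1)",
        OF cM MX _ Msides]) (use fM g' in simp_all)
  show ?thesis
    by (rule rho_homotopic_glue1_moving
        [OF rho_homotopy_glue1[OF rho_homotopy_const[OF f] M] rho_homotopy_const[OF g]])
      (use fM fg ends in \<open>simp_all add: glue1_def\<close>)
qed

end

locale pi2_triad = triad +
  assumes pi2_images: "\<And>c. c \<in> C \<Longrightarrow> pi2_induced X c ` pi2 A c = pi2_induced X c ` pi2 B c"
begin

lemma pi2_replace:
  assumes "c \<in> C" "u \<in> pi2_maps B c"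
  obtains k where "k \<in> pi2_maps A c" "k \<in> pi2_class X c u"
proof -
  have "pi2_class X c u \<in> pi2_induced X c ` pi2 B c"
    using pi2_induced_class[OF B_sub assms(2)] assms(2) by (force simp: pi2_def)
  then obtain k where k: "k \<in> pi2_maps A c" "pi2_class X c u = pi2_induced X c (pi2_class A c k)"
    unfolding pi2_images[OF assms(1), symmetric] by (auto simp: pi2_def)
  have "k \<in> pi2_maps X c" using k(1) A_sub by (auto simp: pi2_maps_iff)
  then have "k \<in> pi2_class X c k"
    unfolding pi2_class_def by (rule square_class_refl) (auto simp: pi2_maps_def)
  then show ?thesis using that k pi2_induced_class[OF A_sub k(1)] by simp
qed

text \<open>
  The loop of paths \<open>h\<close> is deformed in five steps.  It is shrunk to the centre of the middle square
  (\<open>F\<close> and \<open>G\<close> are its stretched neighbours); it is turned into a sphere at \<open>q 0\<close> (\<open>E\<close>); this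
  sphere is replaced by one in \<open>A\<close> (\<open>W\<close>); the sphere leaves through the left edge (\<open>V\<close>); the
  remaining square, which only depends on \<open>q\<close>, is straightened (\<open>L\<close>).
\<close>

lemma glue1_loop:
  assumes f: "f \<in> R" and g: "g \<in> R"
    and fg: "\<And>s. s \<in> {0..1} \<Longrightarrow> f (1, s) = g (0, s)"
    and h: "h \<in> connectors1 B (edge1 1 f) (edge1 0 g)"
  shows "glue1 (glue1 f h) g \<simeq> glue1 f g"
proof -
  note f' = R_squaresD[OF f] and g' = R_squaresD[OF g]
  define q where "q = edge1 0 g"
  have fq: "f (1, s) = q s" and gq: "g (0, s) = q s" if "s \<in> {0..1}" for s
    using fg that by (auto simp: q_def edge1_def)
  have q: "q \<in> paths_on B C" unfolding q_def by (rule edge1_in_paths_on[OF g]) simp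
  note q' = paths_onD[OF q]
  have qX: "q s \<in> X" if "s \<in> {0..1}" for s using q'(2) B_sub that by blast
  have qA: "q 0 \<in> A" "q 1 \<in> A" using q' C_sub_A by blast+
  note h1 = connectors1D[OF h]
  have hq: "h (0, s) = q s" "h (1, s) = q s" "h (s, 0) = q 0" "h (s, 1) = q 1" if "s \<in> {0..1}" for s
    using h1(3-6)[OF that] fq that by (auto simp: edge1_def q_def)
  have hX: "h (a, b) \<in> X" if "a \<in> {0..1}" "b \<in> {0..1}" for a b using h1(2) B_sub that by blast
  have hR: "h \<in> R" by (rule connectors1_in_R[OF h]) (use f' in \<open>simp_all add: edge1_def\<close>)
  have h_clip: "h (clip z1, clip z2) = q (clip z2)" if "box_dist z1 z2 \<ge> 0" for z1 z2
  proof -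
    have "z1 \<le> 0 \<or> z1 \<ge> 1 \<or> z2 \<le> 0 \<or> z2 \<ge> 1" using that by (auto simp: box_dist_def le_max_iff_disj)
    then show ?thesis by (auto simp: clip_eq_0 clip_eq_1 hq)
  qed
  \<comment> \<open>In the coordinates \<open>z = 5 * s - 2\<close> the unit square is \<open>[-2, 3]\<close> squared.  The stretched
    \<open>h\<close> lives on \<open>[0, 1]\<close> squared, and the two collars where \<open>box_dist\<close> lies in \<open>[0, 1]\<close> and in
    \<open>[1, 2]\<close> leave room for the deformations.\<close>
  define \<phi> where "\<phi> = (\<lambda>s. clip (5 * s - 2))"
  have \<phi>: "continuous_on {0..1} \<phi>" "\<And>s. s \<in> {0..1} \<Longrightarrow> \<phi> s \<in> {0..1}" "\<phi> 0 = 0" "\<phi> 1 = 1"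
    by (auto simp: \<phi>_def clip_eq_0 clip_eq_1 intro!: continuous_intros)
  define F where "F = (\<lambda>(s1, s2). f (s1, \<phi> s2))"
  define G where "G = (\<lambda>(s1, s2). g (s1, \<phi> s2))"
  have FR: "F \<in> R" and GR: "G \<in> R"
    using rho_homotopy_stretch2[OF f \<phi>] rho_homotopy_stretch2[OF g \<phi>]
    unfolding rho_homotopy_def F_def G_def by (auto dest!: bspec[where x = 1])
  have FG: "F (1, s) = G (0, s)" "G (0, s) = q (\<phi> s)" if "s \<in> {0..1}" for s
    using fq gq \<phi>(2)[OF that] by (auto simp: F_def G_def)
  let ?d = "\<lambda>s1 s2. box_dist (5 * s1 - 2) (5 * s2 - 2)"
  have d_rim: "?d 0 s = 2" "?d 1 s = 2" "?d s 0 = 2" "?d s 1 = 2" if "s \<in> {0..1}" for s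
    using that by (auto simp: box_dist_def)

  \<comment> \<open>On the collars the stretched \<open>h\<close> is \<open>q (\<phi> s2)\<close>.  Moving inwards from the rim, the argument of
    \<open>q\<close> is lowered to \<open>(1 - t) * \<phi> s2\<close> where the collars meet and raised again.  At time \<open>1\<close> the
    circle between the collars is mapped to \<open>q 0\<close>.\<close>
  define E where "E = (\<lambda>t s1 s2. if ?d s1 s2 \<le> 0 then h (\<phi> s1, \<phi> s2)
    else q ((1 - t * max 0 (min (?d s1 s2) (2 - ?d s1 s2))) * \<phi> s2))"
  have E_unit: "(1 - t * max 0 (min d (2 - d))) * \<phi> s \<in> {0..1}" if "t \<in> {0..1}" for t d s
  proof -
    have "t * max 0 (min d (2 - d)) \<in> {0..1}" by (rule unit_mult[OF that]) auto
    then show ?thesis by (intro unit_mult) (auto simp: \<phi>_def)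
  qed
  have cE: "continuous_cube E"
    unfolding E_def \<phi>_def
    by (intro continuous_cubeI continuous_on_cases_le continuous_on_square_compose[OF h1(1)]
        continuous_on_path_compose[OF q'(1)] continuous_intros)
      (use E_unit h_clip in \<open>auto simp: mem_Times_iff \<phi>_def\<close>)
  have "glue1 (glue1 F (\<lambda>(s1, s2). h (\<phi> s1, \<phi> s2))) G \<simeq> glue1 (glue1 F (\<lambda>(s1, s2). E 1 s1 s2)) G"
  proof (rule glue1_middle_homotopy[OF FR GR FG(1) cE])
    show "E t a b \<in> X" if "t \<in> {0..1}" for t a b
      using hX qX E_unit[OF that] by (auto simp: E_def \<phi>_def)
    show "E t s 0 \<in> A \<and> E t s 1 \<in> A" if "t \<in> {0..1}" "s \<in> {0..1}" for t s
      using d_rim[OF that(2)] qA by (simp add: E_def \<phi>(3,4))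
    show "E t 0 s = G (0, s) \<and> E t 1 s = G (0, s)" if "t \<in> {0..1}" "s \<in> {0..1}" for t s
      using d_rim[OF that(2)] FG(2) that by (simp add: E_def)
    show "E 0 a b = (\<lambda>(s1, s2). h (\<phi> s1, \<phi> s2)) (a, b) \<and> E 1 a b = (\<lambda>(s1, s2). E 1 s1 s2) (a, b)" for a b
      using h_clip by (simp add: E_def \<phi>_def)
  qed

  \<comment> \<open>The part of \<open>E\<close> at time \<open>1\<close> inside that circle, rescaled from \<open>[-1, 2]\<close> squared by
    \<open>z = 3 * s - 1\<close>, is the sphere in \<open>B\<close> to which the hypothesis applies.\<close>
  define u where "u = (\<lambda>(s1, s2). if box_dist (3 * s1 - 1) (3 * s2 - 1) \<le> 0
    then h (clip (3 * s1 - 1), clip (3 * s2 - 1))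
    else q ((1 - clip (box_dist (3 * s1 - 1) (3 * s2 - 1))) * clip (3 * s2 - 1)))"
  have u_unit: "(1 - clip a) * clip b \<in> {0..1}" for a b by (intro unit_mult) auto
  have cu: "continuous_on unit_square (\<lambda>x. u (fst x, snd x))"
    unfolding u_def prod.case
    by (intro continuous_on_cases_le continuous_on_square_compose[OF h1(1)]
        continuous_on_path_compose[OF q'(1)] continuous_intros)
      (use u_unit h_clip in \<open>auto simp: mem_Times_iff clip_eq_0\<close>)
  have rim1: "1 \<le> box_dist (- 1) z" "1 \<le> box_dist 2 z" "1 \<le> box_dist z (- 1)" "1 \<le> box_dist z 2" for z
    by (auto simp: box_dist_def)
  have rim0: "\<not> box_dist (- 1) z \<le> 0" "\<not> box_dist 2 z \<le> 0" "\<not> box_dist z (- 1) \<le> 0" "\<not> box_dist z 2 \<le> 0" for z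
    using rim1[of z] by linarith+
  have "u \<in> pi2_maps B (q 0)"
    unfolding pi2_maps_iff
  proof (intro conjI ballI)
    show "continuous_on unit_square u" using cu by simp
    show "u (a, b) \<in> B" for a b using h1(2) q'(2) u_unit by (auto simp: u_def)
    show "u (0, s) = q 0" "u (1, s) = q 0" "u (s, 0) = q 0" "u (s, 1) = q 0" for s
      by (simp_all add: u_def rim0 rim1 clip_eq_1)
  qed
  then obtain k where k: "k \<in> pi2_maps A (q 0)" and ku: "k \<in> pi2_class X (q 0) u"
    using pi2_replace q'(3) by blast
  obtain N where cN: "continuous_cube N"
    and NX: "\<And>t a b. t \<in> {0..1} \<Longrightarrow> a \<in> {0..1} \<Longrightarrow> b \<in> {0..1} \<Longrightarrow> N t a b \<in> X"
    and Nrim: "\<And>t s. t \<in> {0..1} \<Longrightarrow> s \<in> {0..1} \<Longrightarrow>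
      N t 0 s = q 0 \<and> N t 1 s = q 0 \<and> N t s 0 = q 0 \<and> N t s 1 = q 0"
    and Nends: "\<And>a b. a \<in> {0..1} \<Longrightarrow> b \<in> {0..1} \<Longrightarrow> N 0 a b = u (a, b) \<and> N 1 a b = k (a, b)"
    using pi2_class_cube[OF ku] by blast
  have ck: "continuous_on unit_square k" and kA: "\<And>a b. a \<in> {0..1} \<Longrightarrow> b \<in> {0..1} \<Longrightarrow> k (a, b) \<in> A"
    and krim: "\<And>s. s \<in> {0..1} \<Longrightarrow> k (0, s) = q 0 \<and> k (1, s) = q 0 \<and> k (s, 0) = q 0 \<and> k (s, 1) = q 0"
    using k unfolding pi2_maps_iff by blast+
  define \<kappa> where "\<kappa> = (\<lambda>s. clip ((5 * s - 1) / 3))"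
  have \<kappa>_unit: "\<kappa> s \<in> {0..1}" for s by (simp add: \<kappa>_def)
  have c\<kappa>: "continuous_on S (\<lambda>x. \<kappa> (v x))" if "continuous_on S v" for S :: "(real \<times> real \<times> real) set" and v
    unfolding \<kappa>_def using that by (intro continuous_intros) auto
  have c\<phi>: "continuous_on S (\<lambda>x. \<phi> (v x))" if "continuous_on S v" for S :: "(real \<times> real \<times> real) set" and v
    unfolding \<phi>_def using that by (intro continuous_intros)
  have d1: "(\<kappa> s1 = 0 \<or> \<kappa> s1 = 1) \<or> (\<kappa> s2 = 0 \<or> \<kappa> s2 = 1)" if "?d s1 s2 \<ge> 1" for s1 s2
  proof -
    have "5 * s1 - 2 \<le> -1 \<or> 5 * s1 - 2 \<ge> 2 \<or> 5 * s2 - 2 \<le> -1 \<or> 5 * s2 - 2 \<ge> 2"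
      using that by (auto simp: box_dist_def le_max_iff_disj)
    then show ?thesis by (auto simp: \<kappa>_def clip_eq_0 clip_eq_1)
  qed

  \<comment> \<open>Inside the circle the homotopy \<open>N\<close> from \<open>u\<close> to \<open>k\<close> runs; \<open>\<kappa>\<close> is the rescaled coordinate
    there.\<close>
  define W where "W = (\<lambda>t s1 s2. if ?d s1 s2 \<le> 1 then N t (\<kappa> s1) (\<kappa> s2)
    else q (clip (?d s1 s2 - 1) * \<phi> s2))"
  have W_unit: "clip a * \<phi> b \<in> {0..1}" for a b by (intro unit_mult) (auto simp: \<phi>_def)
  have W_seam: "N t (\<kappa> s1) (\<kappa> s2) = q (clip (?d s1 s2 - 1) * \<phi> s2)"
    if "t \<in> {0..1}" "?d s1 s2 = 1" for t s1 s2
    using d1[of s1 s2] Nrim[OF that(1) \<kappa>_unit[of s1]] Nrim[OF that(1) \<kappa>_unit[of s2]] that(2)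
    by (auto simp: clip_eq_0)
  have cW: "continuous_cube W"
    unfolding W_def
  proof (intro continuous_cubeI continuous_on_cases_le)
    show "continuous_on {x \<in> {0..1::real} \<times> unit_square. ?d (fst (snd x)) (snd (snd x)) \<le> 1}
        (\<lambda>x. N (fst x) (\<kappa> (fst (snd x))) (\<kappa> (snd (snd x))))"
      by (intro continuous_on_cube_compose[OF cN] continuous_intros c\<kappa>) (use \<kappa>_unit in auto)
    show "continuous_on {x \<in> {0..1::real} \<times> unit_square. 1 \<le> ?d (fst (snd x)) (snd (snd x))}
        (\<lambda>x. q (clip (?d (fst (snd x)) (snd (snd x)) - 1) * \<phi> (snd (snd x))))"
      by (intro continuous_on_path_compose[OF q'(1)] continuous_intros c\<phi>, rule W_unit)
    show "N (fst x) (\<kappa> (fst (snd x))) (\<kappa> (snd (snd x)))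
        = q (clip (?d (fst (snd x)) (snd (snd x)) - 1) * \<phi> (snd (snd x)))"
      if "x \<in> {0..1::real} \<times> unit_square" "?d (fst (snd x)) (snd (snd x)) = 1" for x
      using that by (intro W_seam) auto
  qed (intro continuous_intros)
  have "glue1 (glue1 F (\<lambda>(s1, s2). E 1 s1 s2)) G \<simeq> glue1 (glue1 F (\<lambda>(s1, s2). W 1 s1 s2)) G"
  proof (rule glue1_middle_homotopy[OF FR GR FG(1) cW])
    show "W t a b \<in> X" if "t \<in> {0..1}" for t a b
      using NX[OF that \<kappa>_unit \<kappa>_unit] qX W_unit by (auto simp: W_def)
    show "W t s 0 \<in> A \<and> W t s 1 \<in> A" if "t \<in> {0..1}" "s \<in> {0..1}" for t s
      using d_rim[OF that(2)] qA by (simp add: W_def \<phi>(3,4) clip_id)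
    show "W t 0 s = G (0, s) \<and> W t 1 s = G (0, s)" if "t \<in> {0..1}" "s \<in> {0..1}" for t s
      using d_rim[OF that(2)] FG(2) that by (simp add: W_def clip_id)
    show "W 0 a b = (\<lambda>(s1, s2). E 1 s1 s2) (a, b) \<and> W 1 a b = (\<lambda>(s1, s2). W 1 s1 s2) (a, b)"
      if "a \<in> {0..1}" "b \<in> {0..1}" for a b
    proof (cases "?d a b \<le> 1")
      case True
      then have "5 * a - 2 \<in> {-1..2}" "5 * b - 2 \<in> {-1..2}" by (auto simp: box_dist_def)
      then have "\<kappa> a = (5 * a - 1) / 3" "\<kappa> b = (5 * b - 1) / 3" by (simp_all add: \<kappa>_def clip_id)
      then have centre: "3 * \<kappa> a - 1 = 5 * a - 2" "3 * \<kappa> b - 1 = 5 * b - 2" by simp_all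
      have "u (\<kappa> a, \<kappa> b) = E 1 a b"
        unfolding u_def prod.case centre using True by (simp add: E_def \<phi>_def clip_def)
      then show ?thesis using True Nends[OF \<kappa>_unit \<kappa>_unit] by (simp add: W_def)
    next
      case False
      have "?d a b \<le> 2" using that by (auto simp: box_dist_def)
      then show ?thesis using False by (simp add: W_def E_def clip_def)
    qed
  qed

  \<comment> \<open>Without the left wall, \<open>?e \<le> 1\<close> also contains the part of the outer collar to the left of the
    circle.  The square is at \<open>q 0\<close> there, because \<open>\<phi> s2 = 0\<close>, so \<open>k\<close> can slide to the left
    until nothing of it is left.\<close>
  let ?e = "\<lambda>s1 s2. max (max (2 - 5 * s1) (5 * s1 - 3)) (5 * s2 - 3)"
  have e_d: "?e s1 s2 \<le> ?d s1 s2" for s1 s2 by (auto simp: box_dist_def)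
  have far: "clip (?d s1 s2 - 1) * \<phi> s2 = 0" if "?e s1 s2 \<le> 1" for s1 s2
  proof (cases "?d s1 s2 \<le> 1")
    case False
    then have "5 * s2 - 2 \<le> 0" using that by (auto simp: box_dist_def)
    then show ?thesis by (simp add: \<phi>_def clip_eq_0)
  qed (simp add: clip_eq_0)
  define V where "V = (\<lambda>t s1 s2. if ?e s1 s2 \<le> 1 then k (\<kappa> s1, max t (\<kappa> s2))
    else q (clip (?d s1 s2 - 1) * \<phi> s2))"
  have e1: "k (\<kappa> s1, max t (\<kappa> s2)) = q 0" if "?e s1 s2 = 1" "t \<in> {0..1}" for t s1 s2
  proof -
    have "5 * s1 - 2 \<le> -1 \<or> 5 * s1 - 2 \<ge> 2 \<or> 5 * s2 - 2 \<ge> 2"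
      using that(1) by (auto simp: max_def split: if_splits)
    then have "\<kappa> s1 = 0 \<or> \<kappa> s1 = 1 \<or> \<kappa> s2 = 1" by (auto simp: \<kappa>_def clip_eq_0 clip_eq_1)
    moreover have "max t (\<kappa> s2) \<in> {0..1}" using \<kappa>_unit[of s2] that(2) by auto
    ultimately show ?thesis using krim[OF \<kappa>_unit[of s1]] krim[of "max t (\<kappa> s2)"] that(2)
      by (auto simp: max_def split: if_splits)
  qed
  have kV: "max t (\<kappa> s) \<in> {0..1}" if "t \<in> {0..1}" for t s using that \<kappa>_unit[of s] by auto
  have cV: "continuous_cube V"
    unfolding V_def
  proof (intro continuous_cubeI continuous_on_cases_le)
    show "continuous_on {x \<in> {0..1::real} \<times> unit_square. ?e (fst (snd x)) (snd (snd x)) \<le> 1}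
        (\<lambda>x. k (\<kappa> (fst (snd x)), max (fst x) (\<kappa> (snd (snd x)))))"
      by (intro continuous_on_square_compose[OF ck] continuous_intros c\<kappa>) (use \<kappa>_unit kV in auto)
    show "continuous_on {x \<in> {0..1::real} \<times> unit_square. 1 \<le> ?e (fst (snd x)) (snd (snd x))}
        (\<lambda>x. q (clip (?d (fst (snd x)) (snd (snd x)) - 1) * \<phi> (snd (snd x))))"
      by (intro continuous_on_path_compose[OF q'(1)] continuous_intros c\<phi>, rule W_unit)
    show "k (\<kappa> (fst (snd x)), max (fst x) (\<kappa> (snd (snd x))))
        = q (clip (?d (fst (snd x)) (snd (snd x)) - 1) * \<phi> (snd (snd x)))"
      if "x \<in> {0..1::real} \<times> unit_square" "?e (fst (snd x)) (snd (snd x)) = 1" for x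
      using that e1[OF that(2), of "fst x"] far[of "fst (snd x)" "snd (snd x)"] by auto
  qed (intro continuous_intros)
  have "glue1 (glue1 F (\<lambda>(s1, s2). W 1 s1 s2)) G \<simeq> glue1 (glue1 F (\<lambda>(s1, s2). V 1 s1 s2)) G"
  proof (rule glue1_middle_homotopy[OF FR GR FG(1) cV])
    show "V t a b \<in> X" if "t \<in> {0..1}" for t a b
      using kA[OF \<kappa>_unit kV[OF that]] A_sub qX W_unit by (auto simp: V_def)
    show "V t s 0 \<in> A \<and> V t s 1 \<in> A" if "t \<in> {0..1}" "s \<in> {0..1}" for t s
      using d_rim[OF that(2)] qA kA[OF \<kappa>_unit kV[OF that(1)]] by (simp add: V_def \<phi>(3,4) clip_id)
    show "V t 0 s = G (0, s) \<and> V t 1 s = G (0, s)" if "t \<in> {0..1}" "s \<in> {0..1}" for t s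
      using d_rim[OF that(2)] FG(2) that by (simp add: V_def clip_id)
    show "V 0 a b = (\<lambda>(s1, s2). W 1 s1 s2) (a, b) \<and> V 1 a b = (\<lambda>(s1, s2). V 1 s1 s2) (a, b)"
      if "a \<in> {0..1}" "b \<in> {0..1}" for a b
    proof (cases "?e a b \<le> 1")
      case True
      have "W 1 a b = k (\<kappa> a, \<kappa> b)"
      proof (cases "?d a b \<le> 1")
        case False
        then have "\<kappa> b = 0" using True by (auto simp: box_dist_def \<kappa>_def clip_eq_0)
        then show ?thesis using False krim[OF \<kappa>_unit[of a]] by (simp add: W_def far[OF True])
      qed (use Nends[OF \<kappa>_unit \<kappa>_unit] in \<open>simp add: W_def\<close>)
      moreover have "V 0 a b = k (\<kappa> a, \<kappa> b)" using True \<kappa>_unit[of b] by (simp add: V_def)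
      ultimately show ?thesis by simp
    next
      case False
      then have "\<not> ?d a b \<le> 1" using e_d[of a b] by linarith
      then show ?thesis using False by (auto simp: V_def W_def)
    qed
  qed

  \<comment> \<open>The argument of \<open>q\<close> depends on the distance from the rim only through a factor, which is moved
    to \<open>1\<close> on a straight line.\<close>
  define L where "L = (\<lambda>t s1 s2. q (((1 - t) * clip (?d s1 s2 - 1) + t * 1) * \<phi> s2))"
  have L_unit: "((1 - t) * clip a + t * 1) * \<phi> b \<in> {0..1}" if "t \<in> {0..1}" for t a b
    by (intro unit_mult convex_combination_unit) (use that in \<open>auto simp: \<phi>_def\<close>)
  have cL: "continuous_cube L"
    unfolding L_def
    by (intro continuous_cubeI continuous_on_path_compose[OF q'(1)] continuous_intros c\<phi>, rule L_unit) auto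
  have "glue1 (glue1 F (\<lambda>(s1, s2). V 1 s1 s2)) G \<simeq>
      glue1 (glue1 F (\<lambda>(s1, s2). degenerate1 q (\<phi> s1, \<phi> s2))) G"
  proof (rule glue1_middle_homotopy[OF FR GR FG(1) cL])
    show "L t a b \<in> X" if "t \<in> {0..1}" for t a b
      using qX L_unit[OF that] by (simp add: L_def)
    show "L t s 0 \<in> A \<and> L t s 1 \<in> A" if "t \<in> {0..1}" "s \<in> {0..1}" for t s
      using d_rim[OF that(2)] qA by (simp add: L_def \<phi>(3,4) clip_id)
    show "L t 0 s = G (0, s) \<and> L t 1 s = G (0, s)" if "t \<in> {0..1}" "s \<in> {0..1}" for t s
      using d_rim[OF that(2)] FG(2) that by (simp add: L_def clip_id)
    show "L 0 a b = (\<lambda>(s1, s2). V 1 s1 s2) (a, b) \<and>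
        L 1 a b = (\<lambda>(s1, s2). degenerate1 q (\<phi> s1, \<phi> s2)) (a, b)"
      if "a \<in> {0..1}" "b \<in> {0..1}" for a b
    proof -
      have "V 1 a b = q (clip (?d a b - 1) * \<phi> b)"
      proof (cases "?e a b \<le> 1")
        case True
        have "max 1 (\<kappa> b) = 1" using \<kappa>_unit[of b] by simp
        then show ?thesis using True krim[OF \<kappa>_unit[of a]] by (simp add: V_def far[OF True])
      qed (auto simp: V_def)
      then show ?thesis by (simp add: L_def degenerate1_def)
    qed
  qed

  have "glue1 (glue1 f h) g \<simeq> glue1 (glue1 F (\<lambda>(s1, s2). h (\<phi> s1, \<phi> s2))) G"
    unfolding F_def G_def by (rule glue1_stretch[OF f hR g \<phi>]) (use hq fq gq in auto)
  note this
  also note \<open>glue1 (glue1 F (\<lambda>(s1, s2). h (\<phi> s1, \<phi> s2))) G \<simeq> glue1 (glue1 F (\<lambda>(s1, s2). E 1 s1 s2)) G\<close>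
  also note \<open>glue1 (glue1 F (\<lambda>(s1, s2). E 1 s1 s2)) G \<simeq> glue1 (glue1 F (\<lambda>(s1, s2). W 1 s1 s2)) G\<close>
  also note \<open>glue1 (glue1 F (\<lambda>(s1, s2). W 1 s1 s2)) G \<simeq> glue1 (glue1 F (\<lambda>(s1, s2). V 1 s1 s2)) G\<close>
  also note \<open>glue1 (glue1 F (\<lambda>(s1, s2). V 1 s1 s2)) G \<simeq>
      glue1 (glue1 F (\<lambda>(s1, s2). degenerate1 q (\<phi> s1, \<phi> s2))) G\<close>
  also have "glue1 (glue1 F (\<lambda>(s1, s2). degenerate1 q (\<phi> s1, \<phi> s2))) G \<simeq> glue1 (glue1 f (degenerate1 q)) g"
    unfolding F_def G_def
    by (intro rho_homotopic_sym[OF glue1_stretch] f g \<phi> degenerate1_in_R q)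
      (use fq gq in \<open>auto simp: degenerate1_def\<close>)
  also have "glue1 (glue1 f (degenerate1 q)) g \<simeq> glue1 f g"
    by (intro glue1_middle_unit f g) (use fq gq in auto)
  finally show ?thesis .
qed

end

section \<open>The fundamental groupoid\<close>

lemma path_class_eqI: "homotopic_paths Y p q \<Longrightarrow> path_class Y q = path_class Y p"
  unfolding path_class_def using homotopic_paths_trans homotopic_paths_sym by blast

lemma path_class_eq_iff:
  assumes "p \<in> paths_on Y C" shows "path_class Y p = path_class Y q \<longleftrightarrow> homotopic_paths Y p q"
proof
  assume "path_class Y p = path_class Y q"
  moreover have "p \<in> path_class Y p" using assms by (simp add: path_class_def paths_on_def)
  ultimately show "homotopic_paths Y p q" by (simp add: path_class_def homotopic_paths_sym)
qed (simp add: path_class_eqI)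

lemma path_class_cong:
  assumes "p \<in> paths_on Y C" "\<And>s. s \<in> {0..1} \<Longrightarrow> p s = q s" shows "path_class Y p = path_class Y q"
  using assms by (intro path_class_eqI homotopic_paths_sym[OF homotopic_paths_eq]) (auto simp: paths_on_def)

lemma the_elem_constant_image: "x \<in> S \<Longrightarrow> (\<And>y. y \<in> S \<Longrightarrow> F y = F x) \<Longrightarrow> the_elem (F ` S) = F x"
  by (rule the_elem_image_unique) blast+

lemma paths_on_self_class: "p \<in> paths_on Y C \<Longrightarrow> p \<in> path_class Y p"
  by (simp add: path_class_def paths_on_def)

lemma fundamental_groupoid_simps:
  "Obj (fundamental_groupoid Y C) = C"
  "Arr (fundamental_groupoid Y C) = path_class Y ` paths_on Y C"
  "Ide (fundamental_groupoid Y C) c = path_class Y (\<lambda>_. c)"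
  by (simp_all add: fundamental_groupoid_def)

lemma Src_path_class:
  assumes "p \<in> paths_on Y C" shows "Src (fundamental_groupoid Y C) (path_class Y p) = p 0"
proof -
  have "the_elem (pathstart ` path_class Y p) = pathstart p"
    by (rule the_elem_constant_image[OF paths_on_self_class[OF assms]])
      (auto simp: path_class_def dest: homotopic_paths_imp_pathstart)
  then show ?thesis by (simp add: fundamental_groupoid_def pathstart_def)
qed

lemma Tgt_path_class:
  assumes "p \<in> paths_on Y C" shows "Tgt (fundamental_groupoid Y C) (path_class Y p) = p 1"
proof -
  have "the_elem (pathfinish ` path_class Y p) = pathfinish p"
    by (rule the_elem_constant_image[OF paths_on_self_class[OF assms]])
      (auto simp: path_class_def dest: homotopic_paths_imp_pathfinish)
  then show ?thesis by (simp add: fundamental_groupoid_def pathfinish_def)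
qed

lemma Cmp_path_class:
  assumes "p \<in> paths_on Y C" "q \<in> paths_on Y C" "p 1 = q 0"
  shows "Cmp (fundamental_groupoid Y C) (path_class Y p) (path_class Y q) = path_class Y (p +++ q)"
proof -
  have "{path_class Y (p' +++ q') | p' q'. p' \<in> path_class Y p \<and> q' \<in> path_class Y q \<and>
      pathfinish p' = pathstart q'} = {path_class Y (p +++ q)}" (is "?L = _")
  proof
    show "?L \<subseteq> {path_class Y (p +++ q)}"
    proof clarify
      fix p' q' assume "p' \<in> path_class Y p" "q' \<in> path_class Y q"
      then have "homotopic_paths Y (p +++ q) (p' +++ q')"
        using assms(3) unfolding path_class_def mem_Collect_eq
        by (intro homotopic_paths_join) (auto simp: pathstart_def pathfinish_def)
      then show "path_class Y (p' +++ q') = path_class Y (p +++ q)" by (rule path_class_eqI)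
    qed
    show "{path_class Y (p +++ q)} \<subseteq> ?L"
      using assms paths_on_self_class[OF assms(1)] paths_on_self_class[OF assms(2)]
      by (auto simp: pathstart_def pathfinish_def)
  qed
  then show ?thesis by (simp add: fundamental_groupoid_def)
qed

lemma const_in_paths_on: "c \<in> C \<Longrightarrow> C \<subseteq> Y \<Longrightarrow> (\<lambda>_. c) \<in> paths_on Y C"
  by (auto simp: paths_on_def path_def path_image_def pathstart_def pathfinish_def)

lemma join_in_paths_on: "p \<in> paths_on Y C \<Longrightarrow> q \<in> paths_on Y C \<Longrightarrow> p 1 = q 0 \<Longrightarrow> p +++ q \<in> paths_on Y C"
  unfolding paths_on_def pathstart_def[symmetric] pathfinish_def[symmetric]
  by (simp add: subset_path_image_join)

lemma reverse_in_paths_on: "p \<in> paths_on Y C \<Longrightarrow> reversepath p \<in> paths_on Y C"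
  by (auto simp: paths_on_def)

lemma path_class_reparametrize:
  assumes p: "p \<in> paths_on Y C" and "continuous_on {0..1} \<phi>" "continuous_on {0..1} \<psi>"
    and "\<And>s. s \<in> {0..1} \<Longrightarrow> \<phi> s \<in> {0..1} \<and> \<psi> s \<in> {0..1}" "\<phi> 0 = \<psi> 0" "\<phi> 1 = \<psi> 1"
    and "q = p \<circ> \<phi>" "r = p \<circ> \<psi>"
  shows "path_class Y q = path_class Y r"
proof -
  have "closed_segment (\<phi> s) (\<psi> s) \<subseteq> {0..1}" if "s \<in> {0..1}" for s
    using assms(4)[OF that] by (intro closed_segment_subset) auto
  then have "homotopic_paths {0..1} \<phi> \<psi>"
    using assms(2-6) by (intro homotopic_paths_linear) (auto simp: path_def pathstart_def pathfinish_def)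
  then have "homotopic_paths Y (p \<circ> \<phi>) (p \<circ> \<psi>)"
    using p by (rule_tac homotopic_paths_continuous_image)
      (auto simp: paths_on_def path_def path_image_def)
  then show ?thesis using assms(7,8) by (simp add: path_class_eqI)
qed

lemma groupoid_fundamental_groupoid:
  assumes "C \<subseteq> Y" shows "groupoid (fundamental_groupoid Y C)"
proof -
  let ?G = "fundamental_groupoid Y C"
  note [simp] = Src_path_class Tgt_path_class Cmp_path_class
  have const: "(\<lambda>_. c) \<in> paths_on Y C" if "c \<in> C" for c using const_in_paths_on that assms by blast
  have ends: "p 0 \<in> C" "p 1 \<in> C" if "p \<in> paths_on Y C" for p
    using that by (auto simp: paths_on_def pathstart_def pathfinish_def)
  have J: "(p +++ q) 0 = p 0" "(p +++ q) 1 = q 1" for p q :: "real \<Rightarrow> 'a" by (simp_all add: joinpaths_def)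
  have assoc: "path_class Y ((p +++ q) +++ r) = path_class Y (p +++ (q +++ r))"
    if "p \<in> paths_on Y C" "q \<in> paths_on Y C" "r \<in> paths_on Y C" "p 1 = q 0" "q 1 = r 0" for p q r
    using that by (intro path_class_eqI homotopic_paths_assoc) (auto simp: paths_on_def pathstart_def pathfinish_def)
  have lunit: "path_class Y ((\<lambda>_. p 0) +++ p) = path_class Y p" if "p \<in> paths_on Y C" for p
  proof (rule path_class_reparametrize[OF that, of "\<lambda>s. max 0 (2 * s - 1)" "\<lambda>s. s"])
    show "(\<lambda>_. p 0) +++ p = p \<circ> (\<lambda>s. max 0 (2 * s - 1))"
    proof
      show "((\<lambda>_. p 0) +++ p) s = (p \<circ> (\<lambda>s. max 0 (2 * s - 1))) s" for s
        by (cases "s \<le> 1/2") (auto simp: joinpaths_def)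
    qed
  qed (auto intro!: continuous_intros)
  have runit: "path_class Y (p +++ (\<lambda>_. p 1)) = path_class Y p" if "p \<in> paths_on Y C" for p
  proof (rule path_class_reparametrize[OF that, of "\<lambda>s. min 1 (2 * s)" "\<lambda>s. s"])
    show "p +++ (\<lambda>_. p 1) = p \<circ> (\<lambda>s. min 1 (2 * s))"
    proof
      show "(p +++ (\<lambda>_. p 1)) s = (p \<circ> (\<lambda>s. min 1 (2 * s))) s" for s
        by (cases "s \<le> 1/2") (auto simp: joinpaths_def)
    qed
  qed (auto intro!: continuous_intros)
  have inv: "path_class Y (p +++ reversepath p) = path_class Y (\<lambda>_. p 0)" if "p \<in> paths_on Y C" for p
  proof (rule path_class_reparametrize[OF that, of "\<lambda>s. 1 - \<bar>2 * s - 1\<bar>" "\<lambda>s. 0"])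
    show "p +++ reversepath p = p \<circ> (\<lambda>s. 1 - \<bar>2 * s - 1\<bar>)"
    proof
      show "(p +++ reversepath p) s = (p \<circ> (\<lambda>s. 1 - \<bar>2 * s - 1\<bar>)) s" for s
        by (cases "s \<le> 1/2") (auto simp: joinpaths_def reversepath_def)
    qed
  qed (auto simp: abs_le_iff fun_eq_iff intro!: continuous_intros)
  show ?thesis
    unfolding groupoid_def
  proof (intro conjI ballI impI)
    fix f assume "f \<in> Arr ?G"
    then obtain p where p: "p \<in> paths_on Y C" "f = path_class Y p" by (auto simp: fundamental_groupoid_simps)
    show "Src ?G f \<in> Obj ?G" "Tgt ?G f \<in> Obj ?G" using p ends by (auto simp: fundamental_groupoid_simps)
    show "Cmp ?G (Ide ?G (Src ?G f)) f = f" "Cmp ?G f (Ide ?G (Tgt ?G f)) = f"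
      using p ends const lunit runit by (simp_all add: fundamental_groupoid_simps)
    have r: "reversepath p \<in> paths_on Y C" "reversepath p 0 = p 1" "reversepath p 1 = p 0"
      using reverse_in_paths_on[OF p(1)] by (simp_all add: reversepath_def)
    show "\<exists>g\<in>Arr ?G. Src ?G g = Tgt ?G f \<and> Tgt ?G g = Src ?G f \<and>
        Cmp ?G f g = Ide ?G (Src ?G f) \<and> Cmp ?G g f = Ide ?G (Tgt ?G f)"
      using p r inv[OF p(1)] inv[OF r(1)]
      by (intro bexI[of _ "path_class Y (reversepath p)"]) (simp_all add: fundamental_groupoid_simps)
  next
    fix x assume "x \<in> Obj ?G"
    then show "Ide ?G x \<in> Arr ?G" "Src ?G (Ide ?G x) = x" "Tgt ?G (Ide ?G x) = x"
      using const by (simp_all add: fundamental_groupoid_simps)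
  next
    fix f g assume "f \<in> Arr ?G" "g \<in> Arr ?G" and m: "Tgt ?G f = Src ?G g"
    then obtain p q where p: "p \<in> paths_on Y C" "f = path_class Y p"
      and q: "q \<in> paths_on Y C" "g = path_class Y q" by (auto simp: fundamental_groupoid_simps)
    have pq: "p 1 = q 0" using m p q by simp
    note join = join_in_paths_on[OF p(1) q(1) pq]
    show "Cmp ?G f g \<in> Arr ?G" "Src ?G (Cmp ?G f g) = Src ?G f" "Tgt ?G (Cmp ?G f g) = Tgt ?G g"
      using p q pq join J by (simp_all add: fundamental_groupoid_simps)
    fix h assume "h \<in> Arr ?G" "Tgt ?G g = Src ?G h"
    then obtain r where r: "r \<in> paths_on Y C" "h = path_class Y r" "q 1 = r 0"
      using q by (auto simp: fundamental_groupoid_simps)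
    show "Cmp ?G (Cmp ?G f g) h = Cmp ?G f (Cmp ?G g h)"
      using p q r pq join join_in_paths_on[OF q(1) r(1,3)] J assoc by simp
  qed
qed

section \<open>The vertical groupoid of squares\<close>

context triad begin

lemma edge1_class: "f \<in> R \<Longrightarrow> e \<in> {0, 1} \<Longrightarrow> g \<in> rho_class X A B C f \<Longrightarrow>
    path_class B (edge1 e g) = path_class B (edge1 e f)"
  by (intro path_class_eqI rho_homotopic_edge1) (auto simp: rho_homotopic_def)

lemma self_in_class: "f \<in> R \<Longrightarrow> f \<in> rho_class X A B C f"
  using rho_homotopic_refl rho_homotopic_def by blast

lemma Src_rho1:
  assumes f: "f \<in> R" shows "Src (rho1 X A B C) (rho_class X A B C f) = path_class B (edge1 0 f)"
  unfolding rho1_def gpd.simps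
  by (rule the_elem_constant_image[where F = "\<lambda>\<alpha>. path_class B (edge1 0 \<alpha>)",
        OF self_in_class[OF f] edge1_class[OF f]]) simp

lemma Tgt_rho1:
  assumes f: "f \<in> R" shows "Tgt (rho1 X A B C) (rho_class X A B C f) = path_class B (edge1 1 f)"
  unfolding rho1_def gpd.simps
  by (rule the_elem_constant_image[where F = "\<lambda>\<alpha>. path_class B (edge1 1 \<alpha>)",
        OF self_in_class[OF f] edge1_class[OF f]]) simp

lemma degenerate1_homotopic:
  assumes p: "p \<in> paths_on B C" and pq: "homotopic_paths B p q"
  shows "degenerate1 p \<simeq> degenerate1 q"
proof -
  obtain h where h: "h \<in> connectors1 B p q" using pq homotopic_paths_iff_connectors1 by blast
  note h' = connectors1D[OF h] and p' = paths_onD[OF p]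
  have pA: "p 0 \<in> A" "p 1 \<in> A" using p' C_sub_A by blast+
  show ?thesis
  proof (rule rho_homotopicI)
    show "rho_homotopy X A B C (\<lambda>t s1 s2. h (t, s2))"
    proof (rule rho_homotopyI[where nw = "p 0" and ne = "p 1" and sw = "p 0" and se = "p 1"])
      show "continuous_cube (\<lambda>t s1 s2. h (t, s2))"
        by (intro continuous_cubeI continuous_on_square_compose[OF h'(1)] continuous_intros) auto
      show "\<And>t a b. t \<in> {0..1} \<Longrightarrow> a \<in> {0..1} \<Longrightarrow> b \<in> {0..1} \<Longrightarrow> h (t, b) \<in> X" using h'(2) B_sub by blast
    qed (use h' p' pA in simp_all)
  qed (use h' in \<open>simp_all add: degenerate1_def\<close>)
qed

lemma Ide_rho1_singleton:
  assumes "p \<in> paths_on B C"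
  shows "(\<lambda>p. rho_class X A B C (degenerate1 p)) ` path_class B p = {rho_class X A B C (degenerate1 p)}"
proof -
  have "rho_class X A B C (degenerate1 q) = rho_class X A B C (degenerate1 p)" if "q \<in> path_class B p" for q
    by (rule rho_class_eqI[OF degenerate1_homotopic[OF assms]]) (use that in \<open>simp add: path_class_def\<close>)
  then show ?thesis using paths_on_self_class[OF assms] by blast
qed

lemma Ide_rho1: "p \<in> paths_on B C \<Longrightarrow>
    Ide (rho1 X A B C) (path_class B p) = rho_class X A B C (degenerate1 p)"
  by (simp add: rho1_def Ide_rho1_singleton)

end

context pi2_triad begin

text \<open>
  This is where the hypothesis on the second homotopy groups enters the composition: the loop
  produced by \<open>glue1_homotopic_up_to_loop\<close> is cancelled by \<open>glue1_loop\<close>.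
\<close>

lemma glue1_homotopic:
  assumes "f \<simeq> f'" "g \<simeq> g'"
    and fg: "\<And>s. s \<in> {0..1} \<Longrightarrow> f (1, s) = g (0, s)" and fg': "\<And>s. s \<in> {0..1} \<Longrightarrow> f' (1, s) = g' (0, s)"
  shows "glue1 f g \<simeq> glue1 f' g'"
proof -
  note R = rho_homotopic_memD(1,2)[OF assms(1)] rho_homotopic_memD(1,2)[OF assms(2)]
  obtain h where h: "h \<in> connectors1 B (edge1 1 f') (edge1 0 g')"
    "glue1 (glue1 f (degenerate1 (edge1 1 f))) g \<simeq> glue1 (glue1 f' h) g'"
    using glue1_homotopic_up_to_loop[OF assms(1,2) fg] by blast
  have "glue1 f g \<simeq> glue1 (glue1 f (degenerate1 (edge1 1 f))) g"
    by (intro rho_homotopic_sym[OF glue1_middle_unit] R) (simp add: edge1_def fg)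
  also note h(2)
  also have "glue1 (glue1 f' h) g' \<simeq> glue1 f' g'" by (intro glue1_loop R fg' h(1))
  finally show ?thesis .
qed

text \<open>
  A connector can be absorbed into the upper square, which reduces the general composite to the
  gluing of squares with equal adjacent edges.
\<close>

lemma composite1_homotopic:
  assumes "f \<simeq> f'" "g \<simeq> g'"
    and h: "h \<in> connectors1 B (edge1 1 f) (edge1 0 g)" and h': "h' \<in> connectors1 B (edge1 1 f') (edge1 0 g')"
  shows "glue1 (glue1 f h) g \<simeq> glue1 (glue1 f' h') g'"
proof (rule glue1_homotopic[OF _ assms(2)])
  note R = rho_homotopic_memD(1,2)[OF assms(1)]
  have "glue1 f h \<simeq> f" by (rule glue1_connector[OF R(1) h])
  also note assms(1)
  also have "f' \<simeq> glue1 f' h'" by (rule rho_homotopic_sym[OF glue1_connector[OF R(2) h']])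
  finally show "glue1 f h \<simeq> glue1 f' h'" .
qed (use connectors1D(4)[OF h] connectors1D(4)[OF h'] in \<open>simp_all add: glue1_def edge1_def\<close>)

lemma rho_composites1_eq:
  assumes f: "f \<in> R" and g: "g \<in> R" and h: "h \<in> connectors1 B (edge1 1 f) (edge1 0 g)"
  shows "rho_composites1 X A B C (rho_class X A B C f) (rho_class X A B C g) =
    {rho_class X A B C (glue1 (glue1 f h) g)}"
proof
  show "rho_composites1 X A B C (rho_class X A B C f) (rho_class X A B C g)
      \<subseteq> {rho_class X A B C (glue1 (glue1 f h) g)}"
    unfolding rho_composites1_def
    using composite1_homotopic[OF _ _ h] by (auto simp: rho_homotopic_def intro!: rho_class_eqI)
  show "{rho_class X A B C (glue1 (glue1 f h) g)}
      \<subseteq> rho_composites1 X A B C (rho_class X A B C f) (rho_class X A B C g)"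
    unfolding rho_composites1_def using self_in_class f g h by blast
qed

lemma rho_composites1_match:
  assumes f: "f \<in> R" and g: "g \<in> R" and fg: "\<And>s. s \<in> {0..1} \<Longrightarrow> f (1, s) = g (0, s)"
  shows "rho_composites1 X A B C (rho_class X A B C f) (rho_class X A B C g) = {rho_class X A B C (glue1 f g)}"
proof -
  have "degenerate1 (edge1 1 f) \<in> connectors1 B (edge1 1 f) (edge1 0 g)"
    using R_squaresD[OF degenerate1_in_R[OF edge1_in_paths_on[OF f, of 1]]] R_squaresD(3)[OF f] fg
    by (simp add: connectors1_iff degenerate1_def edge1_def)
  from rho_composites1_eq[OF f g this] show ?thesis
    using rho_class_eqI[OF glue1_middle_unit[OF f g, of "edge1 1 f"]] fg by (simp add: edge1_def)
qed

lemma Cmp_rho1: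
  assumes "f \<in> R" "g \<in> R" "\<And>s. s \<in> {0..1} \<Longrightarrow> f (1, s) = g (0, s)"
  shows "Cmp (rho1 X A B C) (rho_class X A B C f) (rho_class X A B C g) = rho_class X A B C (glue1 f g)"
  using rho_composites1_match[OF assms] by (simp add: rho1_def)

theorem composition1_inherited: "composition1_inherited X A B C"
  unfolding composition1_inherited_def
proof (intro ballI conjI impI)
  fix f g assume f: "f \<in> R" and g: "g \<in> R"
  show "\<exists>\<gamma>\<in>rho X A B C. rho_composites1 X A B C (rho_class X A B C f) (rho_class X A B C g) = {\<gamma>}"
    if hom: "homotopic_paths B (edge1 1 f) (edge1 0 g)"
  proof -
    obtain h where h: "h \<in> connectors1 B (edge1 1 f) (edge1 0 g)"
      using hom homotopic_paths_iff_connectors1 by blast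
    have "glue1 (glue1 f h) g \<in> R"
      using rho_homotopic_memD(1)[OF composite1_homotopic[OF rho_homotopic_refl[OF f] rho_homotopic_refl[OF g] h h]] .
    then show ?thesis using rho_composites1_eq[OF f g h] by (auto simp: rho_def)
  qed
  show "Cmp (rho1 X A B C) (rho_class X A B C f) (rho_class X A B C g) = rho_class X A B C (glue1 f g)"
    if "\<forall>t\<in>{0..1}. edge1 1 f t = edge1 0 g t"
    using that by (intro Cmp_rho1 f g) (simp add: edge1_def)
qed

end

context triad begin

text \<open>
  Putting a connector on top of \<open>g\<close> does not change its class and gives it the bottom edge of \<open>f\<close>
  as top edge.
\<close>

lemma rho_match1:
  assumes f: "f \<in> R" and g: "g \<in> R"
    and eq: "Tgt (rho1 X A B C) (rho_class X A B C f) = Src (rho1 X A B C) (rho_class X A B C g)"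
  obtains h where "h \<in> connectors1 B (edge1 1 f) (edge1 0 g)" "glue1 h g \<in> R"
    "rho_class X A B C (glue1 h g) = rho_class X A B C g"
    "\<And>s. s \<in> {0..1} \<Longrightarrow> f (1, s) = glue1 h g (0, s)"
proof -
  have "homotopic_paths B (edge1 1 f) (edge1 0 g)"
    using eq f g by (simp add: Tgt_rho1 Src_rho1 path_class_eq_iff[OF edge1_in_paths_on])
  then obtain h where h: "h \<in> connectors1 B (edge1 1 f) (edge1 0 g)"
    using homotopic_paths_iff_connectors1 by blast
  have hg: "glue1 h g \<simeq> g" by (rule connector_glue1[OF g h])
  show ?thesis
    by (rule that[OF h rho_homotopic_memD(1)[OF hg]])
      (use rho_class_eqI[OF hg] connectors1D(3)[OF h] in \<open>simp_all add: glue1_def edge1_def\<close>)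
qed

end

context pi2_triad begin

theorem groupoid_rho1: "groupoid (rho1 X A B C)"
proof -
  let ?G = "rho1 X A B C" and ?cls = "rho_class X A B C"
  have Arr: "Arr ?G = ?cls ` R" by (simp add: rho1_def rho_def)
  have Obj: "Obj ?G = path_class B ` paths_on B C" by (simp add: rho1_def fundamental_groupoid_simps)
  note [simp] = Src_rho1 Tgt_rho1 Ide_rho1
  have edge: "edge1 e f \<in> paths_on B C" if "f \<in> R" "e \<in> {0, 1}" for e f using edge1_in_paths_on that .
  have matched: "\<exists>g'\<in>R. ?cls g' = T \<and> (\<forall>s\<in>{0..1}. f (1, s) = g' (0, s))"
    if "f \<in> R" "T \<in> Arr ?G" "Tgt ?G (?cls f) = Src ?G T" for f T
  proof -
    obtain g where g: "g \<in> R" "T = ?cls g" using \<open>T \<in> Arr ?G\<close> unfolding Arr by blast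
    show ?thesis using rho_match1[OF \<open>f \<in> R\<close> g(1)] that(3) g(2) by metis
  qed
  have deg_edge: "edge1 e (degenerate1 p) = p" for e and p :: "real \<Rightarrow> 'a"
    by (simp add: edge1_def degenerate1_def)
  have glue_edge: "edge1 0 (glue1 f g) = edge1 0 f" "edge1 1 (glue1 f g) = edge1 1 g" for f g :: "'a square"
    by (simp_all add: edge1_def glue1_def)
  show ?thesis
    unfolding groupoid_def
  proof (intro conjI ballI impI)
    fix S assume "S \<in> Arr ?G"
    then obtain f where f: "f \<in> R" "S = ?cls f" by (auto simp: Arr)
    show "Src ?G S \<in> Obj ?G" "Tgt ?G S \<in> Obj ?G" using f edge by (simp_all add: Obj)
    have deg: "degenerate1 (edge1 e f) \<in> R" if "e \<in> {0, 1}" for e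
      by (rule degenerate1_in_R[OF edge[OF f(1) that]])
    show "Cmp ?G (Ide ?G (Src ?G S)) S = S"
    proof -
      have "Cmp ?G (?cls (degenerate1 (edge1 0 f))) (?cls f) = ?cls (glue1 (degenerate1 (edge1 0 f)) f)"
        by (rule Cmp_rho1) (use deg f in \<open>simp_all add: degenerate1_def edge1_def\<close>)
      also have "\<dots> = ?cls f"
        by (rule rho_class_eqI[symmetric, OF glue1_left_unit[OF f(1)]]) (simp add: edge1_def)
      finally show ?thesis using f edge by simp
    qed
    show "Cmp ?G S (Ide ?G (Tgt ?G S)) = S"
    proof -
      have "Cmp ?G (?cls f) (?cls (degenerate1 (edge1 1 f))) = ?cls (glue1 f (degenerate1 (edge1 1 f)))"
        by (rule Cmp_rho1) (use deg f in \<open>simp_all add: degenerate1_def edge1_def\<close>)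
      also have "\<dots> = ?cls f"
        by (rule rho_class_eqI[symmetric, OF glue1_right_unit[OF f(1)]]) (simp add: edge1_def)
      finally show ?thesis using f edge by simp
    qed
    have inv: "Cmp ?G (?cls g) (?cls (flip1 g)) = Ide ?G (path_class B (edge1 0 g))" if g: "g \<in> R" for g
    proof -
      have "Cmp ?G (?cls g) (?cls (flip1 g)) = ?cls (glue1 g (flip1 g))"
        by (rule Cmp_rho1) (use g flip1_in_R in \<open>simp_all add: flip1_def\<close>)
      also have "\<dots> = ?cls (degenerate1 (edge1 0 g))"
        by (rule rho_class_eqI[symmetric, OF glue1_flip1[OF g]])
      finally show ?thesis using g edge by simp
    qed
    have flip: "edge1 0 (flip1 f) = edge1 1 f" "edge1 1 (flip1 f) = edge1 0 f" "flip1 (flip1 f) = f"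
      by (auto simp: flip1_def edge1_def)
    show "\<exists>T\<in>Arr ?G. Src ?G T = Tgt ?G S \<and> Tgt ?G T = Src ?G S \<and>
        Cmp ?G S T = Ide ?G (Src ?G S) \<and> Cmp ?G T S = Ide ?G (Tgt ?G S)"
      using f inv[OF f(1)] inv[OF flip1_in_R[OF f(1)]] flip1_in_R[OF f(1)] flip
      by (intro bexI[of _ "?cls (flip1 f)"]) (simp_all add: Arr del: Ide_rho1)
  next
    fix P assume "P \<in> Obj ?G"
    then obtain p where p: "p \<in> paths_on B C" "P = path_class B p" by (auto simp: Obj)
    then show "Ide ?G P \<in> Arr ?G" "Src ?G (Ide ?G P) = P" "Tgt ?G (Ide ?G P) = P"
      using degenerate1_in_R by (simp_all add: Arr deg_edge)
  next
    fix S T assume S: "S \<in> Arr ?G" and T: "T \<in> Arr ?G" and m: "Tgt ?G S = Src ?G T"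
    obtain f where f: "f \<in> R" "S = ?cls f" using S by (auto simp: Arr)
    obtain g where g: "g \<in> R" "T = ?cls g" and fg: "\<And>s. s \<in> {0..1} \<Longrightarrow> f (1, s) = g (0, s)"
      using matched[OF f(1) T] m f(2) by metis
    have fgR: "glue1 f g \<in> R" using f g fg by (intro glue1_in_R_squares)
    have ST: "Cmp ?G S T = ?cls (glue1 f g)" unfolding f g by (rule Cmp_rho1[OF f(1) g(1) fg])
    show "Cmp ?G S T \<in> Arr ?G" "Src ?G (Cmp ?G S T) = Src ?G S" "Tgt ?G (Cmp ?G S T) = Tgt ?G T"
      unfolding ST using f g fgR by (simp_all add: Arr glue_edge)
    fix U assume U: "U \<in> Arr ?G" and m': "Tgt ?G T = Src ?G U"
    obtain h where h: "h \<in> R" "U = ?cls h" and gh: "\<And>s. s \<in> {0..1} \<Longrightarrow> g (1, s) = h (0, s)"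
      using matched[OF g(1) U] m' g(2) by metis
    have ghR: "glue1 g h \<in> R" using g h gh by (intro glue1_in_R_squares)
    have "Cmp ?G (Cmp ?G S T) U = ?cls (glue1 (glue1 f g) h)"
      unfolding ST h by (rule Cmp_rho1[OF fgR h(1)]) (simp add: glue1_def gh)
    also have "\<dots> = ?cls (glue1 f (glue1 g h))"
      by (rule rho_class_eqI[symmetric, OF glue1_assoc[OF f(1) g(1) h(1) fg gh]])
    also have "\<dots> = Cmp ?G S (?cls (glue1 g h))"
      unfolding f by (rule Cmp_rho1[symmetric, OF f(1) ghR]) (simp add: glue1_def fg)
    also have "?cls (glue1 g h) = Cmp ?G T U"
      unfolding g h by (rule Cmp_rho1[symmetric, OF g(1) h(1) gh])
    finally show "Cmp ?G (Cmp ?G S T) U = Cmp ?G S (Cmp ?G T U)" .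
  qed
qed

end

section \<open>Reflection in the diagonal\<close>

definition reflect :: "'a square \<Rightarrow> 'a square" where "reflect f = (\<lambda>(s1, s2). f (s2, s1))"

lemma reflect_apply [simp]: "reflect f (a, b) = f (b, a)" by (simp add: reflect_def)
lemma reflect_reflect [simp]: "reflect (reflect f) = f" by (auto simp: reflect_def)
lemma mem_reflect_image: "h \<in> reflect ` S \<longleftrightarrow> reflect h \<in> S" by (metis image_iff reflect_reflect)
lemma edge1_reflect [simp]: "edge1 e (reflect f) = edge2 e f" by (simp add: edge1_def edge2_def)
lemma edge2_reflect [simp]: "edge2 e (reflect f) = edge1 e f" by (simp add: edge1_def edge2_def)
lemma reflect_degenerate1 [simp]: "reflect (degenerate1 p) = degenerate2 p"
  by (auto simp: reflect_def degenerate1_def degenerate2_def)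
lemma reflect_glue1 [simp]: "reflect (glue1 f g) = glue2 (reflect f) (reflect g)"
  by (auto simp: reflect_def glue1_def glue2_def)
lemma reflect_glue2 [simp]: "reflect (glue2 f g) = glue1 (reflect f) (reflect g)"
  by (auto simp: reflect_def glue1_def glue2_def)

lemma continuous_on_reflect [simp]:
  "continuous_on unit_square (reflect f) \<longleftrightarrow> continuous_on unit_square f"
proof -
  have "continuous_on unit_square (reflect f)" if f: "continuous_on unit_square f" for f :: "'b::topological_space square"
  proof -
    have "continuous_on unit_square (\<lambda>x. f (snd x, fst x))"
      by (intro continuous_on_square_compose[OF f] continuous_intros) auto
    then show ?thesis by (simp add: reflect_def case_prod_unfold)
  qed
  from this[of f] this[of "reflect f"] show ?thesis by auto
qed

lemma square_maps_reflect [simp]: "reflect f \<in> square_maps Y \<longleftrightarrow> f \<in> square_maps Y"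
  by (auto simp: square_maps_iff)

lemma R_squares_reflect [simp]: "reflect f \<in> R_squares X A B C \<longleftrightarrow> f \<in> R_squares X B A C"
  by (auto simp: R_squares_iff)

lemma glue2_in_R_squares:
  assumes "f \<in> R_squares X A B C" "g \<in> R_squares X A B C" "\<And>s. s \<in> {0..1} \<Longrightarrow> f (s, 1) = g (s, 0)"
  shows "glue2 f g \<in> R_squares X A B C"
  using glue1_in_R_squares[of "reflect f" X B A C "reflect g"] assms
  by (metis R_squares_reflect reflect_apply reflect_glue2)

lemma connectors2_iff_reflect: "h \<in> connectors2 Y p q \<longleftrightarrow> reflect h \<in> connectors1 Y p q"
  by (simp add: connectors1_def connectors2_def)

lemma rho_homotopic_reflect [simp]:
  "rho_homotopic X A B C (reflect f) (reflect g) \<longleftrightarrow> rho_homotopic X B A C f g"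
proof -
  have *: "rho_homotopic X A B C (reflect f) (reflect g)" if "rho_homotopic X B A C f g" for A B and f g :: "'a square"
  proof -
    obtain H where H: "rho_homotopy X B A C H"
      and fg: "\<And>a b. a \<in> {0..1} \<Longrightarrow> b \<in> {0..1} \<Longrightarrow> H 0 a b = f (a, b) \<and> H 1 a b = g (a, b)"
      using \<open>rho_homotopic X B A C f g\<close> unfolding rho_homotopic_iff by blast
    note h = rho_homotopyD[OF H]
    have "rho_homotopy X A B C (\<lambda>t s1 s2. H t s2 s1)"
    proof (rule rho_homotopyI[where nw = "H 0 0 0" and ne = "H 0 1 0" and sw = "H 0 0 1" and se = "H 0 1 1"])
      show "continuous_cube (\<lambda>t s1 s2. H t s2 s1)"
        by (intro continuous_cubeI continuous_on_cube_compose[OF h(1)] continuous_intros) auto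
      show "\<And>t. t \<in> {0..1} \<Longrightarrow> H t 0 0 = H 0 0 0 \<and> H t 1 0 = H 0 1 0 \<and> H t 0 1 = H 0 0 1 \<and> H t 1 1 = H 0 1 1"
        using h(5) by blast
    qed (use h(2,3,4,6) in blast)+
    then show ?thesis by (rule rho_homotopicI) (use fg in simp_all)
  qed
  from *[of B A f g] *[of A B "reflect f" "reflect g"] show ?thesis by auto
qed

lemma rho_class_reflect: "rho_class X A B C (reflect f) = reflect ` rho_class X B A C f"
proof -
  have *: "g \<in> rho_class X A B C (reflect f) \<longleftrightarrow> reflect g \<in> rho_class X B A C f" for g
    using rho_homotopic_reflect[of X A B C f "reflect g"] by (simp add: rho_homotopic_def)
  show ?thesis by (rule set_eqI) (simp only: * mem_reflect_image)
qed

lemma rho_class_via_reflect: "rho_class X A B C f = reflect ` rho_class X B A C (reflect f)"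
  using rho_class_reflect[of X A B C "reflect f"] by simp

lemma rho_reflect: "rho X A B C = (`) reflect ` rho X B A C"
proof -
  have "R_squares X A B C = reflect ` R_squares X B A C"
    by (rule set_eqI) (simp add: mem_reflect_image)
  then show ?thesis unfolding rho_def by (simp add: image_image rho_class_reflect)
qed

text \<open>
  Taking images under \<open>reflect\<close> is an isomorphism from the vertical structure for \<open>(B, A)\<close> to the
  horizontal structure for \<open>(A, B)\<close>.
\<close>

lemma Src_rho2_reflect: "Src (rho2 X A B C) (reflect ` S) = Src (rho1 X B A C) S"
  by (simp add: rho1_def rho2_def image_image)

lemma Tgt_rho2_reflect: "Tgt (rho2 X A B C) (reflect ` S) = Tgt (rho1 X B A C) S"
  by (simp add: rho1_def rho2_def image_image)

lemma rho_composites2_reflect: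
  "rho_composites2 X A B C (reflect ` S) (reflect ` T) = (`) reflect ` rho_composites1 X B A C S T"
proof -
  have "rho_composites2 X A B C (reflect ` S) (reflect ` T) =
      {rho_class X A B C (glue2 (glue2 (reflect \<alpha>) (reflect h)) (reflect \<beta>)) | \<alpha> h \<beta>.
        \<alpha> \<in> S \<and> \<beta> \<in> T \<and> h \<in> connectors1 A (edge1 1 \<alpha>) (edge1 0 \<beta>)}"
    (is "?L = ?M")
  proof
    show "?L \<subseteq> ?M"
    proof
      fix \<gamma> assume "\<gamma> \<in> ?L"
      then obtain \<alpha> h \<beta> where "\<alpha> \<in> S" "\<beta> \<in> T"
        and h: "h \<in> connectors2 A (edge2 1 (reflect \<alpha>)) (edge2 0 (reflect \<beta>))"
        and \<gamma>: "\<gamma> = rho_class X A B C (glue2 (glue2 (reflect \<alpha>) h) (reflect \<beta>))"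
        unfolding rho_composites2_def by blast
      moreover have "reflect h \<in> connectors1 A (edge1 1 \<alpha>) (edge1 0 \<beta>)"
        using h by (simp add: connectors2_iff_reflect)
      moreover have "\<gamma> = rho_class X A B C (glue2 (glue2 (reflect \<alpha>) (reflect (reflect h))) (reflect \<beta>))"
        using \<gamma> by simp
      ultimately show "\<gamma> \<in> ?M" by blast
    qed
    show "?M \<subseteq> ?L"
    proof
      fix \<gamma> assume "\<gamma> \<in> ?M"
      then obtain \<alpha> h \<beta> where "\<alpha> \<in> S" "\<beta> \<in> T" and h: "h \<in> connectors1 A (edge1 1 \<alpha>) (edge1 0 \<beta>)"
        and "\<gamma> = rho_class X A B C (glue2 (glue2 (reflect \<alpha>) (reflect h)) (reflect \<beta>))"
        by blast
      moreover have "reflect h \<in> connectors2 A (edge2 1 (reflect \<alpha>)) (edge2 0 (reflect \<beta>))"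
        using h by (simp add: connectors2_iff_reflect)
      ultimately show "\<gamma> \<in> ?L" unfolding rho_composites2_def by blast
    qed
  qed
  also have "\<dots> = {reflect ` rho_class X B A C (glue1 (glue1 \<alpha> h) \<beta>) | \<alpha> h \<beta>.
        \<alpha> \<in> S \<and> \<beta> \<in> T \<and> h \<in> connectors1 A (edge1 1 \<alpha>) (edge1 0 \<beta>)}"
    by (simp flip: rho_class_reflect)
  also have "\<dots> = (`) reflect ` rho_composites1 X B A C S T"
    unfolding rho_composites1_def by blast
  finally show ?thesis .
qed

section \<open>The horizontal groupoid of squares\<close>

lemma groupoid_transfer:
  assumes G: "groupoid G" and "Obj G' = Obj G" "Arr G' = \<theta> ` Arr G"
    and st: "\<And>f. f \<in> Arr G \<Longrightarrow> Src G' (\<theta> f) = Src G f" "\<And>f. f \<in> Arr G \<Longrightarrow> Tgt G' (\<theta> f) = Tgt G f"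
    and ide: "\<And>x. x \<in> Obj G \<Longrightarrow> Ide G' x = \<theta> (Ide G x)"
    and cmp: "\<And>f g. f \<in> Arr G \<Longrightarrow> g \<in> Arr G \<Longrightarrow> Tgt G f = Src G g \<Longrightarrow> Cmp G' (\<theta> f) (\<theta> g) = \<theta> (Cmp G f g)"
  shows "groupoid G'"
proof -
  have O: "\<And>f. f \<in> Arr G \<Longrightarrow> Src G f \<in> Obj G \<and> Tgt G f \<in> Obj G"
    and I: "\<And>x. x \<in> Obj G \<Longrightarrow> Ide G x \<in> Arr G \<and> Src G (Ide G x) = x \<and> Tgt G (Ide G x) = x"
    and K: "\<And>f g. f \<in> Arr G \<Longrightarrow> g \<in> Arr G \<Longrightarrow> Tgt G f = Src G g \<Longrightarrow>
        Cmp G f g \<in> Arr G \<and> Src G (Cmp G f g) = Src G f \<and> Tgt G (Cmp G f g) = Tgt G g"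
    and L: "\<And>f g h. f \<in> Arr G \<Longrightarrow> g \<in> Arr G \<Longrightarrow> h \<in> Arr G \<Longrightarrow> Tgt G f = Src G g \<Longrightarrow> Tgt G g = Src G h \<Longrightarrow>
        Cmp G (Cmp G f g) h = Cmp G f (Cmp G g h)"
    and U: "\<And>f. f \<in> Arr G \<Longrightarrow> Cmp G (Ide G (Src G f)) f = f \<and> Cmp G f (Ide G (Tgt G f)) = f"
    and V: "\<And>f. f \<in> Arr G \<Longrightarrow> \<exists>g\<in>Arr G. Src G g = Tgt G f \<and> Tgt G g = Src G f \<and>
        Cmp G f g = Ide G (Src G f) \<and> Cmp G g f = Ide G (Tgt G f)"
    using G unfolding groupoid_def by blast+
  show ?thesis
    unfolding groupoid_def assms(2,3) ball_simps
  proof (intro conjI ballI impI)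
    fix f assume f: "f \<in> Arr G"
    show "Src G' (\<theta> f) \<in> Obj G" "Tgt G' (\<theta> f) \<in> Obj G" using O f st by simp_all
    show "Cmp G' (Ide G' (Src G' (\<theta> f))) (\<theta> f) = \<theta> f" "Cmp G' (\<theta> f) (Ide G' (Tgt G' (\<theta> f))) = \<theta> f"
      using O[OF f] I[of "Src G f"] I[of "Tgt G f"] U[OF f] f by (simp_all add: st ide cmp)
    obtain g where g: "g \<in> Arr G" "Src G g = Tgt G f" "Tgt G g = Src G f"
        "Cmp G f g = Ide G (Src G f)" "Cmp G g f = Ide G (Tgt G f)" using V[OF f] by blast
    have "Src G' (\<theta> g) = Tgt G' (\<theta> f) \<and> Tgt G' (\<theta> g) = Src G' (\<theta> f) \<and>
        Cmp G' (\<theta> f) (\<theta> g) = Ide G' (Src G' (\<theta> f)) \<and> Cmp G' (\<theta> g) (\<theta> f) = Ide G' (Tgt G' (\<theta> f))"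
      using f g O[OF f] by (simp add: st ide cmp)
    then show "\<exists>x\<in>\<theta> ` Arr G. Src G' x = Tgt G' (\<theta> f) \<and> Tgt G' x = Src G' (\<theta> f) \<and>
        Cmp G' (\<theta> f) x = Ide G' (Src G' (\<theta> f)) \<and> Cmp G' x (\<theta> f) = Ide G' (Tgt G' (\<theta> f))"
      using g(1) by blast
  next
    fix x assume "x \<in> Obj G"
    then show "Ide G' x \<in> \<theta> ` Arr G" "Src G' (Ide G' x) = x" "Tgt G' (Ide G' x) = x"
      using I by (simp_all add: ide st)
  next
    fix f g assume f: "f \<in> Arr G" and g: "g \<in> Arr G" and "Tgt G' (\<theta> f) = Src G' (\<theta> g)"
    then have fg: "Tgt G f = Src G g" by (simp add: st)
    show "Cmp G' (\<theta> f) (\<theta> g) \<in> \<theta> ` Arr G" "Src G' (Cmp G' (\<theta> f) (\<theta> g)) = Src G' (\<theta> f)"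
      "Tgt G' (Cmp G' (\<theta> f) (\<theta> g)) = Tgt G' (\<theta> g)"
      using K[OF f g fg] f g by (simp_all add: cmp fg st)
    fix h assume h: "h \<in> Arr G" and "Tgt G' (\<theta> g) = Src G' (\<theta> h)"
    then have gh: "Tgt G g = Src G h" using g by (simp add: st)
    show "Cmp G' (Cmp G' (\<theta> f) (\<theta> g)) (\<theta> h) = Cmp G' (\<theta> f) (Cmp G' (\<theta> g) (\<theta> h))"
      using K[OF f g fg] K[OF g h gh] L[OF f g h fg gh] f g h fg gh by (simp add: cmp)
  qed
qed

context triad begin

lemma triad_swap: "triad X B A C"
  using A_sub B_sub C_sub_A C_sub_B by unfold_locales

lemma Src_rho2: "f \<in> R \<Longrightarrow> Src (rho2 X A B C) (rho_class X A B C f) = path_class A (edge2 0 f)"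
  using triad.Src_rho1[OF triad_swap, of "reflect f"]
  by (simp add: rho_class_via_reflect[of X A B C f] Src_rho2_reflect)

lemma Tgt_rho2: "f \<in> R \<Longrightarrow> Tgt (rho2 X A B C) (rho_class X A B C f) = path_class A (edge2 1 f)"
  using triad.Tgt_rho1[OF triad_swap, of "reflect f"]
  by (simp add: rho_class_via_reflect[of X A B C f] Tgt_rho2_reflect)

lemma Ide_rho2: "p \<in> paths_on A C \<Longrightarrow> Ide (rho2 X A B C) (path_class A p) = rho_class X A B C (degenerate2 p)"
proof -
  assume p: "p \<in> paths_on A C"
  have "(\<lambda>p. rho_class X A B C (degenerate2 p)) ` path_class A p =
      (`) reflect ` (\<lambda>p. rho_class X B A C (degenerate1 p)) ` path_class A p"
    by (simp add: image_image flip: rho_class_reflect)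
  then show ?thesis
    by (simp add: rho2_def triad.Ide_rho1_singleton[OF triad_swap p] flip: rho_class_reflect)
qed

lemma rho_match2:
  assumes f: "f \<in> R" and g: "g \<in> R"
    and eq: "Tgt (rho2 X A B C) (rho_class X A B C f) = Src (rho2 X A B C) (rho_class X A B C g)"
  obtains h where "h \<in> connectors2 A (edge2 1 f) (edge2 0 g)" "glue2 h g \<in> R"
    "rho_class X A B C (glue2 h g) = rho_class X A B C g"
    "\<And>s. s \<in> {0..1} \<Longrightarrow> f (s, 1) = glue2 h g (s, 0)"
proof -
  have eq': "Tgt (rho1 X B A C) (rho_class X B A C (reflect f)) = Src (rho1 X B A C) (rho_class X B A C (reflect g))"
    using eq by (simp add: rho_class_via_reflect[of X A B C] Tgt_rho2_reflect Src_rho2_reflect)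
  obtain h where h: "h \<in> connectors1 A (edge1 1 (reflect f)) (edge1 0 (reflect g))"
    "glue1 h (reflect g) \<in> R_squares X B A C"
    "rho_class X B A C (glue1 h (reflect g)) = rho_class X B A C (reflect g)"
    "\<And>s. s \<in> {0..1} \<Longrightarrow> reflect f (1, s) = glue1 h (reflect g) (0, s)"
    using triad.rho_match1[OF triad_swap _ _ eq'] f g by auto
  have refl: "glue2 (reflect h) g = reflect (glue1 h (reflect g))" by simp
  show ?thesis
  proof (rule that[of "reflect h"])
    show "reflect h \<in> connectors2 A (edge2 1 f) (edge2 0 g)" using h(1) by (simp add: connectors2_iff_reflect)
    show "glue2 (reflect h) g \<in> R" unfolding refl using h(2) by (simp del: reflect_glue1)
    show "rho_class X A B C (glue2 (reflect h) g) = rho_class X A B C g"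
      unfolding refl by (simp add: rho_class_reflect h(3) image_image del: reflect_glue1)
    show "f (s, 1) = glue2 (reflect h) g (s, 0)" if "s \<in> {0..1}" for s
      unfolding refl using h(4)[OF that] by (simp del: reflect_glue1)
  qed
qed

lemma glue2_left_unit:
  assumes "f \<in> R" "\<And>s. s \<in> {0..1} \<Longrightarrow> p s = f (s, 0)"
  shows "glue2 (degenerate2 p) f \<simeq> f"
proof -
  have "rho_homotopic X B A C (glue1 (degenerate1 p) (reflect f)) (reflect f)"
    by (rule triad.glue1_left_unit[OF triad_swap]) (use assms in simp_all)
  then have "rho_homotopic X A B C (reflect (glue1 (degenerate1 p) (reflect f))) (reflect (reflect f))"
    unfolding rho_homotopic_reflect .
  then show ?thesis by simp
qed

end

context pi2_triad begin

lemma pi2_triad_swap: "pi2_triad X B A C"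
  using A_sub B_sub C_sub_A C_sub_B pi2_images by unfold_locales auto

lemma rho_composites2_match:
  assumes "f \<in> R" "g \<in> R" "\<And>s. s \<in> {0..1} \<Longrightarrow> f (s, 1) = g (s, 0)"
  shows "rho_composites2 X A B C (rho_class X A B C f) (rho_class X A B C g) = {rho_class X A B C (glue2 f g)}"
proof -
  have "rho_composites1 X B A C (rho_class X B A C (reflect f)) (rho_class X B A C (reflect g)) =
      {rho_class X B A C (glue1 (reflect f) (reflect g))}"
    by (rule pi2_triad.rho_composites1_match[OF pi2_triad_swap]) (use assms in simp_all)
  then show ?thesis
    by (simp add: rho_class_via_reflect[of X A B C f] rho_class_via_reflect[of X A B C g]
        rho_composites2_reflect rho_class_via_reflect[of X A B C "glue2 f g"])
qed

lemma Cmp_rho2: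
  assumes "f \<in> R" "g \<in> R" "\<And>s. s \<in> {0..1} \<Longrightarrow> f (s, 1) = g (s, 0)"
  shows "Cmp (rho2 X A B C) (rho_class X A B C f) (rho_class X A B C g) = rho_class X A B C (glue2 f g)"
  using rho_composites2_match[OF assms] by (simp add: rho2_def)

theorem composition2_inherited: "composition2_inherited X A B C"
  unfolding composition2_inherited_def
proof (intro ballI conjI impI)
  fix f g assume f: "f \<in> R" and g: "g \<in> R"
  show "\<exists>\<gamma>\<in>rho X A B C. rho_composites2 X A B C (rho_class X A B C f) (rho_class X A B C g) = {\<gamma>}"
    if hom: "homotopic_paths A (edge2 1 f) (edge2 0 g)"
  proof -
    obtain \<gamma> where "\<gamma> \<in> rho X B A C"
      "rho_composites1 X B A C (rho_class X B A C (reflect f)) (rho_class X B A C (reflect g)) = {\<gamma>}"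
      using pi2_triad.composition1_inherited[OF pi2_triad_swap] f g hom
      unfolding composition1_inherited_def by (metis R_squares_reflect edge1_reflect)
    then show ?thesis
      by (auto simp: rho_class_via_reflect[of X A B C f] rho_class_via_reflect[of X A B C g]
          rho_composites2_reflect rho_reflect[of X A B C])
  qed
  show "Cmp (rho2 X A B C) (rho_class X A B C f) (rho_class X A B C g) = rho_class X A B C (glue2 f g)"
    if "\<forall>t\<in>{0..1}. edge2 1 f t = edge2 0 g t"
    using that by (intro Cmp_rho2 f g) (simp add: edge2_def)
qed

lemma Cmp_rho2_reflect:
  assumes S: "S \<in> rho X B A C" and T: "T \<in> rho X B A C" and ST: "Tgt (rho1 X B A C) S = Src (rho1 X B A C) T"
  shows "Cmp (rho2 X A B C) (reflect ` S) (reflect ` T) = reflect ` Cmp (rho1 X B A C) S T"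
proof -
  obtain f g where f: "f \<in> R_squares X B A C" "S = rho_class X B A C f"
    and g: "g \<in> R_squares X B A C" "T = rho_class X B A C g"
    using S T by (auto simp: rho_def)
  obtain h where h: "glue1 h g \<in> R_squares X B A C" "rho_class X B A C (glue1 h g) = rho_class X B A C g"
    "\<And>s. s \<in> {0..1} \<Longrightarrow> f (1, s) = glue1 h g (0, s)"
    using triad.rho_match1[OF triad_swap f(1) g(1)] ST f(2) g(2) by metis
  have "rho_composites1 X B A C S T = {rho_class X B A C (glue1 f (glue1 h g))}"
    using pi2_triad.rho_composites1_match[OF pi2_triad_swap f(1) h(1,3)] by (simp add: f(2) g(2) h(2))
  then show ?thesis by (simp add: rho1_def rho2_def rho_composites2_reflect)
qed

theorem groupoid_rho2: "groupoid (rho2 X A B C)"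
proof (rule groupoid_transfer[OF pi2_triad.groupoid_rho1[OF pi2_triad_swap], where \<theta> = "(`) reflect"])
  show "Arr (rho2 X A B C) = (`) reflect ` Arr (rho1 X B A C)"
    by (simp add: rho1_def rho2_def rho_reflect[of X A B C])
  show "Ide (rho2 X A B C) P = reflect ` Ide (rho1 X B A C) P" if "P \<in> Obj (rho1 X B A C)" for P
  proof -
    obtain p where p: "p \<in> paths_on A C" "P = path_class A p"
      using \<open>P \<in> Obj (rho1 X B A C)\<close> by (auto simp: rho1_def fundamental_groupoid_simps)
    show ?thesis
      unfolding p(2) Ide_rho2[OF p(1)] triad.Ide_rho1[OF triad_swap p(1)] rho_class_reflect[symmetric] by simp
  qed
  show "Cmp (rho2 X A B C) (reflect ` S) (reflect ` T) = reflect ` Cmp (rho1 X B A C) S T"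
    if "S \<in> Arr (rho1 X B A C)" "T \<in> Arr (rho1 X B A C)" "Tgt (rho1 X B A C) S = Src (rho1 X B A C) T" for S T
    using that by (intro Cmp_rho2_reflect) (simp_all add: rho1_def)
qed (simp_all add: Src_rho2_reflect Tgt_rho2_reflect, simp add: rho1_def rho2_def)

section \<open>The double groupoid\<close>

lemma edges_of_glue:
  "edge1 e (glue2 f g) = edge1 e f +++ edge1 e g" "edge2 e (glue1 f g) = edge2 e f +++ edge2 e g"
  by (simp_all add: edge1_def edge2_def glue1_def glue2_def joinpaths_def)

text \<open>
  Interchange is an equality of functions once the four squares match along all four common edges.
  The last square \<open>d1\<close> has to be matched twice, and its second adjustment prepends a connector that is
  constant along its top edge; the top edge of the result differs from the bottom edge of \<open>b1\<close> by
  a constant path.  Prepending a degenerate square to \<open>b1\<close> introduces the same constant path.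
\<close>

lemma interchange:
  assumes x: "x \<in> rho X A B C" and y: "y \<in> rho X A B C" and z: "z \<in> rho X A B C" and w: "w \<in> rho X A B C"
    and xy: "Tgt (rho2 X A B C) x = Src (rho2 X A B C) y" and zw: "Tgt (rho2 X A B C) z = Src (rho2 X A B C) w"
    and xz: "Tgt (rho1 X A B C) x = Src (rho1 X A B C) z" and yw: "Tgt (rho1 X A B C) y = Src (rho1 X A B C) w"
  shows "Cmp (rho1 X A B C) (Cmp (rho2 X A B C) x y) (Cmp (rho2 X A B C) z w)
    = Cmp (rho2 X A B C) (Cmp (rho1 X A B C) x z) (Cmp (rho1 X A B C) y w)"
proof -
  let ?cls = "rho_class X A B C"
  obtain a b0 c0 d0 where a: "a \<in> R" "x = ?cls a" and b0: "b0 \<in> R" "y = ?cls b0"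
    and c0: "c0 \<in> R" "z = ?cls c0" and d0: "d0 \<in> R" "w = ?cls d0"
    using x y z w by (auto simp: rho_def)
  obtain b1 where b1: "b1 \<in> R" "y = ?cls b1" and ab1: "\<And>s. s \<in> {0..1} \<Longrightarrow> a (s, 1) = b1 (s, 0)"
    using rho_match2[OF a(1) b0(1)] xy a(2) b0(2) by metis
  obtain c where c: "c \<in> R" "z = ?cls c" and ac: "\<And>s. s \<in> {0..1} \<Longrightarrow> a (1, s) = c (0, s)"
    using rho_match1[OF a(1) c0(1)] xz a(2) c0(2) by metis
  obtain d1 where d1: "d1 \<in> R" "w = ?cls d1" and bd1: "\<And>s. s \<in> {0..1} \<Longrightarrow> b1 (1, s) = d1 (0, s)"
    using rho_match1[OF b1(1) d0(1)] yw b1(2) d0(2) by metis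
  obtain k where k: "k \<in> connectors2 A (edge2 1 c) (edge2 0 d1)" and d: "glue2 k d1 \<in> R" "?cls (glue2 k d1) = w"
    and cd: "\<And>s. s \<in> {0..1} \<Longrightarrow> c (s, 1) = glue2 k d1 (s, 0)"
    using rho_match2[OF c(1) d1(1)] zw c(2) d1(2) by metis
  define b where "b = glue2 (degenerate2 (edge2 0 b1)) b1"
  have "b \<simeq> b1" unfolding b_def by (rule glue2_left_unit[OF b1(1)]) (simp add: edge2_def)
  then have b: "b \<in> R" "y = ?cls b" using rho_homotopic_memD(1) rho_class_eqI b1(2) by metis+
  have ab: "a (s, 1) = b (s, 0)" if "s \<in> {0..1}" for s
    using ab1[OF that] by (simp add: b_def glue2_def degenerate2_def edge2_def)
  have bd: "b (1, s) = glue2 k d1 (0, s)" if "s \<in> {0..1}" for s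
  proof (cases "s \<le> 1/2")
    case True
    have "k (0, 2 * s) = c (0, 1)"
      using connectors1D(5)[OF k[unfolded connectors2_iff_reflect], of "2 * s"] that True
      by (simp add: edge2_def)
    also have "\<dots> = b1 (1, 0)" using ac[of 1] ab1[of 1] by simp
    finally show ?thesis using True by (simp add: b_def glue2_def degenerate2_def edge2_def)
  next
    case False
    then show ?thesis using bd1[of "2 * s - 1"] that by (simp add: b_def glue2_def)
  qed
  let ?d = "glue2 k d1"
  have R: "glue1 a c \<in> R" "glue1 b ?d \<in> R"
    by (rule glue1_in_R_squares[OF a(1) c(1) ac] glue1_in_R_squares[OF b(1) d(1) bd], assumption)+
  have "Cmp (rho2 X A B C) x y = ?cls (glue2 a b)" unfolding a b by (rule Cmp_rho2[OF a(1) b(1) ab])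
  moreover have "Cmp (rho2 X A B C) z w = ?cls (glue2 c ?d)"
    unfolding c d(2)[symmetric] by (rule Cmp_rho2[OF c(1) d(1) cd])
  moreover have "Cmp (rho1 X A B C) (?cls (glue2 a b)) (?cls (glue2 c ?d)) = ?cls (glue1 (glue2 a b) (glue2 c ?d))"
    by (rule Cmp_rho1[OF glue2_in_R_squares[OF a(1) b(1) ab] glue2_in_R_squares[OF c(1) d(1) cd]])
      (use ac bd in \<open>auto simp: glue2_def[of a] glue2_def[of c]\<close>)
  moreover have "glue1 (glue2 a b) (glue2 c ?d) = glue2 (glue1 a c) (glue1 b ?d)"
    unfolding glue1_def glue2_def by (auto simp: fun_eq_iff)
  moreover have "Cmp (rho1 X A B C) x z = ?cls (glue1 a c)" unfolding a c by (rule Cmp_rho1[OF a(1) c(1) ac])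
  moreover have "Cmp (rho1 X A B C) y w = ?cls (glue1 b ?d)"
    unfolding b d(2)[symmetric] by (rule Cmp_rho1[OF b(1) d(1) bd])
  moreover have "Cmp (rho2 X A B C) (?cls (glue1 a c)) (?cls (glue1 b ?d)) = ?cls (glue2 (glue1 a c) (glue1 b ?d))"
    by (rule Cmp_rho2[OF R]) (use ab cd in \<open>auto simp: glue1_def\<close>)
  ultimately show ?thesis by simp
qed

theorem double_groupoid_rho:
  "double_groupoid (fundamental_groupoid A C) (fundamental_groupoid B C) (rho1 X A B C) (rho2 X A B C)"
proof -
  let ?V = "fundamental_groupoid A C" and ?H = "fundamental_groupoid B C"
  let ?D1 = "rho1 X A B C" and ?D2 = "rho2 X A B C" and ?cls = "rho_class X A B C"
  note [simp] = Src_rho1 Tgt_rho1 Src_rho2 Tgt_rho2 Ide_rho1 Ide_rho2 Src_path_class Tgt_path_class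
    Cmp_path_class edge1_in_paths_on edge2_in_paths_on degenerate1_in_R degenerate2_in_R
  have Arr: "Arr ?D1 = ?cls ` R" "Arr ?D2 = ?cls ` R" by (simp_all add: rho1_def rho2_def rho_def)
  have Obj: "Obj ?D1 = Arr ?H" "Obj ?D2 = Arr ?V" "Obj ?V = Obj ?H"
    by (simp_all add: rho1_def rho2_def fundamental_groupoid_simps)
  have constA: "(\<lambda>_. c) \<in> paths_on A C" and constB: "(\<lambda>_. c) \<in> paths_on B C" if "c \<in> C" for c
    using const_in_paths_on that C_sub_A C_sub_B by blast+
  have deg: "edge1 e (degenerate2 p) = (\<lambda>_. p e)" "edge2 e (degenerate1 p) = (\<lambda>_. p e)" for e and p :: "real \<Rightarrow> 'a"
    by (simp_all add: edge1_def edge2_def degenerate1_def degenerate2_def)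
  show ?thesis
    unfolding double_groupoid_def
  proof (intro conjI ballI impI)
    show "groupoid ?V" "groupoid ?H" using groupoid_fundamental_groupoid C_sub_A C_sub_B by blast+
    show "groupoid ?D1" "groupoid ?D2" by (fact groupoid_rho1 groupoid_rho2)+
    show "Obj ?V = Obj ?H" "Obj ?D1 = Arr ?H" "Obj ?D2 = Arr ?V" "Arr ?D1 = Arr ?D2"
      using Obj Arr by simp_all
  next
    fix x assume "x \<in> Arr ?D1"
    then obtain f where f: "f \<in> R" "x = ?cls f" by (auto simp: Arr)
    show "Src ?V (Src ?D2 x) = Src ?H (Src ?D1 x)" "Tgt ?V (Src ?D2 x) = Src ?H (Tgt ?D1 x)"
      "Src ?V (Tgt ?D2 x) = Tgt ?H (Src ?D1 x)" "Tgt ?V (Tgt ?D2 x) = Tgt ?H (Tgt ?D1 x)"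
      using f by (simp_all, simp_all add: edge1_def edge2_def)
  next
    fix x y assume x: "x \<in> Arr ?D1" and y: "y \<in> Arr ?D1" and xy: "Tgt ?D2 x = Src ?D2 y"
    obtain f where f: "f \<in> R" "x = ?cls f" using x by (auto simp: Arr)
    obtain g0 where g0: "g0 \<in> R" "y = ?cls g0" using y by (auto simp: Arr)
    obtain g where g: "g \<in> R" "y = ?cls g" and fg: "\<And>s. s \<in> {0..1} \<Longrightarrow> f (s, 1) = g (s, 0)"
      using rho_match2[OF f(1) g0(1)] xy f(2) g0(2) by metis
    have "Cmp ?D2 x y = ?cls (glue2 f g)" unfolding f g by (rule Cmp_rho2[OF f(1) g(1) fg])
    moreover have "edge1 e f 1 = edge1 e g 0" if "e \<in> {0, 1}" for e using fg[of e] that by (auto simp: edge1_def)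
    ultimately show "Src ?D1 (Cmp ?D2 x y) = Cmp ?H (Src ?D1 x) (Src ?D1 y)"
      "Tgt ?D1 (Cmp ?D2 x y) = Cmp ?H (Tgt ?D1 x) (Tgt ?D1 y)"
      using f g glue2_in_R_squares[OF f(1) g(1) fg] by (simp_all add: edges_of_glue)
  next
    fix x y assume x: "x \<in> Arr ?D1" and y: "y \<in> Arr ?D1" and xy: "Tgt ?D1 x = Src ?D1 y"
    obtain f where f: "f \<in> R" "x = ?cls f" using x by (auto simp: Arr)
    obtain g0 where g0: "g0 \<in> R" "y = ?cls g0" using y by (auto simp: Arr)
    obtain g where g: "g \<in> R" "y = ?cls g" and fg: "\<And>s. s \<in> {0..1} \<Longrightarrow> f (1, s) = g (0, s)"
      using rho_match1[OF f(1) g0(1)] xy f(2) g0(2) by metis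
    have "Cmp ?D1 x y = ?cls (glue1 f g)" unfolding f g by (rule Cmp_rho1[OF f(1) g(1) fg])
    moreover have "edge2 e f 1 = edge2 e g 0" if "e \<in> {0, 1}" for e using fg[of e] that by (auto simp: edge2_def)
    ultimately show "Src ?D2 (Cmp ?D1 x y) = Cmp ?V (Src ?D2 x) (Src ?D2 y)"
      "Tgt ?D2 (Cmp ?D1 x y) = Cmp ?V (Tgt ?D2 x) (Tgt ?D2 y)"
      using f g glue1_in_R_squares[OF f(1) g(1) fg] by (simp_all add: edges_of_glue)
  next
    fix v assume "v \<in> Arr ?V"
    then obtain p where p: "p \<in> paths_on A C" "v = path_class A p" by (auto simp: fundamental_groupoid_simps)
    then show "Src ?D1 (Ide ?D2 v) = Ide ?H (Src ?V v)" "Tgt ?D1 (Ide ?D2 v) = Ide ?H (Tgt ?V v)"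
      by (simp_all add: deg fundamental_groupoid_simps)
    fix w assume "w \<in> Arr ?V" and "Tgt ?V v = Src ?V w"
    then obtain q where q: "q \<in> paths_on A C" "w = path_class A q" "p 1 = q 0"
      using p by (auto simp: fundamental_groupoid_simps)
    have "Cmp ?D1 (?cls (degenerate2 p)) (?cls (degenerate2 q)) = ?cls (glue1 (degenerate2 p) (degenerate2 q))"
      by (rule Cmp_rho1) (use p q in \<open>simp_all, simp add: degenerate2_def\<close>)
    moreover have "glue1 (degenerate2 p) (degenerate2 q) = degenerate2 (p +++ q)"
      by (auto simp: glue1_def degenerate2_def joinpaths_def)
    ultimately show "Ide ?D2 (Cmp ?V v w) = Cmp ?D1 (Ide ?D2 v) (Ide ?D2 w)"
      using p q join_in_paths_on[OF p(1) q(1,3)] by simp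
  next
    fix v assume "v \<in> Arr ?H"
    then obtain p where p: "p \<in> paths_on B C" "v = path_class B p" by (auto simp: fundamental_groupoid_simps)
    then show "Src ?D2 (Ide ?D1 v) = Ide ?V (Src ?H v)" "Tgt ?D2 (Ide ?D1 v) = Ide ?V (Tgt ?H v)"
      by (simp_all add: deg fundamental_groupoid_simps)
    fix w assume "w \<in> Arr ?H" and "Tgt ?H v = Src ?H w"
    then obtain q where q: "q \<in> paths_on B C" "w = path_class B q" "p 1 = q 0"
      using p by (auto simp: fundamental_groupoid_simps)
    have "Cmp ?D2 (?cls (degenerate1 p)) (?cls (degenerate1 q)) = ?cls (glue2 (degenerate1 p) (degenerate1 q))"
      by (rule Cmp_rho2) (use p q in \<open>simp_all, simp add: degenerate1_def\<close>)
    moreover have "glue2 (degenerate1 p) (degenerate1 q) = degenerate1 (p +++ q)"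
      by (auto simp: glue2_def degenerate1_def joinpaths_def)
    ultimately show "Ide ?D1 (Cmp ?H v w) = Cmp ?D2 (Ide ?D1 v) (Ide ?D1 w)"
      using p q join_in_paths_on[OF p(1) q(1,3)] by simp
  next
    fix c assume "c \<in> Obj ?V"
    then show "Ide ?D2 (Ide ?V c) = Ide ?D1 (Ide ?H c)"
      using constA constB by (simp add: fundamental_groupoid_simps degenerate1_def degenerate2_def)
  next
    fix x y z w assume "x \<in> Arr ?D1" "y \<in> Arr ?D1" "z \<in> Arr ?D1" "w \<in> Arr ?D1"
      "Tgt ?D2 x = Src ?D2 y" "Tgt ?D2 z = Src ?D2 w" "Tgt ?D1 x = Src ?D1 z" "Tgt ?D1 y = Src ?D1 w"
    then show "Cmp ?D1 (Cmp ?D2 x y) (Cmp ?D2 z w) = Cmp ?D2 (Cmp ?D1 x z) (Cmp ?D1 y w)"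
      by (intro interchange) (simp_all add: Arr rho_def)
  qed
qed

end

section \<open>Homotopy classes of relative maps\<close>

lemma rel_maps2_iff:
  "f \<in> rel_maps2 X A c \<longleftrightarrow> continuous_on unit_square f \<and> (\<forall>a\<in>{0..1}. \<forall>b\<in>{0..1}. f (a, b) \<in> X) \<and>
    (\<forall>s\<in>{0..1}. f (s, 0) \<in> A \<and> f (s, 1) = c \<and> f (0, s) = c \<and> f (1, s) = c)"
  by (auto simp: rel_maps2_def square_maps_iff edge1_def edge2_def)

lemma rel_maps2D:
  assumes "f \<in> rel_maps2 X A c"
  shows "continuous_on unit_square f" "\<And>a b. a \<in> {0..1} \<Longrightarrow> b \<in> {0..1} \<Longrightarrow> f (a, b) \<in> X"
    "\<And>s. s \<in> {0..1} \<Longrightarrow> f (s, 0) \<in> A"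
    "\<And>s. s \<in> {0..1} \<Longrightarrow> f (s, 1) = c \<and> f (0, s) = c \<and> f (1, s) = c"
  using assms unfolding rel_maps2_iff by blast+

lemma rel_class2_iff:
  "g \<in> rel_class2 X A c f \<longleftrightarrow>
    (\<exists>H. continuous_cube H \<and> (\<forall>t\<in>{0..1}. (\<lambda>(s1, s2). H t s1 s2) \<in> rel_maps2 X A c) \<and>
      (\<forall>s1\<in>{0..1}. \<forall>s2\<in>{0..1}. H 0 s1 s2 = f (s1, s2) \<and> H 1 s1 s2 = g (s1, s2)))"
  unfolding rel_class2_def
proof (rule square_class_iff)
  show "g \<in> rel_maps2 X A c" if "f \<in> rel_maps2 X A c" "\<And>z. z \<in> unit_square \<Longrightarrow> f z = g z" for f g
    using that square_maps_cong[of f X g] by (simp add: rel_maps2_def edge1_def edge2_def)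
qed (auto simp: rel_maps2_def)

lemma rel_class2I:
  assumes "continuous_cube H"
    and "\<And>t a b. t \<in> {0..1} \<Longrightarrow> a \<in> {0..1} \<Longrightarrow> b \<in> {0..1} \<Longrightarrow> H t a b \<in> X"
    and "\<And>t s. t \<in> {0..1} \<Longrightarrow> s \<in> {0..1} \<Longrightarrow> H t s 0 \<in> A"
    and "\<And>t s. t \<in> {0..1} \<Longrightarrow> s \<in> {0..1} \<Longrightarrow> H t s 1 = c \<and> H t 0 s = c \<and> H t 1 s = c"
    and "\<And>a b. a \<in> {0..1} \<Longrightarrow> b \<in> {0..1} \<Longrightarrow> H 0 a b = f (a, b)"
    and "\<And>a b. a \<in> {0..1} \<Longrightarrow> b \<in> {0..1} \<Longrightarrow> H 1 a b = g (a, b)"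
  shows "g \<in> rel_class2 X A c f"
  unfolding rel_class2_iff
proof (intro exI[of _ H] conjI ballI)
  show "(\<lambda>(s1, s2). H t s1 s2) \<in> rel_maps2 X A c" if "t \<in> {0..1}" for t
    using continuous_cube_slice[OF assms(1) that] assms(2-4) that by (simp add: rel_maps2_iff)
qed (use assms(1,5,6) in auto)

lemma rel_class2_refl: "f \<in> rel_maps2 X A c \<Longrightarrow> f \<in> rel_class2 X A c f"
  unfolding rel_class2_def by (rule square_class_refl) (auto simp: rel_maps2_def)

lemma rel_class2_sym: "g \<in> rel_class2 X A c f \<Longrightarrow> f \<in> rel_class2 X A c g"
  unfolding rel_class2_def by (rule square_class_sym)

lemma rel_class2_trans: "g \<in> rel_class2 X A c f \<Longrightarrow> h \<in> rel_class2 X A c g \<Longrightarrow> h \<in> rel_class2 X A c f"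
  unfolding rel_class2_def by (rule square_class_trans)

lemma rel_class2_eq: "g \<in> rel_class2 X A c f \<Longrightarrow> rel_class2 X A c g = rel_class2 X A c f"
  unfolding rel_class2_def by (rule square_class_eq)

lemma rel_class2_memD: "g \<in> rel_class2 X A c f \<Longrightarrow> f \<in> rel_maps2 X A c \<and> g \<in> rel_maps2 X A c"
  unfolding rel_class2_def by (rule square_class_memD)

text \<open>
  A relative map is constant on the top, right and bottom edges.  Deforming its argument is
  therefore a homotopy through relative maps as soon as these edges move within their union and
  the left edge moves within the boundary of the square.
\<close>

lemma rel_class2_push:
  assumes f: "f \<in> rel_maps2 X A c" and c: "c \<in> A"
    and cont: "continuous_cube \<phi>" "continuous_cube \<psi>"
    and range: "\<And>t a b. t \<in> {0..1} \<Longrightarrow> a \<in> {0..1} \<Longrightarrow> b \<in> {0..1} \<Longrightarrow> \<phi> t a b \<in> {0..1} \<and> \<psi> t a b \<in> {0..1}"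
    and start: "\<And>a b. a \<in> {0..1} \<Longrightarrow> b \<in> {0..1} \<Longrightarrow> \<phi> 0 a b = a \<and> \<psi> 0 a b = b"
    and left: "\<And>t s. t \<in> {0..1} \<Longrightarrow> s \<in> {0..1} \<Longrightarrow> \<phi> t s 0 \<in> {0, 1} \<or> \<psi> t s 0 \<in> {0, 1}"
    and right: "\<And>t s. t \<in> {0..1} \<Longrightarrow> s \<in> {0..1} \<Longrightarrow> \<phi> t s 1 \<in> {0, 1} \<or> \<psi> t s 1 = 1"
    and top: "\<And>t s. t \<in> {0..1} \<Longrightarrow> s \<in> {0..1} \<Longrightarrow> \<phi> t 0 s \<in> {0, 1} \<or> \<psi> t 0 s = 1"
    and bottom: "\<And>t s. t \<in> {0..1} \<Longrightarrow> s \<in> {0..1} \<Longrightarrow> \<phi> t 1 s \<in> {0, 1} \<or> \<psi> t 1 s = 1"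
  shows "(\<lambda>(a, b). f (\<phi> 1 a b, \<psi> 1 a b)) \<in> rel_class2 X A c f"
proof (rule rel_class2I[of "\<lambda>t a b. f (\<phi> t a b, \<psi> t a b)"])
  note f' = rel_maps2D[OF f]
  have const: "f (x, y) = c" if "x \<in> {0..1}" "y \<in> {0..1}" "x \<in> {0, 1} \<or> y = 1" for x y
    using f'(4)[OF that(1)] f'(4)[OF that(2)] that(3) by auto
  show "continuous_cube (\<lambda>t a b. f (\<phi> t a b, \<psi> t a b))"
  proof -
    have "continuous_on ({0..1} \<times> unit_square) (\<lambda>x. \<phi> (fst x) (fst (snd x)) (snd (snd x)))"
      "continuous_on ({0..1} \<times> unit_square) (\<lambda>x. \<psi> (fst x) (fst (snd x)) (snd (snd x)))"
      by (intro continuous_on_cube_compose[OF cont(1)] continuous_on_cube_compose[OF cont(2)]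
          continuous_intros, auto)+
    then show ?thesis
      by (intro continuous_cubeI continuous_on_square_compose[OF f'(1)]) (use range in auto)
  qed
  fix t s :: real assume t: "t \<in> {0..1}" and s: "s \<in> {0..1}"
  note r = range[OF t s, of 0] range[OF t s, of 1] range[OF t _ s, of 0] range[OF t _ s, of 1]
  show "f (\<phi> t s 0, \<psi> t s 0) \<in> A"
    using left[OF t s] r(1) const[of "\<phi> t s 0" "\<psi> t s 0"] f'(3)[of "\<phi> t s 0"] c by auto
  show "f (\<phi> t s 1, \<psi> t s 1) = c \<and> f (\<phi> t 0 s, \<psi> t 0 s) = c \<and> f (\<phi> t 1 s, \<psi> t 1 s) = c"
    using right[OF t s] top[OF t s] bottom[OF t s] r const by simp
qed (use rel_maps2D(2)[OF f] range start in auto)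

text \<open>
  The right edge shrinks to its lower end, and the top edge grows around the corner to cover it.
\<close>

lemma rel_class2_push_right:
  assumes f: "f \<in> rel_maps2 X A c" and c: "c \<in> A"
  shows "(\<lambda>(a, b). f (max a (2 * b - 1), min 1 (2 * b))) \<in> rel_class2 X A c f"
proof -
  have le: "(1 + t) * b - 1 \<le> 1" "0 \<le> (1 + t) * b" if "t \<in> {0..1}" "b \<in> {0..1}" for t b :: real
    using mult_mono[of "1 + t" 2 b 1] that by auto
  have "(\<lambda>(a, b). f (max a ((1 + 1) * b - 1), min 1 ((1 + 1) * b))) \<in> rel_class2 X A c f"
    by (rule rel_class2_push[OF f c, of "\<lambda>t a b. max a ((1 + t) * b - 1)" "\<lambda>t a b. min 1 ((1 + t) * b)"];
        (intro continuous_cubeI continuous_intros)?)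
      (auto simp: le max_def min_def)
  then show ?thesis by simp
qed

text \<open>
  The top edge shrinks to its right end, and the left edge grows around the corner to cover it.
\<close>

lemma rel_class2_push_top:
  assumes f: "f \<in> rel_maps2 X A c" and c: "c \<in> A"
  shows "(\<lambda>(a, b). f (max 0 (2 * a - 1), max b (1 - 2 * a))) \<in> rel_class2 X A c f"
proof -
  have le: "(1 + t) * a - t \<le> 1" "t - (1 + t) * a \<le> 1" if "t \<in> {0..1}" "a \<in> {0..1}" for t a :: real
  proof -
    have "(1 + t) * a \<le> (1 + t) * 1" "0 \<le> (1 + t) * a" "t \<le> 1"
      using that by (auto intro!: mult_left_mono mult_nonneg_nonneg)
    then show "(1 + t) * a - t \<le> 1" and "t - (1 + t) * a \<le> 1" by simp_all
  qed
  have "(\<lambda>(a, b). f (max 0 ((1 + 1) * a - 1), max b (1 - (1 + 1) * a))) \<in> rel_class2 X A c f"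
    by (rule rel_class2_push[OF f c, of "\<lambda>t a b. max 0 ((1 + t) * a - t)" "\<lambda>t a b. max b (t - (1 + t) * a)"];
        (intro continuous_cubeI continuous_intros)?)
      (auto simp: le max_def)
  then show ?thesis by simp
qed

text \<open>
  The bottom edge shrinks to its right end, and the left edge grows around the corner to cover it.
\<close>

lemma rel_class2_push_bottom:
  assumes f: "f \<in> rel_maps2 X A c" and c: "c \<in> A"
  shows "(\<lambda>(a, b). f (min 1 (2 * a), max b (2 * a - 1))) \<in> rel_class2 X A c f"
proof -
  have le: "(1 + t) * a - 1 \<le> 1" "0 \<le> (1 + t) * a" if "t \<in> {0..1}" "a \<in> {0..1}" for t a :: real
    using mult_mono[of "1 + t" 2 a 1] that by auto
  have "(\<lambda>(a, b). f (min 1 ((1 + 1) * a), max b ((1 + 1) * a - 1))) \<in> rel_class2 X A c f"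
    by (rule rel_class2_push[OF f c, of "\<lambda>t a b. min 1 ((1 + t) * a)" "\<lambda>t a b. max b ((1 + t) * a - 1)"];
        (intro continuous_cubeI continuous_intros)?)
      (auto simp: le max_def min_def)
  then show ?thesis by simp
qed

text \<open>
  A homotopy of pairs with fixed corners deforms into one through relative maps: pushing the
  right edge into the top, then the top and the bottom into the left edge leaves all but the left
  edge at a corner, at all times.  The two ends are pushed as well, but within their classes.
\<close>

lemma rel_class2_compression:
  assumes f: "f \<in> rel_maps2 X A c" and g: "g \<in> rel_maps2 X A c" and c: "c \<in> A"
    and cH: "continuous_cube H"
    and HX: "\<And>t a b. t \<in> {0..1} \<Longrightarrow> a \<in> {0..1} \<Longrightarrow> b \<in> {0..1} \<Longrightarrow> H t a b \<in> X"
    and HA: "\<And>t s. t \<in> {0..1} \<Longrightarrow> s \<in> {0..1} \<Longrightarrow> H t 0 s \<in> A \<and> H t 1 s \<in> A \<and> H t s 0 \<in> A \<and> H t s 1 \<in> A"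
    and Hc: "\<And>t. t \<in> {0..1} \<Longrightarrow> H t 0 0 = c \<and> H t 0 1 = c \<and> H t 1 0 = c \<and> H t 1 1 = c"
    and ends: "\<And>a b. a \<in> {0..1} \<Longrightarrow> b \<in> {0..1} \<Longrightarrow> H 0 a b = f (a, b) \<and> H 1 a b = g (a, b)"
  shows "g \<in> rel_class2 X A c f"
proof -
  define K1 where "K1 = (\<lambda>t a b. H t (max a (2 * b - 1)) (min 1 (2 * b)))"
  define K2 where "K2 = (\<lambda>t a b. K1 t (max 0 (2 * a - 1)) (max b (1 - 2 * a)))"
  define K3 where "K3 = (\<lambda>t a b. K2 t (min 1 (2 * a)) (max b (2 * a - 1)))"
  have cK1: "continuous_cube K1"
    unfolding K1_def by (intro continuous_cubeI continuous_on_cube_compose[OF cH] continuous_intros) auto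
  have cK2: "continuous_cube K2"
    unfolding K2_def by (intro continuous_cubeI continuous_on_cube_compose[OF cK1] continuous_intros) auto
  have cK3: "continuous_cube K3"
    unfolding K3_def by (intro continuous_cubeI continuous_on_cube_compose[OF cK2] continuous_intros) auto
  have K1X: "K1 t a b \<in> X" if "t \<in> {0..1}" "a \<in> {0..1}" "b \<in> {0..1}" for t a b
    unfolding K1_def by (rule HX) (use that in auto)
  have K2X: "K2 t a b \<in> X" if "t \<in> {0..1}" "a \<in> {0..1}" "b \<in> {0..1}" for t a b
    unfolding K2_def by (rule K1X) (use that in auto)
  have K3X: "K3 t a b \<in> X" if "t \<in> {0..1}" "a \<in> {0..1}" "b \<in> {0..1}" for t a b
    unfolding K3_def by (rule K2X) (use that in auto)
  have K1A: "K1 t 0 s \<in> A" "K1 t 1 s \<in> A" "K1 t s 0 \<in> A" "K1 t s 1 = c"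
    if t: "t \<in> {0..1}" and s: "s \<in> {0..1}" for t s
  proof -
    show "K1 t 0 s \<in> A"
      using HA[OF t, of "2 * s"] HA[OF t, of "2 * s - 1"] s by (cases "s \<le> 1/2") (auto simp: K1_def)
    have "max 1 (2 * s - 1) = 1" "min 1 (2 * s) \<in> {0..1}" using s by auto
    then show "K1 t 1 s \<in> A" using HA[OF t] by (simp add: K1_def)
    show "K1 t s 0 \<in> A" using HA[OF t s] s by (simp add: K1_def)
    show "K1 t s 1 = c" using Hc[OF t] s by (simp add: K1_def)
  qed
  have K2A: "K2 t 0 s = c" "K2 t 1 s \<in> A" "K2 t s 0 \<in> A" "K2 t s 1 = c"
    if t: "t \<in> {0..1}" and s: "s \<in> {0..1}" for t s
  proof -
    show "K2 t 0 s = c" using K1A(4)[OF t, of 0] s by (simp add: K2_def)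
    show "K2 t 1 s \<in> A" using K1A(2)[OF t s] s by (simp add: K2_def)
    show "K2 t s 0 \<in> A"
      using K1A(1)[OF t, of "1 - 2 * s"] K1A(3)[OF t, of "2 * s - 1"] s by (cases "s \<le> 1/2") (auto simp: K2_def)
    have "max 1 (1 - 2 * s) = 1" "max 0 (2 * s - 1) \<in> {0..1}" using s by auto
    then show "K2 t s 1 = c" using K1A(4)[OF t] by (simp add: K2_def)
  qed
  have "(\<lambda>(a, b). K3 1 a b) \<in> rel_class2 X A c (\<lambda>(a, b). K3 0 a b)"
  proof (rule rel_class2I[OF cK3 K3X])
    fix t s :: real assume t: "t \<in> {0..1}" and s: "s \<in> {0..1}"
    show "K3 t s 0 \<in> A"
      using K2A(3)[OF t, of "2 * s"] K2A(2)[OF t, of "2 * s - 1"] s by (cases "s \<le> 1/2") (auto simp: K3_def)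
    have "max 1 (2 * s - 1) = 1" "min 1 (2 * s) \<in> {0..1}" using s by auto
    then show "K3 t s 1 = c \<and> K3 t 0 s = c \<and> K3 t 1 s = c"
      using K2A(4)[OF t] K2A(1)[OF t s] s by (simp add: K3_def)
  qed auto
  moreover have "(\<lambda>(a, b). K3 e a b) \<in> rel_class2 X A c h"
    if h: "h \<in> rel_maps2 X A c" and He: "\<And>a b. a \<in> {0..1} \<Longrightarrow> b \<in> {0..1} \<Longrightarrow> H e a b = h (a, b)"
      and e: "e \<in> {0, 1}" for e h
  proof -
    define h1 where "h1 = (\<lambda>(a, b). h (max a (2 * b - 1), min 1 (2 * b)))"
    define h2 where "h2 = (\<lambda>(a, b). h1 (max 0 (2 * a - 1), max b (1 - 2 * a)))"
    define h3 where "h3 = (\<lambda>(a, b). h2 (min 1 (2 * a), max b (2 * a - 1)))"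
    have 1: "h1 \<in> rel_class2 X A c h" unfolding h1_def by (rule rel_class2_push_right[OF h c])
    have 2: "h2 \<in> rel_class2 X A c h1"
      unfolding h2_def using rel_class2_push_top[OF _ c] rel_class2_memD[OF 1] by blast
    have 3: "h3 \<in> rel_class2 X A c h2"
      unfolding h3_def using rel_class2_push_bottom[OF _ c] rel_class2_memD[OF 2] by blast
    have h3: "h3 \<in> rel_class2 X A c h" using rel_class2_trans[OF rel_class2_trans[OF 1 2] 3] .
    have eq1: "K1 e a b = h1 (a, b)" if "a \<in> {0..1}" "b \<in> {0..1}" for a b
      unfolding K1_def h1_def prod.case by (rule He) (use that in auto)
    have eq2: "K2 e a b = h2 (a, b)" if "a \<in> {0..1}" "b \<in> {0..1}" for a b
      unfolding K2_def h2_def prod.case by (rule eq1) (use that in auto)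
    have eq3: "K3 e a b = h3 (a, b)" if "a \<in> {0..1}" "b \<in> {0..1}" for a b
      unfolding K3_def h3_def prod.case by (rule eq2) (use that in auto)
    obtain F where F: "continuous_cube F" "\<forall>t\<in>{0..1}. (\<lambda>(s1, s2). F t s1 s2) \<in> rel_maps2 X A c"
      "\<forall>s1\<in>{0..1}. \<forall>s2\<in>{0..1}. F 0 s1 s2 = h (s1, s2) \<and> F 1 s1 s2 = h3 (s1, s2)"
      using h3 unfolding rel_class2_iff by blast
    show ?thesis
      unfolding rel_class2_iff by (intro exI[of _ F] conjI F(1,2)) (use F(3) eq3 in simp)
  qed
  from this[OF f, of 0] this[OF g, of 1] ends
  have "(\<lambda>(a, b). K3 0 a b) \<in> rel_class2 X A c f" "(\<lambda>(a, b). K3 1 a b) \<in> rel_class2 X A c g" by simp_all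
  ultimately show ?thesis using rel_class2_trans rel_class2_sym by metis
qed

lemma rel_glue1:
  assumes f: "f' \<in> rel_class2 X A c f" and g: "g' \<in> rel_class2 X A c g"
  shows "glue1 f' g' \<in> rel_class2 X A c (glue1 f g)"
proof -
  obtain H where H: "continuous_cube H" "\<And>t. t \<in> {0..1} \<Longrightarrow> (\<lambda>(s1, s2). H t s1 s2) \<in> rel_maps2 X A c"
    "\<And>a b. a \<in> {0..1} \<Longrightarrow> b \<in> {0..1} \<Longrightarrow> H 0 a b = f (a, b) \<and> H 1 a b = f' (a, b)"
    using f unfolding rel_class2_iff by blast
  obtain K where K: "continuous_cube K" "\<And>t. t \<in> {0..1} \<Longrightarrow> (\<lambda>(s1, s2). K t s1 s2) \<in> rel_maps2 X A c"
    "\<And>a b. a \<in> {0..1} \<Longrightarrow> b \<in> {0..1} \<Longrightarrow> K 0 a b = g (a, b) \<and> K 1 a b = g' (a, b)"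
    using g unfolding rel_class2_iff by blast
  have h: "\<And>a b. a \<in> {0..1} \<Longrightarrow> b \<in> {0..1} \<Longrightarrow> H t a b \<in> X" "\<And>s. s \<in> {0..1} \<Longrightarrow> H t s 0 \<in> A"
    "\<And>s. s \<in> {0..1} \<Longrightarrow> H t s 1 = c \<and> H t 0 s = c \<and> H t 1 s = c"
    and k: "\<And>a b. a \<in> {0..1} \<Longrightarrow> b \<in> {0..1} \<Longrightarrow> K t a b \<in> X" "\<And>s. s \<in> {0..1} \<Longrightarrow> K t s 0 \<in> A"
    "\<And>s. s \<in> {0..1} \<Longrightarrow> K t s 1 = c \<and> K t 0 s = c \<and> K t 1 s = c" if "t \<in> {0..1}" for t
    using rel_maps2D(2-4)[OF H(2)[OF that]] rel_maps2D(2-4)[OF K(2)[OF that]] by simp_all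
  have half: "H t (2 * a) s = K t (2 * a - 1) s" if "t \<in> {0..1}" "s \<in> {0..1}" "a * 2 = 1" for t a s
    using h(3)[OF that(1,2)] k(3)[OF that(1,2)] that(3) by (simp add: mult.commute)
  show ?thesis
  proof (rule rel_class2I[of "\<lambda>t s1 s2. if s1 \<le> 1/2 then H t (2 * s1) s2 else K t (2 * s1 - 1) s2"])
    show "continuous_cube (\<lambda>t s1 s2. if s1 \<le> 1/2 then H t (2 * s1) s2 else K t (2 * s1 - 1) s2)"
      by (intro continuous_cubeI continuous_on_if_half continuous_on_cube_compose[OF H(1)]
          continuous_on_cube_compose[OF K(1)] continuous_intros) (auto simp: half)
    show "(if a \<le> 1/2 then H t (2 * a) b else K t (2 * a - 1) b) \<in> X"
      if "t \<in> {0..1}" "a \<in> {0..1}" "b \<in> {0..1}" for t a b using that h(1) k(1) by auto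
    show "(if s \<le> 1/2 then H t (2 * s) 0 else K t (2 * s - 1) 0) \<in> A"
      if "t \<in> {0..1}" "s \<in> {0..1}" for t s using that h(2) k(2) by auto
    show "(if s \<le> 1/2 then H t (2 * s) 1 else K t (2 * s - 1) 1) = c \<and>
        (if (0::real) \<le> 1/2 then H t (2 * 0) s else K t (2 * 0 - 1) s) = c \<and>
        (if (1::real) \<le> 1/2 then H t (2 * 1) s else K t (2 * 1 - 1) s) = c"
      if "t \<in> {0..1}" "s \<in> {0..1}" for t s
      using that h(3)[OF that(1), of "2 * s"] h(3)[OF that] k(3)[OF that] k(3)[OF that(1), of "2 * s - 1"] by auto
  qed (use H(3) K(3) in \<open>auto simp: glue1_def\<close>)
qed

lemma glue1_rel_maps2:
  assumes "f \<in> rel_maps2 X A c" "g \<in> rel_maps2 X A c" shows "glue1 f g \<in> rel_maps2 X A c"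
  using rel_class2_memD[OF rel_glue1[OF rel_class2_refl rel_class2_refl]] assms by blast

lemma Cmp_rel_pi2_2:
  assumes f: "f \<in> rel_maps2 X A c" and g: "g \<in> rel_maps2 X A c"
  shows "Cmp (rel_pi2_2 X A C) (c, rel_class2 X A c f) (c, rel_class2 X A c g) = (c, rel_class2 X A c (glue1 f g))"
proof -
  have "{rel_class2 X A c (glue1 f' g') | f' g'. f' \<in> rel_class2 X A c f \<and> g' \<in> rel_class2 X A c g}
      = {rel_class2 X A c (glue1 f g)}"
    using rel_class2_eq[OF rel_glue1] rel_class2_refl[OF f] rel_class2_refl[OF g] by blast
  then show ?thesis by (simp add: rel_pi2_2_def)
qed

section \<open>Reflected relative maps\<close>

lemma square_class_reflect:
  assumes "g \<in> square_class M Y f" "\<And>h. h \<in> M \<Longrightarrow> reflect h \<in> M'"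
  shows "reflect g \<in> square_class M' Y (reflect f)"
proof -
  have refl: "reflect h = h \<circ> prod.swap" for h :: "'a square" by (auto simp: reflect_def fun_eq_iff)
  have "homotopic_with_canon (\<lambda>h. h \<in> M') unit_square Y (f \<circ> prod.swap) (g \<circ> prod.swap)"
  proof (rule homotopic_with_compose_continuous_map_right)
    show "homotopic_with_canon (\<lambda>h. h \<in> M) unit_square Y f g" using assms(1) by (simp add: square_class_def)
    show "continuous_map (top_of_set unit_square) (top_of_set unit_square) prod.swap"
      by (auto intro!: continuous_on_swap)
  qed (use assms(2) refl in metis)
  then show ?thesis by (simp add: square_class_def refl)
qed

lemma rel_maps1_reflect: "reflect f \<in> rel_maps1 X B c \<longleftrightarrow> f \<in> rel_maps2 X B c"
  by (simp add: rel_maps1_def rel_maps2_def conj_ac)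

lemma rel_class1_iff_reflect: "g \<in> rel_class1 X B c f \<longleftrightarrow> reflect g \<in> rel_class2 X B c (reflect f)"
proof
  assume "g \<in> rel_class1 X B c f"
  then show "reflect g \<in> rel_class2 X B c (reflect f)"
    unfolding rel_class1_def rel_class2_def
    by (rule square_class_reflect) (metis rel_maps1_reflect reflect_reflect)
next
  assume "reflect g \<in> rel_class2 X B c (reflect f)"
  then have "reflect (reflect g) \<in> rel_class1 X B c (reflect (reflect f))"
    unfolding rel_class1_def rel_class2_def
    by (rule square_class_reflect) (simp add: rel_maps1_reflect)
  then show "g \<in> rel_class1 X B c f" by simp
qed

lemma rel_maps1_iff_reflect: "f \<in> rel_maps1 X B c \<longleftrightarrow> reflect f \<in> rel_maps2 X B c"
  using rel_maps1_reflect[of "reflect f"] by simp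

lemma rel_class1_refl: "f \<in> rel_maps1 X B c \<Longrightarrow> f \<in> rel_class1 X B c f"
  by (simp add: rel_class1_iff_reflect rel_maps1_iff_reflect rel_class2_refl)

lemma rel_class1_eq: "g \<in> rel_class1 X B c f \<Longrightarrow> rel_class1 X B c g = rel_class1 X B c f"
  unfolding rel_class1_def by (rule square_class_eq)

lemma rel_glue2:
  assumes "f' \<in> rel_class1 X B c f" "g' \<in> rel_class1 X B c g"
  shows "glue2 f' g' \<in> rel_class1 X B c (glue2 f g)"
  using assms rel_glue1 by (simp add: rel_class1_iff_reflect)

lemma glue2_rel_maps1:
  assumes "f \<in> rel_maps1 X B c" "g \<in> rel_maps1 X B c" shows "glue2 f g \<in> rel_maps1 X B c"
  using assms glue1_rel_maps2 by (simp add: rel_maps1_iff_reflect)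

lemma Cmp_rel_pi2_1:
  assumes f: "f \<in> rel_maps1 X B c" and g: "g \<in> rel_maps1 X B c"
  shows "Cmp (rel_pi2_1 X B C) (c, rel_class1 X B c f) (c, rel_class1 X B c g) = (c, rel_class1 X B c (glue2 f g))"
proof -
  have "{rel_class1 X B c (glue2 f' g') | f' g'. f' \<in> rel_class1 X B c f \<and> g' \<in> rel_class1 X B c g}
      = {rel_class1 X B c (glue2 f g)}"
    using rel_class1_eq[OF rel_glue2] rel_class1_refl[OF f] rel_class1_refl[OF g] by blast
  then show ?thesis by (simp add: rel_pi2_1_def)
qed

section \<open>The natural morphisms\<close>

context triad begin

lemma rel_maps2_in_R:
  assumes "f \<in> rel_maps2 X A c" "c \<in> C" shows "f \<in> R"
proof -
  note f = rel_maps2D[OF assms(1)]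
  have "c \<in> A" "c \<in> B" using assms(2) C_sub_A C_sub_B by blast+
  then show ?thesis using f assms(2) by (simp add: R_squares_iff)
qed

lemma rel_class2_homotopic:
  assumes g: "g \<in> rel_class2 X A c f" and c: "c \<in> C" shows "f \<simeq> g"
proof -
  obtain H where H: "continuous_cube H" "\<And>t. t \<in> {0..1} \<Longrightarrow> (\<lambda>(s1, s2). H t s1 s2) \<in> rel_maps2 X A c"
    "\<And>a b. a \<in> {0..1} \<Longrightarrow> b \<in> {0..1} \<Longrightarrow> H 0 a b = f (a, b) \<and> H 1 a b = g (a, b)"
    using g unfolding rel_class2_iff by blast
  have "H t a b = c" if "t \<in> {0..1}" "a \<in> {0, 1}" "b \<in> {0, 1}" for t a b
    using rel_maps2D(4)[OF H(2)[OF that(1)], of a] that(2,3)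
      rel_maps2D(4)[OF H(2)[OF that(1)], of b] by auto
  then have "rho_homotopy X A B C H"
    unfolding rho_homotopy_def using H(1) rel_maps2_in_R[OF H(2) c] by simp
  then show ?thesis by (rule rho_homotopicI) (use H(3) in simp_all)
qed

lemma natural_map_rel2:
  assumes "f \<in> rel_maps2 X A c" "c \<in> C"
  shows "natural_map X A B C (c, rel_class2 X A c f) = rho_class X A B C f"
  unfolding natural_map_def prod.case
  by (rule the_elem_constant_image[OF rel_class2_refl[OF assms(1)]])
    (rule rho_class_eqI[OF rel_class2_homotopic[OF _ assms(2)]])

lemma rel_maps1_in_R: "f \<in> rel_maps1 X B c \<Longrightarrow> c \<in> C \<Longrightarrow> f \<in> R"
  using triad.rel_maps2_in_R[OF triad_swap, of "reflect f" c] by (simp add: rel_maps1_iff_reflect)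

lemma natural_map_rel1:
  assumes "f \<in> rel_maps1 X B c" "c \<in> C"
  shows "natural_map X A B C (c, rel_class1 X B c f) = rho_class X A B C f"
  unfolding natural_map_def prod.case
proof (rule the_elem_constant_image[OF rel_class1_refl[OF assms(1)]])
  fix g assume "g \<in> rel_class1 X B c f"
  then have "rho_homotopic X B A C (reflect f) (reflect g)"
    by (intro triad.rel_class2_homotopic[OF triad_swap _ assms(2)]) (simp add: rel_class1_iff_reflect)
  then have "f \<simeq> g" using rho_homotopic_reflect[of X A B C "reflect f" "reflect g"] by simp
  then show "rho_class X A B C g = rho_class X A B C f" by (rule rho_class_eqI)
qed

end

context pi2_triad begin

theorem natural_hom2:
  "groupoid_hom (rel_pi2_2 X A C) (rho1 X A B C) (Ide (fundamental_groupoid B C)) (natural_map X A B C)"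
  unfolding groupoid_hom_def
proof (intro conjI ballI impI)
  let ?G = "rel_pi2_2 X A C" and ?N = "natural_map X A B C" and ?I = "Ide (fundamental_groupoid B C)"
  have const: "(\<lambda>_. c) \<in> paths_on B C" if "c \<in> C" for c using const_in_paths_on that C_sub_B by blast
  have Arr: "Arr ?G = (SIGMA c:C. rel_class2 X A c ` rel_maps2 X A c)" and st: "Src ?G = fst" "Tgt ?G = fst"
    and Obj: "Obj ?G = C" by (simp_all add: rel_pi2_2_def)
  show "?I \<in> Obj ?G \<rightarrow> Obj (rho1 X A B C)"
    using const by (auto simp: Obj rho1_def fundamental_groupoid_simps)
  show "?N \<in> Arr ?G \<rightarrow> Arr (rho1 X A B C)"
    using rel_maps2_in_R by (auto simp: Arr natural_map_rel2 rho1_def rho_def)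
  show "?N (Ide ?G c) = Ide (rho1 X A B C) (?I c)" if c: "c \<in> Obj ?G" for c
  proof -
    have cC: "c \<in> C" using c by (simp add: Obj)
    then have cX: "c \<in> A" "c \<in> X" using C_sub_A A_sub by blast+
    have "(\<lambda>_. c) \<in> rel_maps2 X A c" using cX by (simp add: rel_maps2_iff)
    then have "?N (Ide ?G c) = rho_class X A B C (\<lambda>_. c)"
      using natural_map_rel2[OF _ cC] by (simp add: rel_pi2_2_def)
    moreover have "degenerate1 (\<lambda>_. c) = (\<lambda>_. c)" by (auto simp: degenerate1_def)
    ultimately show ?thesis
      using Ide_rho1[OF const[OF cC]] by (simp add: fundamental_groupoid_simps)
  qed
  fix x assume "x \<in> Arr ?G"
  then obtain c f where c: "c \<in> C" and f: "f \<in> rel_maps2 X A c" and x: "x = (c, rel_class2 X A c f)"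
    by (auto simp: Arr)
  have fR: "f \<in> R" by (rule rel_maps2_in_R[OF f c])
  have edge: "path_class B (edge1 e f) = path_class B (\<lambda>_. c)" if "e \<in> {0, 1}" for e
    by (rule path_class_cong[OF edge1_in_paths_on[OF fR that]])
      (use rel_maps2D(4)[OF f] that in \<open>auto simp: edge1_def\<close>)
  show "Src (rho1 X A B C) (?N x) = ?I (Src ?G x)" "Tgt (rho1 X A B C) (?N x) = ?I (Tgt ?G x)"
    using f c fR edge by (simp_all add: x st natural_map_rel2 Src_rho1 Tgt_rho1 fundamental_groupoid_simps)
  fix y assume yA: "y \<in> Arr ?G" and xy: "Tgt ?G x = Src ?G y"
  have "fst y = c" using xy by (simp add: st x)
  then obtain g where g: "g \<in> rel_maps2 X A c" and y: "y = (c, rel_class2 X A c g)"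
    using yA unfolding Arr by (cases y) auto
  show "?N (Cmp ?G x y) = Cmp (rho1 X A B C) (?N x) (?N y)"
  proof -
    have "?N (Cmp ?G x y) = rho_class X A B C (glue1 f g)"
      unfolding x y Cmp_rel_pi2_2[OF f g] by (rule natural_map_rel2[OF glue1_rel_maps2[OF f g] c])
    also have "\<dots> = Cmp (rho1 X A B C) (rho_class X A B C f) (rho_class X A B C g)"
      by (rule Cmp_rho1[symmetric, OF fR rel_maps2_in_R[OF g c]])
        (use rel_maps2D(4)[OF f] rel_maps2D(4)[OF g] in simp)
    finally show ?thesis by (simp add: x y natural_map_rel2 f g c)
  qed
qed

theorem natural_hom1:
  "groupoid_hom (rel_pi2_1 X B C) (rho2 X A B C) (Ide (fundamental_groupoid A C)) (natural_map X A B C)"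
  unfolding groupoid_hom_def
proof (intro conjI ballI impI)
  let ?G = "rel_pi2_1 X B C" and ?N = "natural_map X A B C" and ?I = "Ide (fundamental_groupoid A C)"
  have const: "(\<lambda>_. c) \<in> paths_on A C" if "c \<in> C" for c using const_in_paths_on that C_sub_A by blast
  have Arr: "Arr ?G = (SIGMA c:C. rel_class1 X B c ` rel_maps1 X B c)" and st: "Src ?G = fst" "Tgt ?G = fst"
    and Obj: "Obj ?G = C" by (simp_all add: rel_pi2_1_def)
  show "?I \<in> Obj ?G \<rightarrow> Obj (rho2 X A B C)"
    using const by (auto simp: Obj rho2_def fundamental_groupoid_simps)
  show "?N \<in> Arr ?G \<rightarrow> Arr (rho2 X A B C)"
    using rel_maps1_in_R by (auto simp: Arr natural_map_rel1 rho2_def rho_def)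
  show "?N (Ide ?G c) = Ide (rho2 X A B C) (?I c)" if c: "c \<in> Obj ?G" for c
  proof -
    have cC: "c \<in> C" using c by (simp add: Obj)
    then have cX: "c \<in> B" "c \<in> X" using C_sub_B B_sub by blast+
    have "(\<lambda>_. c) \<in> rel_maps1 X B c" using cX by (simp add: rel_maps1_iff_reflect rel_maps2_iff reflect_def)
    then have "?N (Ide ?G c) = rho_class X A B C (\<lambda>_. c)"
      using natural_map_rel1[OF _ cC] by (simp add: rel_pi2_1_def)
    moreover have "degenerate2 (\<lambda>_. c) = (\<lambda>_. c)" by (auto simp: degenerate2_def)
    ultimately show ?thesis
      using Ide_rho2[OF const[OF cC]] by (simp add: fundamental_groupoid_simps)
  qed
  fix x assume "x \<in> Arr ?G"
  then obtain c f where c: "c \<in> C" and f: "f \<in> rel_maps1 X B c" and x: "x = (c, rel_class1 X B c f)"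
    by (auto simp: Arr)
  have fR: "f \<in> R" by (rule rel_maps1_in_R[OF f c])
  have side: "h (s, 1) = c \<and> h (s, 0) = c" if "h \<in> rel_maps1 X B c" "s \<in> {0..1}" for h s
    using rel_maps2D(4)[of "reflect h" X B c s] that by (simp add: rel_maps1_iff_reflect)
  have edge: "path_class A (edge2 e f) = path_class A (\<lambda>_. c)" if "e \<in> {0, 1}" for e
    by (rule path_class_cong[OF edge2_in_paths_on[OF fR that]])
      (use side[OF f] that in \<open>auto simp: edge2_def\<close>)
  show "Src (rho2 X A B C) (?N x) = ?I (Src ?G x)" "Tgt (rho2 X A B C) (?N x) = ?I (Tgt ?G x)"
    using f c fR edge by (simp_all add: x st natural_map_rel1 Src_rho2 Tgt_rho2 fundamental_groupoid_simps)
  fix y assume yA: "y \<in> Arr ?G" and xy: "Tgt ?G x = Src ?G y"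
  have "fst y = c" using xy by (simp add: st x)
  then obtain g where g: "g \<in> rel_maps1 X B c" and y: "y = (c, rel_class1 X B c g)"
    using yA unfolding Arr by (cases y) auto
  show "?N (Cmp ?G x y) = Cmp (rho2 X A B C) (?N x) (?N y)"
  proof -
    have "?N (Cmp ?G x y) = rho_class X A B C (glue2 f g)"
      unfolding x y Cmp_rel_pi2_1[OF f g] by (rule natural_map_rel1[OF glue2_rel_maps1[OF f g] c])
    also have "\<dots> = Cmp (rho2 X A B C) (rho_class X A B C f) (rho_class X A B C g)"
      by (rule Cmp_rho2[symmetric, OF fR rel_maps1_in_R[OF g c]]) (simp add: side[OF f] side[OF g])
    finally show ?thesis by (simp add: x y natural_map_rel1 f g c)
  qed
qed

text \<open>
  Only the top and bottom faces of the given cube fail to lie in \<open>A\<close>.  Since \<open>f\<close> and \<open>g\<close> are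
  constant on the top and bottom edges, these faces are spheres in \<open>B\<close>; homotopies \<open>N\<close>, \<open>M\<close> to
  spheres \<open>k\<close>, \<open>l\<close> in \<open>A\<close> are attached above and below the cube.
\<close>

lemma rel_class2_of_homotopic:
  assumes c: "c \<in> C" and f: "f \<in> rel_maps2 X A c" and g: "g \<in> rel_maps2 X A c" and fg: "f \<simeq> g"
  shows "g \<in> rel_class2 X A c f"
proof -
  have cA: "c \<in> A" using c C_sub_A by blast
  note f' = rel_maps2D[OF f] and g' = rel_maps2D[OF g]
  obtain H where H: "rho_homotopy X A B C H"
    and Hends: "\<And>a b. a \<in> {0..1} \<Longrightarrow> b \<in> {0..1} \<Longrightarrow> H 0 a b = f (a, b) \<and> H 1 a b = g (a, b)"
    using fg unfolding rho_homotopic_iff by blast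
  note h = rho_homotopyD[OF H]
  have Hc: "H t a b = c" if "t \<in> {0..1}" "a \<in> {0, 1}" "b \<in> {0, 1}" for t a b
    using h(5)[OF that(1)] that(2,3) Hends[of a b] f'(4)[of b] by auto
  have slice: "(\<lambda>(t, s). H t e s) \<in> pi2_maps B c" if e: "e \<in> {0, 1}" for e
    unfolding pi2_maps_iff
  proof (intro conjI ballI)
    have "continuous_on unit_square (\<lambda>x. H (fst x) e (snd x))"
      by (intro continuous_on_cube_compose[OF h(1)] continuous_intros) (use e in auto)
    then show "continuous_on unit_square (\<lambda>(t, s). H t e s)" by (simp add: case_prod_unfold)
    fix s :: real assume s: "s \<in> {0..1}"
    show "(\<lambda>(t, s). H t e s) (0, s) = c" "(\<lambda>(t, s). H t e s) (1, s) = c"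
      using Hends[of e s] f'(4)[OF s] g'(4)[OF s] s e by auto
    show "(\<lambda>(t, s). H t e s) (s, 0) = c" "(\<lambda>(t, s). H t e s) (s, 1) = c" using Hc s e by auto
  qed (use h(3) e in auto)
  have fill: "\<exists>k N. k \<in> pi2_maps A c \<and> continuous_cube N \<and>
      (\<forall>r\<in>{0..1}. \<forall>t\<in>{0..1}. \<forall>s\<in>{0..1}. N r t s \<in> X) \<and>
      (\<forall>r\<in>{0..1}. \<forall>s\<in>{0..1}. N r 0 s = c \<and> N r 1 s = c \<and> N r s 0 = c \<and> N r s 1 = c) \<and>
      (\<forall>t\<in>{0..1}. \<forall>s\<in>{0..1}. N 0 t s = H t e s \<and> N 1 t s = k (t, s))" if e: "e \<in> {0, 1}" for e
  proof -
    obtain k where k: "k \<in> pi2_maps A c" "k \<in> pi2_class X c (\<lambda>(t, s). H t e s)"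
      using pi2_replace[OF c slice[OF e]] by blast
    obtain N where "continuous_cube N"
      "\<And>r t s. r \<in> {0..1} \<Longrightarrow> t \<in> {0..1} \<Longrightarrow> s \<in> {0..1} \<Longrightarrow> N r t s \<in> X"
      "\<And>r s. r \<in> {0..1} \<Longrightarrow> s \<in> {0..1} \<Longrightarrow> N r 0 s = c \<and> N r 1 s = c \<and> N r s 0 = c \<and> N r s 1 = c"
      "\<And>t s. t \<in> {0..1} \<Longrightarrow> s \<in> {0..1} \<Longrightarrow> N 0 t s = (\<lambda>(t, s). H t e s) (t, s) \<and> N 1 t s = k (t, s)"
      using pi2_class_cube[OF k(2)] by blast
    then show ?thesis using k(1) unfolding prod.case by blast
  qed
  obtain k N where k: "k \<in> pi2_maps A c" and N: "continuous_cube N"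
      "\<forall>r\<in>{0..1}. \<forall>t\<in>{0..1}. \<forall>s\<in>{0..1}. N r t s \<in> X"
      "\<forall>r\<in>{0..1}. \<forall>s\<in>{0..1}. N r 0 s = c \<and> N r 1 s = c \<and> N r s 0 = c \<and> N r s 1 = c"
      "\<forall>t\<in>{0..1}. \<forall>s\<in>{0..1}. N 0 t s = H t 0 s \<and> N 1 t s = k (t, s)"
    using fill[of 0] by blast
  obtain l M where l: "l \<in> pi2_maps A c" and M: "continuous_cube M"
      "\<forall>r\<in>{0..1}. \<forall>t\<in>{0..1}. \<forall>s\<in>{0..1}. M r t s \<in> X"
      "\<forall>r\<in>{0..1}. \<forall>s\<in>{0..1}. M r 0 s = c \<and> M r 1 s = c \<and> M r s 0 = c \<and> M r s 1 = c"
      "\<forall>t\<in>{0..1}. \<forall>s\<in>{0..1}. M 0 t s = H t 1 s \<and> M 1 t s = l (t, s)"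
    using fill[of 1] by blast
  \<comment> \<open>The time of \<open>H\<close> is the first coordinate of the faces, and the time of \<open>N\<close> and \<open>M\<close> becomes the
    vertical coordinate; \<open>N\<close> is run backwards so that \<open>k\<close> is the new top face.\<close>
  define K where "K = (\<lambda>t a b. if a \<le> 1/3 then N (clip (1 - 3 * a)) t b
    else if a \<le> 2/3 then H t (clip (3 * a - 1)) b else M (clip (3 * a - 2)) t b)"
  have K0: "K t 0 s = k (t, s)" and K1: "K t 1 s = l (t, s)" if "t \<in> {0..1}" "s \<in> {0..1}" for t s
    using N(4) M(4) that by (simp_all add: K_def clip_eq_1)
  have cK: "continuous_cube K"
    unfolding K_def
  proof (intro continuous_cubeI continuous_on_cases_le)
    show "continuous_on {x \<in> {0..1::real} \<times> unit_square. fst (snd x) \<le> 1/3}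
        (\<lambda>x. N (clip (1 - 3 * fst (snd x))) (fst x) (snd (snd x)))"
      by (intro continuous_on_cube_compose[OF N(1)] continuous_intros) auto
    show "continuous_on {x \<in> {x \<in> {0..1::real} \<times> unit_square. 1/3 \<le> fst (snd x)}. fst (snd x) \<le> 2/3}
        (\<lambda>x. H (fst x) (clip (3 * fst (snd x) - 1)) (snd (snd x)))"
      by (intro continuous_on_cube_compose[OF h(1)] continuous_intros) auto
    show "continuous_on {x \<in> {x \<in> {0..1::real} \<times> unit_square. 1/3 \<le> fst (snd x)}. 2/3 \<le> fst (snd x)}
        (\<lambda>x. M (clip (3 * fst (snd x) - 2)) (fst x) (snd (snd x)))"
      by (intro continuous_on_cube_compose[OF M(1)] continuous_intros) auto
    show "N (clip (1 - 3 * fst (snd x))) (fst x) (snd (snd x)) =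
        (if fst (snd x) \<le> 2/3 then H (fst x) (clip (3 * fst (snd x) - 1)) (snd (snd x))
         else M (clip (3 * fst (snd x) - 2)) (fst x) (snd (snd x)))"
      if "x \<in> {0..1::real} \<times> unit_square" "fst (snd x) = 1/3" for x
      using that N(4) by (auto simp: clip_eq_0)
    show "H (fst x) (clip (3 * fst (snd x) - 1)) (snd (snd x)) = M (clip (3 * fst (snd x) - 2)) (fst x) (snd (snd x))"
      if "x \<in> {x \<in> {0..1::real} \<times> unit_square. 1/3 \<le> fst (snd x)}" "fst (snd x) = 2/3" for x
      using that M(4) by (auto simp: clip_eq_0 clip_eq_1)
  qed (intro continuous_intros)+
  let ?st = "\<lambda>h. (\<lambda>(a, b). h (clip (3 * a - 1), b)) :: 'a square"
  have stretch: "?st h \<in> rel_class2 X A c h" if h: "h \<in> rel_maps2 X A c" for h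
  proof -
    have "(\<lambda>(a, b). h ((1 - 1) * a + 1 * clip (3 * a - 1), b)) \<in> rel_class2 X A c h"
    proof (rule rel_class2_push[OF h cA, of "\<lambda>t a b. (1 - t) * a + t * clip (3 * a - 1)" "\<lambda>t a b. b"])
      show "(1 - t) * a + t * clip (3 * a - 1) \<in> {0..1} \<and> b \<in> {0..1}"
        if "t \<in> {0..1}" "a \<in> {0..1}" "b \<in> {0..1}" for t a b
        using convex_combination_unit[OF that(1,2), of "clip (3 * a - 1)"] that(3) by simp
    qed (auto simp: clip_eq_0 clip_eq_1 intro!: continuous_cubeI continuous_intros)
    then show ?thesis by simp
  qed
  have "?st g \<in> rel_class2 X A c (?st f)"
  proof (rule rel_class2_compression[OF _ _ cA cK])
    show "?st f \<in> rel_maps2 X A c" "?st g \<in> rel_maps2 X A c"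
      using rel_class2_memD stretch f g by blast+
    show "K t a b \<in> X" if "t \<in> {0..1}" "a \<in> {0..1}" "b \<in> {0..1}" for t a b
      using that h(2) N(2) M(2) by (simp add: K_def)
    show "K t 0 s \<in> A \<and> K t 1 s \<in> A \<and> K t s 0 \<in> A \<and> K t s 1 \<in> A" if "t \<in> {0..1}" "s \<in> {0..1}" for t s
      using k l that h(4) N(3) M(3) cA by (simp add: K0 K1 pi2_maps_iff) (simp add: K_def)
    show "K t 0 0 = c \<and> K t 0 1 = c \<and> K t 1 0 = c \<and> K t 1 1 = c" if "t \<in> {0..1}" for t
      using k l that by (simp add: K0 K1 pi2_maps_iff)
    show "K 0 a b = ?st f (a, b) \<and> K 1 a b = ?st g (a, b)" if "a \<in> {0..1}" "b \<in> {0..1}" for a b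
    proof -
      have N': "N (clip x) 0 b = c \<and> N (clip x) 1 b = c" "M (clip x) 0 b = c \<and> M (clip x) 1 b = c" for x
        using N(3) M(3) that by simp_all
      consider "a \<le> 1/3" | "\<not> a \<le> 1/3" "a \<le> 2/3" | "\<not> a \<le> 1/3" "\<not> a \<le> 2/3" by linarith
      then show ?thesis
        by cases (use N' f'(4)[OF that(2)] g'(4)[OF that(2)] Hends[of "clip (3 * a - 1)" b] that
            in \<open>simp_all add: K_def clip_eq_0 clip_eq_1\<close>)
    qed
  qed
  then show ?thesis using stretch[OF f] stretch[OF g] rel_class2_trans rel_class2_sym by metis
qed

theorem natural_inj2: "inj_on (natural_map X A B C) (Arr (rel_pi2_2 X A C))"
proof (rule inj_onI)
  fix x y assume "x \<in> Arr (rel_pi2_2 X A C)" "y \<in> Arr (rel_pi2_2 X A C)"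
    and eq: "natural_map X A B C x = natural_map X A B C y"
  then obtain c f d g where c: "c \<in> C" and f: "f \<in> rel_maps2 X A c" and x: "x = (c, rel_class2 X A c f)"
    and d: "d \<in> C" and g: "g \<in> rel_maps2 X A d" and y: "y = (d, rel_class2 X A d g)"
    by (auto simp: rel_pi2_2_def)
  have "rho_class X A B C f = rho_class X A B C g" using eq c d f g by (simp add: x y natural_map_rel2)
  then have gf: "g \<simeq> f" using rho_class_eq_iff[OF rel_maps2_in_R[OF f c]] by blast
  have "c = d" using rho_homotopic_memD(3)[OF gf, of "(0, 0)"] rel_maps2D(4)[OF f, of 0] rel_maps2D(4)[OF g, of 0] by simp
  then show "x = y" using rel_class2_eq[OF rel_class2_of_homotopic[OF d g _ gf]] f by (simp add: x y)
qed

theorem natural_inj1: "inj_on (natural_map X A B C) (Arr (rel_pi2_1 X B C))"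
proof (rule inj_onI)
  fix x y assume "x \<in> Arr (rel_pi2_1 X B C)" "y \<in> Arr (rel_pi2_1 X B C)"
    and eq: "natural_map X A B C x = natural_map X A B C y"
  then obtain c f d g where c: "c \<in> C" and f: "f \<in> rel_maps1 X B c" and x: "x = (c, rel_class1 X B c f)"
    and d: "d \<in> C" and g: "g \<in> rel_maps1 X B d" and y: "y = (d, rel_class1 X B d g)"
    by (auto simp: rel_pi2_1_def)
  note f' = f[unfolded rel_maps1_iff_reflect] and g' = g[unfolded rel_maps1_iff_reflect]
  have "rho_class X A B C f = rho_class X A B C g" using eq c d f g by (simp add: x y natural_map_rel1)
  then have gf: "g \<simeq> f" using rho_class_eq_iff[OF rel_maps1_in_R[OF f c]] by blast
  then have gf': "rho_homotopic X B A C (reflect g) (reflect f)" by simp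
  have "c = d" using rho_homotopic_memD(3)[OF gf', of "(0, 0)"] rel_maps2D(4)[OF f', of 0] rel_maps2D(4)[OF g', of 0]
    by simp
  moreover from this have "f \<in> rel_class1 X B d g"
    using pi2_triad.rel_class2_of_homotopic[OF pi2_triad_swap d g' _ gf'] f' by (simp add: rel_class1_iff_reflect)
  ultimately show "x = y" using rel_class1_eq by (simp add: x y)
qed

end

theorem theorem2p1:
  fixes X A B C :: "'a::topological_space set"
  assumes "A \<subseteq> X" and "B \<subseteq> X" and "C \<subseteq> A \<inter> B"
    and "\<And>c. c \<in> C \<Longrightarrow> pi2_induced X c ` pi2 A c = pi2_induced X c ` pi2 B c"
  shows "composition1_inherited X A B C \<and> composition2_inherited X A B C \<and>
    double_groupoid (fundamental_groupoid A C) (fundamental_groupoid B C)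
      (rho1 X A B C) (rho2 X A B C) \<and>
    groupoid_hom (rel_pi2_2 X A C) (rho1 X A B C)
      (Ide (fundamental_groupoid B C)) (natural_map X A B C) \<and>
    inj_on (natural_map X A B C) (Arr (rel_pi2_2 X A C)) \<and>
    groupoid_hom (rel_pi2_1 X B C) (rho2 X A B C)
      (Ide (fundamental_groupoid A C)) (natural_map X A B C) \<and>
    inj_on (natural_map X A B C) (Arr (rel_pi2_1 X B C))"
proof -
  interpret pi2_triad X A B C using assms by unfold_locales auto
  show ?thesis
    using composition1_inherited composition2_inherited double_groupoid_rho
      natural_hom2 natural_inj2 natural_hom1 natural_inj1 by blast
qed

end
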